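(* Let $\Omega_0\subset\mathbb{C}$ be the unit disk. There exists a $C^\infty$ subharmonic function $\varphi$ on $\Omega_0$ such that $$\sup_{n}\lambda^{\mathrm e}_{n\varphi}<\infty\quad\text{but}\quad\limsup_{n\to\infty}\lambda^{\mathrm m}_{n\varphi}=\infty .$$
   Context: For a subharmonic function $\psi$ on $\Omega_0$ with $\nabla\psi\in L^2_{\mathrm{loc}}(\Omega_0)$, set $D_\psi=(\partial_x+i\psi_y,\ \partial_y-i\psi_x)$ and $$\lambda^{\mathrm m}_\psi=\inf\Big\{\int_{\Omega_0}|D_\psi u|^2+\int_{\Omega_0}\Delta\psi\,|u|^2:\ u\in C_0^\infty(\Omega_0),\ \|u\|_{L^2(\Omega_0)}=1\Big\},$$ $$\lambda^{\mathrm e}_\psi=\inf\Big\{\int_{\Omega_0}|\nabla u|^2+\int_{\Omega_0}\Delta\psi\,|u|^2:\ u\in C_0^\infty(\Omega_0),\ \|u\|_{L^2(\Omega_0)}=1\Big\},$$ with complex-valued $u$. The index $n$ runs over positive integers. *)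

theory Defs
  imports "HOL-Analysis.Analysis"
begin

text \<open>The plane is the type \<^typ>\<open>complex\<close> seen as a real normed space; all derivatives below are
  real derivatives, and area integrals are Lebesgue integrals with respect to \<open>lborel\<close>.\<close>

primrec Ck_on :: "nat \<Rightarrow> 'a::real_normed_vector set \<Rightarrow> ('a \<Rightarrow> 'b::real_normed_vector) \<Rightarrow> bool" where
  "Ck_on 0 S f \<longleftrightarrow> continuous_on S f"
| "Ck_on (Suc k) S f \<longleftrightarrow>
     (\<forall>x\<in>S. f differentiable at x) \<and> (\<forall>v. Ck_on k S (\<lambda>x. frechet_derivative f (at x) v))"

text \<open>Meant for open \<open>S\<close>.\<close>

definition smooth_on :: "'a::real_normed_vector set \<Rightarrow> ('a \<Rightarrow> 'b::real_normed_vector) \<Rightarrow> bool" where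
  "smooth_on S f \<longleftrightarrow> (\<forall>k. Ck_on k S f)"

definition partial_x :: "(complex \<Rightarrow> 'b::real_normed_vector) \<Rightarrow> complex \<Rightarrow> 'b" where
  "partial_x f z = frechet_derivative f (at z) 1"

definition partial_y :: "(complex \<Rightarrow> 'b::real_normed_vector) \<Rightarrow> complex \<Rightarrow> 'b" where
  "partial_y f z = frechet_derivative f (at z) \<i>"

definition laplacian :: "(complex \<Rightarrow> real) \<Rightarrow> complex \<Rightarrow> real" where
  "laplacian f z = partial_x (partial_x f) z + partial_y (partial_y f) z"

text \<open>Subharmonicity of a finite-valued function: upper semicontinuity and the sub-mean value
  inequality on circles. The circle means of a finite-valued subharmonic function are finite, so
  demanding integrability only prevents the integral from taking its default value.\<close>

definition subharmonic_on :: "complex set \<Rightarrow> (complex \<Rightarrow> real) \<Rightarrow> bool" where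
  "subharmonic_on S f \<longleftrightarrow>
     (\<forall>c. openin (top_of_set S) {z \<in> S. f z < c}) \<and>
     (\<forall>a r. 0 < r \<and> cball a r \<subseteq> S \<longrightarrow>
        (\<lambda>\<theta>. f (a + of_real r * cis \<theta>)) integrable_on {0..2 * pi} \<and>
        f a \<le> 1 / (2 * pi) * integral {0..2 * pi} (\<lambda>\<theta>. f (a + of_real r * cis \<theta>)))"

text \<open>\<open>C\<^sub>0\<^sup>\<infinity>(S)\<close>, complex-valued: smooth with compact support in \<open>S\<close>. Values outside \<open>S\<close> are
  irrelevant here and below.\<close>

definition test_functions :: "complex set \<Rightarrow> (complex \<Rightarrow> complex) set" where
  "test_functions S =
     {u. smooth_on S u \<and> compact (closure (support_on S u)) \<and> closure (support_on S u) \<subseteq> S}"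

definition L2_norm_on :: "complex set \<Rightarrow> (complex \<Rightarrow> complex) \<Rightarrow> real" where
  "L2_norm_on S u = sqrt (LINT z:S|lborel. (cmod (u z))\<^sup>2)"

text \<open>Values are pairs in \<open>\<complex>\<^sup>2\<close>; the norm of the product type is the Hermitian one.\<close>

definition gradient :: "(complex \<Rightarrow> complex) \<Rightarrow> complex \<Rightarrow> complex \<times> complex" where
  "gradient u z = (partial_x u z, partial_y u z)"

definition magnetic_gradient ::
    "(complex \<Rightarrow> real) \<Rightarrow> (complex \<Rightarrow> complex) \<Rightarrow> complex \<Rightarrow> complex \<times> complex" where
  "magnetic_gradient \<psi> u z =
     (partial_x u z + \<i> * of_real (partial_y \<psi> z) * u z,
      partial_y u z - \<i> * of_real (partial_x \<psi> z) * u z)"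

text \<open>The magnetic and electric ground state energies. They are stated with classical derivatives
  of the potential, hence are meant for smooth \<open>\<psi>\<close>, where these agree with the distributional
  ones. The infima are taken in \<^typ>\<open>ereal\<close>.\<close>

definition lambda_m :: "complex set \<Rightarrow> (complex \<Rightarrow> real) \<Rightarrow> ereal" where
  "lambda_m S \<psi> =
     (INF u \<in> {u \<in> test_functions S. L2_norm_on S u = 1}.
        ereal ((LINT z:S|lborel. (norm (magnetic_gradient \<psi> u z))\<^sup>2)
             + (LINT z:S|lborel. laplacian \<psi> z * (cmod (u z))\<^sup>2)))"

definition lambda_e :: "complex set \<Rightarrow> (complex \<Rightarrow> real) \<Rightarrow> ereal" where
  "lambda_e S \<psi> =
     (INF u \<in> {u \<in> test_functions S. L2_norm_on S u = 1}.
        ereal ((LINT z:S|lborel. (norm (gradient u z))\<^sup>2)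
             + (LINT z:S|lborel. laplacian \<psi> z * (cmod (u z))\<^sup>2)))"

end

theory Submission
  imports Defs
begin

text \<open>
  The proof exploits the Aharonov--Bohm effect. A magnetic field that is concentrated on tiny disks is
  nearly invisible for the electric energy, because the disks have small capacity, but the magnetic
  energy feels the flux through the disks modulo \<open>2\<pi>\<close>, and a fine lattice of disks with flux \<open>\<pi>\<close> forces it
  to be large. The potential is a sum \<open>\<Phi> = \<Sum>\<^sub>k \<phi>\<^sub>k\<close>. The Laplacian of \<open>\<phi>\<^sub>k\<close> consists of equal blobs around the points
  of a square lattice with mesh \<open>\<epsilon>\<^sub>k\<close>, and there are numbers \<open>n\<^sub>k \<rightarrow> \<infinity>\<close> such that \<open>n\<^sub>k \<Delta>\<phi>\<^sub>k\<close> has flux exactly \<open>\<pi>\<close>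
  through every square of side \<open>\<epsilon>\<^sub>k\<close>, wherever its corner is (\<open>square_flux_lattice_density\<close>).

  To bound the magnetic energy at \<open>n = n\<^sub>k\<close> from below, let \<open>\<beta>\<close> be the Laplacian of the stages before \<open>k\<close>. If the
  \<open>\<epsilon>\<^sub>k\<close>-square with corner \<open>z\<close> does not meet \<open>{\<beta> > 0}\<close>, its total flux is between \<open>\<pi>\<close> and \<open>\<pi> + 1\<close>, and parallel transport around the square shows that
  \<open>|u(z)|\<^sup>2\<close> is at most a constant times \<open>\<epsilon>\<^sub>k\<close> times the integral of \<open>|D u|\<^sup>2\<close> over its boundary (\<open>square_transport\<close>).
  Integrating over \<open>z\<close> bounds the mass of \<open>u\<close> on the set of these \<open>z\<close> by \<open>4 \<epsilon>\<^sub>k\<^sup>2 \<integral>|D u|\<^sup>2\<close>. Where \<open>n\<^sub>k \<beta>\<close> is large, the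
  term \<open>\<integral> \<Delta>(n\<^sub>k \<Phi>) |u|\<^sup>2\<close> controls the mass. What remains is a set whose measure is as small as desired, since
  \<open>{\<beta> > 0}\<close> is bounded by circles and \<open>n\<^sub>k\<close> is chosen after \<open>\<beta>\<close> and \<open>\<epsilon>\<^sub>k\<close>; on it the mass is controlled by an
  \<open>L\<^sup>4\<close> bound (\<open>ladyzhenskaya\<close>). The three estimates are combined in \<open>lambda_m_ge\<close>.

  The electric energy stays bounded because points have zero capacity (\<open>capacity_cutoff\<close>):
  for each lattice the radius of the blobs can be chosen so small that a given trial function can be modified to vanish on the blobs at an arbitrarily small
  cost (\<open>trial_remove_points\<close>). This gives trial functions \<open>v\<^sub>k\<close> with uniformly bounded Rayleigh quotients that
  vanish where the first \<open>k\<close> stages have positive Laplacian. For a given \<open>n\<close>, the later stages add at most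
  \<open>1 / n\<close> to the Laplacian if \<open>k\<close> is large, and \<open>v\<^sub>k\<close> shows that \<open>\<lambda>\<^sup>e\<close> is bounded (\<open>lambda_e_le\<close>).

  The size of \<open>\<phi>\<^sub>k\<close> is proportional to \<open>1 / n\<^sub>k\<close>, and \<open>n\<^sub>k\<close> is the last number chosen in a
  stage (\<open>next_stage\<close>). So the series converges with all its derivatives (\<open>partials_suminf\<close>), and later stages do not
  spoil the flux conditions of earlier ones. Finally \<open>\<Phi>\<close> is subharmonic since its Laplacian is nonnegative
  (\<open>subharmonic_on_laplacian_nonneg\<close>).
\<close>

section \<open>Functions with continuous derivatives of all orders\<close>

lemma Ck_on_cong:
  assumes "open S" "\<And>x. x \<in> S \<Longrightarrow> f x = g x" "Ck_on k S f"
  shows "Ck_on k S g"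
  using assms(2,3)
proof (induction k arbitrary: f g)
  case 0
  then show ?case by (auto cong: continuous_on_cong)
next
  case (Suc k)
  have fd: "frechet_derivative f (at x) = frechet_derivative g (at x)" if "x \<in> S" for x
    using frechet_derivative_transform_within_open[of f x S g] Suc.prems that \<open>open S\<close> by auto
  have "g differentiable at x" if "x \<in> S" for x
    using Suc.prems that \<open>open S\<close> has_derivative_transform_within_open[of f _ x UNIV S g]
    unfolding differentiable_def by (metis Ck_on.simps(2) differentiable_def)
  moreover have "Ck_on k S (\<lambda>x. frechet_derivative g (at x) v)" for v
    using Suc.IH[of "\<lambda>x. frechet_derivative f (at x) v" "\<lambda>x. frechet_derivative g (at x) v"]
      fd Suc.prems by auto
  ultimately show ?case by auto
qed

lemma Ck_on_SucI:
  assumes "open S" "\<And>x. x \<in> S \<Longrightarrow> (f has_derivative f' x) (at x)" "\<And>v. Ck_on k S (\<lambda>x. f' x v)"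
  shows "Ck_on (Suc k) S f"
proof -
  have "Ck_on k S (\<lambda>x. frechet_derivative f (at x) v)" for v
    by (rule Ck_on_cong[OF assms(1) _ assms(3)[of v]]) (use assms(2) frechet_derivative_at in metis)
  then show ?thesis using assms(2) by (auto simp: differentiable_def)
qed

lemma Ck_on_SucD:
  assumes "Ck_on (Suc k) S f"
  shows "Ck_on k S f"
  using assms
proof (induction k arbitrary: f)
  case 0
  then show ?case
    using continuous_at_imp_continuous_on differentiable_imp_continuous_within unfolding Ck_on.simps by metis
next
  case (Suc k)
  then show ?case by (metis Ck_on.simps(2))
qed

lemma Ck_on_derivD:
  assumes "Ck_on (Suc k) S f" "x \<in> S"
  shows "(f has_derivative frechet_derivative f (at x)) (at x)"
  using assms frechet_derivative_works by auto

lemma Ck_on_subset: "Ck_on k S f \<Longrightarrow> T \<subseteq> S \<Longrightarrow> Ck_on k T f"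
  by (induction k arbitrary: f) (auto intro: continuous_on_subset)

lemma Ck_on_Un:
  assumes "open S" "open T" "Ck_on k S f" "Ck_on k T f"
  shows "Ck_on k (S \<union> T) f"
  using assms(3,4)
proof (induction k arbitrary: f)
  case 0
  then show ?case using continuous_on_open_Un[OF assms(1,2)] by simp
next
  case (Suc k)
  then show ?case by (simp add: ball_Un)
qed

lemma Ck_on_const: "Ck_on k S (\<lambda>x. c)"
proof (induction k arbitrary: c)
  case 0
  show ?case unfolding Ck_on.simps by (rule continuous_on_const)
next
  case (Suc k)
  show ?case unfolding Ck_on.simps frechet_derivative_const using Suc by (intro conjI ballI allI differentiable_const)
qed

lemma Ck_on_add:
  assumes "open S" "Ck_on k S f" "Ck_on k S g"
  shows "Ck_on k S (\<lambda>x. f x + g x)"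
  using assms(2,3)
proof (induction k arbitrary: f g)
  case 0
  then show ?case unfolding Ck_on.simps by (rule continuous_on_add)
next
  case (Suc k)
  show ?case
  proof (rule Ck_on_SucI[OF assms(1), where f' = "\<lambda>x v. frechet_derivative f (at x) v + frechet_derivative g (at x) v"])
    show "((\<lambda>x. f x + g x) has_derivative
        (\<lambda>v. frechet_derivative f (at x) v + frechet_derivative g (at x) v)) (at x)" if "x \<in> S" for x
      using Suc.prems that by (intro has_derivative_add Ck_on_derivD)
    show "Ck_on k S (\<lambda>x. frechet_derivative f (at x) v + frechet_derivative g (at x) v)" for v
      using Suc.prems unfolding Ck_on.simps by (intro Suc.IH) (elim conjE, erule spec)+
  qed
qed

lemma Ck_on_bounded_linear:
  assumes "open S" "bounded_linear h" "Ck_on k S f"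
  shows "Ck_on k S (\<lambda>x. h (f x))"
  using assms(3)
proof (induction k arbitrary: f)
  case 0
  then show ?case unfolding Ck_on.simps by (rule bounded_linear.continuous_on[OF assms(2)])
next
  case (Suc k)
  show ?case
  proof (rule Ck_on_SucI[OF assms(1), where f' = "\<lambda>x v. h (frechet_derivative f (at x) v)"])
    show "((\<lambda>x. h (f x)) has_derivative (\<lambda>v. h (frechet_derivative f (at x) v))) (at x)" if "x \<in> S" for x
      using Suc.prems that by (intro bounded_linear.has_derivative[OF assms(2)] Ck_on_derivD)
    show "Ck_on k S (\<lambda>x. h (frechet_derivative f (at x) v))" for v
      using Suc.prems unfolding Ck_on.simps by (intro Suc.IH) (elim conjE, erule spec)+
  qed
qed

lemma Ck_on_mult:
  fixes f g :: "'a::real_normed_vector \<Rightarrow> 'b::real_normed_algebra"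
  assumes "open S" "Ck_on k S f" "Ck_on k S g"
  shows "Ck_on k S (\<lambda>x. f x * g x)"
  using assms(2,3)
proof (induction k arbitrary: f g)
  case 0
  then show ?case unfolding Ck_on.simps by (rule continuous_on_mult)
next
  case (Suc k)
  show ?case
  proof (rule Ck_on_SucI[OF assms(1), where f' = "\<lambda>x v. f x * frechet_derivative g (at x) v + frechet_derivative f (at x) v * g x"])
    fix x assume "x \<in> S"
    then show "((\<lambda>x. f x * g x) has_derivative
        (\<lambda>v. f x * frechet_derivative g (at x) v + frechet_derivative f (at x) v * g x)) (at x)"
      using Suc.prems by (intro has_derivative_mult Ck_on_derivD) 
  next
    fix v
    show "Ck_on k S (\<lambda>x. f x * frechet_derivative g (at x) v + frechet_derivative f (at x) v * g x)"
      using Suc.prems by (intro Ck_on_add assms Suc.IH) (blast dest: Ck_on_SucD Ck_on.simps(2)[THEN iffD1])+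
  qed
qed

text \<open>The order of differentiation drops by one when the chain rule is applied, but the outer function
  changes from \<open>g\<close> to its derivative; hence the induction runs over all \<open>g\<close> at once.\<close>

lemma Ck_on_compose_real:
  fixes g :: "real \<Rightarrow> real" and N :: "'a::real_normed_vector \<Rightarrow> real"
  assumes "open S" "open T" "N ` S \<subseteq> T" "Ck_on k T g" "Ck_on k S N"
  shows "Ck_on k S (\<lambda>x. g (N x))"
  using assms(4,5)
proof (induction k arbitrary: g)
  case 0
  then show ?case using assms(3) unfolding Ck_on.simps by (rule continuous_on_compose2)
next
  case (Suc k)
  show ?case
  proof (rule Ck_on_SucI[OF assms(1), where f' = "\<lambda>x v. frechet_derivative g (at (N x)) 1 * frechet_derivative N (at x) v"])
    fix x assume x: "x \<in> S"
    have g: "(g has_derivative frechet_derivative g (at (N x))) (at (N x))"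
      using x assms(3) by (auto simp: image_subset_iff intro: Ck_on_derivD[OF Suc.prems(1)])
    have eq: "frechet_derivative g (at (N x)) t = frechet_derivative g (at (N x)) 1 * t" for t
      using linear_scale[OF has_derivative_linear[OF g], of t 1] by simp
    have N: "(N has_derivative frechet_derivative N (at x)) (at x)"
      by (rule Ck_on_derivD[OF Suc.prems(2) x])
    have "((\<lambda>x. g (N x)) has_derivative (\<lambda>v. frechet_derivative g (at (N x)) (frechet_derivative N (at x) v))) (at x)"
      using has_derivative_compose[OF N g] .
    then show "((\<lambda>x. g (N x)) has_derivative
        (\<lambda>v. frechet_derivative g (at (N x)) 1 * frechet_derivative N (at x) v)) (at x)"
      unfolding eq[of "frechet_derivative N (at x) _"] .
  next
    fix v
    have g': "Ck_on k T (\<lambda>t. frechet_derivative g (at t) 1)"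
      using Suc.prems(1) unfolding Ck_on.simps by (elim conjE) (erule spec)
    have N': "Ck_on k S (\<lambda>x. frechet_derivative N (at x) v)"
      using Suc.prems(2) unfolding Ck_on.simps by (elim conjE) (erule spec)
    show "Ck_on k S (\<lambda>x. frechet_derivative g (at (N x)) 1 * frechet_derivative N (at x) v)"
      by (rule Ck_on_mult[OF assms(1) Suc.IH[OF g' Ck_on_SucD[OF Suc.prems(2)]] N'])
  qed
qed

lemma smooth_on_cong: "smooth_on S f \<Longrightarrow> open S \<Longrightarrow> (\<And>x. x \<in> S \<Longrightarrow> f x = g x) \<Longrightarrow> smooth_on S g"
  unfolding smooth_on_def using Ck_on_cong by blast

lemma smooth_on_subset: "smooth_on S f \<Longrightarrow> T \<subseteq> S \<Longrightarrow> smooth_on T f"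
  unfolding smooth_on_def using Ck_on_subset by blast

lemma smooth_on_Un: "open S \<Longrightarrow> open T \<Longrightarrow> smooth_on S f \<Longrightarrow> smooth_on T f \<Longrightarrow> smooth_on (S \<union> T) f"
  unfolding smooth_on_def using Ck_on_Un by blast

lemma smooth_on_const: "smooth_on S (\<lambda>x. c)"
  unfolding smooth_on_def using Ck_on_const by blast

lemma smooth_on_add: "open S \<Longrightarrow> smooth_on S f \<Longrightarrow> smooth_on S g \<Longrightarrow> smooth_on S (\<lambda>x. f x + g x)"
  unfolding smooth_on_def using Ck_on_add by blast
lemma smooth_on_mult:
  fixes f g :: "'a::real_normed_vector \<Rightarrow> 'b::real_normed_algebra"
  shows "open S \<Longrightarrow> smooth_on S f \<Longrightarrow> smooth_on S g \<Longrightarrow> smooth_on S (\<lambda>x. f x * g x)"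
  unfolding smooth_on_def using Ck_on_mult by blast

lemma smooth_on_bounded_linear: "open S \<Longrightarrow> bounded_linear h \<Longrightarrow> smooth_on S f \<Longrightarrow> smooth_on S (\<lambda>x. h (f x))"
  unfolding smooth_on_def using Ck_on_bounded_linear by blast
lemma smooth_on_compose_real:
  fixes g :: "real \<Rightarrow> real" and N :: "'a::real_normed_vector \<Rightarrow> real"
  shows "open S \<Longrightarrow> open T \<Longrightarrow> N ` S \<subseteq> T \<Longrightarrow> smooth_on T g \<Longrightarrow> smooth_on S N \<Longrightarrow> smooth_on S (\<lambda>x. g (N x))"
  unfolding smooth_on_def using Ck_on_compose_real by blast

lemma smooth_on_deriv: "smooth_on S f \<Longrightarrow> smooth_on S (\<lambda>x. frechet_derivative f (at x) v)"
  unfolding smooth_on_def by (metis Ck_on.simps(2))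
lemma smooth_on_has_derivative:
  "smooth_on S f \<Longrightarrow> x \<in> S \<Longrightarrow> (f has_derivative frechet_derivative f (at x)) (at x)"
  unfolding smooth_on_def using Ck_on_derivD by blast

lemma smooth_on_continuous: "smooth_on S f \<Longrightarrow> continuous_on S f"
  unfolding smooth_on_def using Ck_on.simps(1) by blast

lemma smooth_continuous_on: "smooth_on UNIV f \<Longrightarrow> continuous_on A f"
  by (rule continuous_on_subset[OF smooth_on_continuous subset_UNIV])

lemma smooth_on_diff:
  assumes "open S" "smooth_on S f" "smooth_on S g"
  shows "smooth_on S (\<lambda>x. f x - g x)"
  using smooth_on_add[OF assms(1,2) smooth_on_bounded_linear[OF assms(1) bounded_linear_minus[OF bounded_linear_ident] assms(3)]]
  by simp

lemma smooth_on_sum: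
  assumes "open S" "\<And>i. i \<in> I \<Longrightarrow> smooth_on S (f i)"
  shows "smooth_on S (\<lambda>x. \<Sum>i\<in>I. f i x)"
  using assms(2)
  by (induction I rule: infinite_finite_induct) (auto intro!: smooth_on_const smooth_on_add assms(1))

lemma smooth_on_ident: "open S \<Longrightarrow> smooth_on S (\<lambda>x. x)"
  unfolding smooth_on_def
proof
  fix k assume "open S"
  have "Ck_on (Suc k) S (\<lambda>x. x)" for k
    by (rule Ck_on_SucI[OF \<open>open S\<close>, where f' = "\<lambda>x v. v"]) (simp_all add: Ck_on_const has_derivative_ident)
  then show "Ck_on k S (\<lambda>x. x)"
    using Ck_on_SucD by blast
qed

section \<open>A smooth step and a potential with prescribed radial Laplacian\<close>

text \<open>For \<open>m = 0\<close> this is the classical smooth function that vanishes on the left half line without being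
  zero. The powers in the denominator are there because they make the family closed under
  differentiation, up to linear combinations, so that all members can be shown smooth together.\<close>

definition flat :: "nat \<Rightarrow> real \<Rightarrow> real" where
  "flat m x = (if 0 < x then exp (- (1 / x)) / x ^ m else 0)"

lemma flat_tendsto_0: "(flat m \<longlongrightarrow> 0) (at 0)"
proof -
  have "((\<lambda>x. x ^ m / exp x) \<longlongrightarrow> (0::real)) at_top"
    by (rule tendsto_power_div_exp_0)
  then have "((\<lambda>x. exp (- (1 / inverse x)) / (inverse x) ^ m) \<longlongrightarrow> (0::real)) at_top"
    by (simp add: exp_minus field_simps)
  then have "((\<lambda>x. exp (- (1 / x)) / x ^ m) \<longlongrightarrow> (0::real)) (at_right 0)"
    by (subst filterlim_at_right_to_top)
  then have r: "(flat m \<longlongrightarrow> 0) (at_right 0)"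
    by (rule Lim_transform_eventually) (auto simp: flat_def eventually_at_right_less intro!: eventually_mono[OF eventually_at_right_less])
  have l: "(flat m \<longlongrightarrow> 0) (at_left 0)"
    by (rule Lim_transform_eventually[OF tendsto_const]) (auto simp: flat_def eventually_at_filter)
  show ?thesis
    using l r by (simp add: filterlim_split_at)
qed

lemma flat_has_derivative:
  "(flat m has_real_derivative flat (m + 2) x - real m * flat (m + 1) x) (at x)"
proof -
  consider "x > 0" | "x < 0" | "x = 0" by linarith
  then show ?thesis
  proof cases
    case 1
    have "((\<lambda>x. exp (- inverse x) * inverse x ^ m) has_real_derivative
        exp (- inverse x) * (inverse x * inverse x) * inverse x ^ m
        - real m * inverse x ^ (m - 1) * (inverse x * inverse x) * exp (- inverse x)) (at x)"
      using 1 by (auto intro!: derivative_eq_intros)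
    also have "exp (- inverse x) * (inverse x * inverse x) * inverse x ^ m
        - real m * inverse x ^ (m - 1) * (inverse x * inverse x) * exp (- inverse x)
      = flat (m + 2) x - real m * flat (m + 1) x"
      using 1 by (cases m) (simp_all add: flat_def divide_inverse power_inverse algebra_simps)
    finally have "((\<lambda>x. exp (- inverse x) * inverse x ^ m) has_real_derivative flat (m + 2) x - real m * flat (m + 1) x) (at x)" .
    then show ?thesis
      by (rule has_field_derivative_transform_within_open[where S = "{0<..}"]) (use 1 in \<open>auto simp: flat_def divide_inverse power_inverse\<close>)
  next
    case 2
    have "((\<lambda>x. 0) has_real_derivative flat (m + 2) x - real m * flat (m + 1) x) (at x)"
      using 2 by (auto simp: flat_def)
    then show ?thesis
      by (rule has_field_derivative_transform_within_open[where S = "{..<0}"]) (use 2 in \<open>auto simp: flat_def\<close>)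
  next
    case 3
    have "((\<lambda>h. (flat m (0 + h) - flat m 0) / h) \<longlongrightarrow> 0) (at 0)"
      by (rule Lim_transform_eventually[OF flat_tendsto_0[of "Suc m"]])
        (auto simp: flat_def field_simps eventually_at_filter)
    then show ?thesis using 3 by (simp add: DERIV_def flat_def)
  qed
qed

lemma smooth_on_has_real_derivative:
  assumes "\<And>t. (f has_real_derivative f' t) (at t)" "smooth_on UNIV f'"
  shows "smooth_on UNIV f"
  unfolding smooth_on_def
proof
  fix k
  have "Ck_on k UNIV (\<lambda>t. f' t * v)" for v
    using smooth_on_mult[OF open_UNIV assms(2) smooth_on_const[of UNIV v]] unfolding smooth_on_def by blast
  then have "Ck_on (Suc k) UNIV f"
    using assms(1) by (intro Ck_on_SucI[where f' = "\<lambda>x v. f' x * v"]) (simp_all add: has_field_derivative_def)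
  then show "Ck_on k UNIV f" by (rule Ck_on_SucD)
qed

lemma smooth_flat: "smooth_on UNIV (flat m)"
proof -
  have "Ck_on k UNIV (flat m)" for k m
  proof (induction k arbitrary: m)
    case 0
    have "\<forall>x\<in>UNIV. isCont (flat m) x"
      using DERIV_isCont[OF flat_has_derivative] by blast
    then show ?case unfolding Ck_on.simps by (rule continuous_at_imp_continuous_on)
  next
    case (Suc k)
    have "Ck_on k UNIV (\<lambda>x. (flat (m + 2) x + (- real m) * flat (m + 1) x) * v)" for v
      by (rule Ck_on_mult[OF open_UNIV Ck_on_add[OF open_UNIV Suc.IH Ck_on_mult[OF open_UNIV Ck_on_const Suc.IH]] Ck_on_const])
    then have *: "Ck_on k UNIV (\<lambda>x. (flat (m + 2) x - real m * flat (m + 1) x) * v)" for v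
      by simp
    show ?case
      by (rule Ck_on_SucI[OF open_UNIV flat_has_derivative[unfolded has_field_derivative_def] *])
  qed
  then show ?thesis unfolding smooth_on_def by blast
qed

lemma smooth_inverse: "smooth_on {0<..} (inverse :: real \<Rightarrow> real)"
proof -
  have "Ck_on k {0<..} (inverse :: real \<Rightarrow> real)" for k
  proof (induction k)
    case 0
    have "continuous_on {0<..} (\<lambda>x::real. inverse x)"
      by (intro continuous_on_inverse continuous_on_id) simp
    then show ?case by simp
  next
    case (Suc k)
    have *: "Ck_on k {0<..} (\<lambda>x::real. (- 1) * (inverse x * v * inverse x))" for v
      by (intro Ck_on_mult open_greaterThan Suc Ck_on_const)
    have "Ck_on (Suc k) {0<..} (\<lambda>x::real. inverse x)"
    proof (rule Ck_on_SucI)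
      show "((\<lambda>x::real. inverse x) has_derivative (\<lambda>v. (- 1) * (inverse x * v * inverse x))) (at x)"
        if "x \<in> {0<..}" for x :: real
        using has_derivative_inverse'[of x UNIV] that by simp
    qed (simp, rule *)
    then show ?case by simp
  qed
  then show ?thesis unfolding smooth_on_def by blast
qed

text \<open>The integral over the empty interval \<open>{c..t}\<close> with \<open>t < c\<close> is \<open>0\<close>, which is also the value of the
  antiderivative there because \<open>w\<close> vanishes on the left of \<open>c\<close>. So the formula is right on the whole
  line and no case distinction is needed when it is used.\<close>

lemma integral_from_has_derivative:
  fixes w :: "real \<Rightarrow> real"
  assumes w: "continuous_on UNIV w" and z: "\<And>t. t \<le> c \<Longrightarrow> w t = 0"
  shows "((\<lambda>t. integral {c..t} w) has_real_derivative w t) (at t)"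
proof -
  \<comment> \<open>an interval around \<open>t\<close> that begins to the left of \<open>c\<close>, where moving the lower limit changes nothing\<close>
  define a b where "a = min c t - 1" and "b = t + 1"
  have eq: "integral {c..s} w = integral {a..s} w" if "s \<in> {a<..<b}" for s
  proof (cases "c \<le> s")
    case True
    have "integral {a..c} w + integral {c..s} w = integral {a..s} w"
      by (rule Henstock_Kurzweil_Integration.integral_combine)
        (use True in \<open>auto simp: a_def intro!: integrable_continuous_interval continuous_on_subset[OF w]\<close>)
    moreover have "integral {a..c} w = integral {a..c} (\<lambda>_. 0)"
      by (rule integral_cong) (use z in auto)
    ultimately show ?thesis by simp
  next
    case False
    have "integral {a..s} w = integral {a..s} (\<lambda>_. 0)"
      by (rule integral_cong) (use z False in auto)
    then show ?thesis using False by simp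
  qed
  have "((\<lambda>s. integral {a..s} w) has_real_derivative w t) (at t within {a..b})"
    by (rule integral_has_real_derivative) (auto simp: a_def b_def intro!: continuous_on_subset[OF w])
  then have "((\<lambda>s. integral {a..s} w) has_real_derivative w t) (at t within {a<..<b})"
    by (rule DERIV_subset) auto
  moreover have t: "t \<in> {a<..<b}" by (auto simp: a_def b_def)
  ultimately have "((\<lambda>s. integral {a..s} w) has_real_derivative w t) (at t)"
    using at_within_open[OF t] by simp
  then show ?thesis
    by (rule has_field_derivative_transform_within_open[where S = "{a<..<b}"]) (use t eq in auto)
qed

definition step_density :: "real \<Rightarrow> real" where
  "step_density t = flat 0 (t - 1/4) * flat 0 (1 - t)"

definition smooth_step :: "real \<Rightarrow> real" where
  "smooth_step t = integral {1/4..t} step_density / integral {1/4..1} step_density"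

definition smooth_step' :: "real \<Rightarrow> real" where
  "smooth_step' t = step_density t / integral {1/4..1} step_density"

lemma smooth_step_density: "smooth_on UNIV step_density"
proof -
  have "smooth_on UNIV (\<lambda>t. flat 0 (t - 1/4) * flat 0 (1 - t))"
    by (intro smooth_on_mult open_UNIV smooth_on_compose_real[OF open_UNIV open_UNIV subset_UNIV smooth_flat]
        smooth_on_diff smooth_on_ident smooth_on_const)
  then show ?thesis unfolding step_density_def[abs_def] .
qed

lemma step_density_nonneg: "0 \<le> step_density t"
  by (simp add: step_density_def flat_def)

lemma step_density_pos: "0 < step_density t \<longleftrightarrow> 1/4 < t \<and> t < 1"
  by (simp add: step_density_def flat_def)

lemma step_density_integral_pos: "0 < integral {1/4..1} step_density"
proof -
  have c: "continuous_on {1/4..1} step_density"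
    using smooth_on_continuous[OF smooth_step_density] continuous_on_subset by blast
  have "integral {1/4..1} step_density \<noteq> 0"
  proof
    assume "integral {1/4..1} step_density = 0"
    then have "\<forall>x\<in>{1/4..1}. step_density x = 0"
      using integral_eq_0_iff[OF c] step_density_nonneg by simp
    moreover have "(1/2::real) \<in> {1/4..1}" by simp
    ultimately show False using step_density_pos[of "1/2"] by fastforce
  qed
  moreover have "0 \<le> integral {1/4..1} step_density"
    by (intro integral_nonneg integrable_continuous_interval c step_density_nonneg)
  ultimately show ?thesis by linarith
qed

lemma step_density_integral_derivative:
  "((\<lambda>t. integral {1/4..t} step_density) has_real_derivative step_density t) (at t)"
  by (rule integral_from_has_derivative)
    (use smooth_on_continuous[OF smooth_step_density] in \<open>auto simp: step_density_def flat_def\<close>)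

lemma smooth_step_has_derivative: "(smooth_step has_real_derivative smooth_step' t) (at t)"
  unfolding smooth_step_def[abs_def] smooth_step'_def
  by (rule DERIV_cdivide[OF step_density_integral_derivative])

lemma smooth_smooth_step': "smooth_on UNIV smooth_step'"
proof -
  have "smooth_on UNIV (\<lambda>t. step_density t * inverse (integral {1/4..1} step_density))"
    by (intro smooth_on_mult open_UNIV smooth_step_density smooth_on_const)
  then show ?thesis unfolding smooth_step'_def[abs_def] divide_inverse .
qed

lemma smooth_smooth_step: "smooth_on UNIV smooth_step"
  by (rule smooth_on_has_real_derivative[OF smooth_step_has_derivative smooth_smooth_step'])

lemma smooth_step'_nonneg: "0 \<le> smooth_step' t"
  using step_density_integral_pos step_density_nonneg by (simp add: smooth_step'_def)

lemma smooth_step'_pos: "0 < smooth_step' t \<longleftrightarrow> 1/4 < t \<and> t < 1"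
  using step_density_integral_pos by (simp add: smooth_step'_def zero_less_divide_iff step_density_pos)

lemma smooth_step'_eq_0: "t \<le> 1/4 \<or> 1 \<le> t \<Longrightarrow> smooth_step' t = 0"
  using smooth_step'_pos[of t] smooth_step'_nonneg[of t] by linarith

lemma smooth_step_mono: "s \<le> t \<Longrightarrow> smooth_step s \<le> smooth_step t"
  by (rule DERIV_nonneg_imp_nondecreasing) (use smooth_step_has_derivative smooth_step'_nonneg in blast)+

lemma smooth_step_eq_0: "t \<le> 1/4 \<Longrightarrow> smooth_step t = 0"
  unfolding smooth_step_def by (cases "t < 1/4") (use order_antisym[of t "1/4"] in force)+

lemma smooth_step_eq_1: assumes "1 \<le> t" shows "smooth_step t = 1"
proof -
  have "smooth_step t = smooth_step 1"
  proof (cases "t = 1")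
    case False
    then have "1 < t" using assms by simp
    have "\<exists>z>1. z < t \<and> smooth_step t - smooth_step 1 = (t - 1) * smooth_step' z"
      using MVT2[OF \<open>1 < t\<close>, of smooth_step smooth_step'] smooth_step_has_derivative by blast
    then show ?thesis using smooth_step'_eq_0 by force
  qed simp
  then show ?thesis using step_density_integral_pos by (simp add: smooth_step_def)
qed

lemma smooth_step_nonneg: "0 \<le> smooth_step t"
  using smooth_step_mono[of "min t 0" t] smooth_step_eq_0[of "min t 0"] by simp

lemma smooth_step_le_1: "smooth_step t \<le> 1"
  using smooth_step_mono[of t "max t 1"] smooth_step_eq_1[of "max t 1"] by simp

text \<open>In the variable \<open>t = |z|\<^sup>2\<close> the Laplacian of \<open>g(|z|\<^sup>2)\<close> is \<open>4 (t g')'\<close>. Choosing \<open>4 t g'\<close> to be the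
  smooth step makes the Laplacian the derivative of the step: a smooth nonnegative function carried by the
  annulus \<open>1/4 < |z|\<^sup>2 < 1\<close>. Outside the unit disk \<open>g\<close> is \<open>1/4 ln t\<close> up to a constant. Since the step
  vanishes near \<open>0\<close>, the division by \<open>t\<close> does no harm.\<close>

definition profile' :: "real \<Rightarrow> real" where
  "profile' t = smooth_step t / (4 * t)"

definition profile :: "real \<Rightarrow> real" where
  "profile t = integral {1/4..t} profile'"

lemma smooth_profile': "smooth_on UNIV profile'"
proof -
  have "smooth_on {0<..} (\<lambda>t. smooth_step t * (inverse 4 * inverse t))"
    by (intro smooth_on_mult open_greaterThan smooth_on_subset[OF smooth_smooth_step] smooth_on_const smooth_inverse) simp
  then have a: "smooth_on {0<..} profile'"
    by (rule smooth_on_cong) (simp_all add: profile'_def field_simps)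
  have b: "smooth_on {..<1/4} profile'"
    by (rule smooth_on_cong[OF smooth_on_const[of _ 0]]) (auto simp: profile'_def smooth_step_eq_0)
  have "{0<..} \<union> {..<1/4} = (UNIV :: real set)" by auto
  with smooth_on_Un[OF _ _ a b] show ?thesis by simp
qed

lemma profile_has_derivative: "(profile has_real_derivative profile' t) (at t)"
  unfolding profile_def[abs_def]
  by (rule integral_from_has_derivative)
    (use smooth_on_continuous[OF smooth_profile'] in \<open>auto simp: profile'_def smooth_step_eq_0\<close>)

lemma smooth_profile: "smooth_on UNIV profile"
  by (rule smooth_on_has_real_derivative[OF profile_has_derivative smooth_profile'])

lemma profile'_times: "4 * t * profile' t = smooth_step t"
  by (cases "t = 0") (simp_all add: profile'_def smooth_step_eq_0)

section \<open>Iterated partial derivatives, series and the Laplacian\<close>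

lemma partial_x_eq: "(f has_derivative f') (at z) \<Longrightarrow> partial_x f z = f' 1"
  unfolding partial_x_def using frechet_derivative_at by metis

lemma partial_y_eq: "(f has_derivative f') (at z) \<Longrightarrow> partial_y f z = f' \<i>"
  unfolding partial_y_def using frechet_derivative_at by metis

lemma has_derivative_partials:
  assumes "(f has_derivative f') (at z)"
  shows "(f has_derivative (\<lambda>h. Re h *\<^sub>R partial_x f z + Im h *\<^sub>R partial_y f z)) (at z)"
proof -
  have "f' h = Re h *\<^sub>R partial_x f z + Im h *\<^sub>R partial_y f z" for h
  proof -
    have "h = Re h *\<^sub>R 1 + Im h *\<^sub>R \<i>" by (simp add: complex_eq_iff)
    then have "f' h = f' (Re h *\<^sub>R 1 + Im h *\<^sub>R \<i>)" by (rule arg_cong)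
    also have "\<dots> = Re h *\<^sub>R f' 1 + Im h *\<^sub>R f' \<i>"
      using has_derivative_linear[OF assms] by (simp add: linear_add linear_scale)
    finally show ?thesis by (simp add: partial_x_eq[OF assms] partial_y_eq[OF assms])
  qed
  then have "f' = (\<lambda>h. Re h *\<^sub>R partial_x f z + Im h *\<^sub>R partial_y f z)" by auto
  with assms show ?thesis by simp
qed

lemma smooth_on_has_partials:
  "smooth_on S f \<Longrightarrow> z \<in> S \<Longrightarrow>
    (f has_derivative (\<lambda>h. Re h *\<^sub>R partial_x f z + Im h *\<^sub>R partial_y f z)) (at z)"
  by (rule has_derivative_partials[OF smooth_on_has_derivative])

lemma smooth_on_partial_x: "smooth_on S f \<Longrightarrow> smooth_on S (partial_x f)"
  unfolding partial_x_def[abs_def] by (rule smooth_on_deriv)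

lemma smooth_on_partial_y: "smooth_on S f \<Longrightarrow> smooth_on S (partial_y f)"
  unfolding partial_y_def[abs_def] by (rule smooth_on_deriv)

definition partial :: "bool \<Rightarrow> (complex \<Rightarrow> real) \<Rightarrow> complex \<Rightarrow> real" where
  "partial b f z = (if b then partial_x f z else partial_y f z)"

lemma partial_eq: "(f has_derivative f') (at z) \<Longrightarrow> partial b f z = f' (if b then 1 else \<i>)"
  unfolding partial_def using partial_x_eq partial_y_eq by auto

lemma smooth_on_partial: "smooth_on S f \<Longrightarrow> smooth_on S (partial b f)"
  unfolding partial_def[abs_def] by (cases b) (simp_all add: smooth_on_partial_x smooth_on_partial_y)

lemma partial_cong:
  assumes "open S" "z \<in> S" "\<And>w. w \<in> S \<Longrightarrow> f w = g w" "smooth_on S f"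
  shows "partial b f z = partial b g z"
proof -
  have f: "(f has_derivative frechet_derivative f (at z)) (at z)"
    by (rule smooth_on_has_derivative[OF assms(4,2)])
  moreover have "(g has_derivative frechet_derivative f (at z)) (at z)"
    by (rule has_derivative_transform_within_open[OF f assms(1,2,3)])
  ultimately show ?thesis by (simp add: partial_eq)
qed

lemma partial_add:
  assumes "smooth_on S f" "smooth_on S g" "z \<in> S"
  shows "partial b (\<lambda>w. f w + g w) z = partial b f z + partial b g z"
  using partial_eq[OF has_derivative_add[OF smooth_on_has_derivative[OF assms(1,3)] smooth_on_has_derivative[OF assms(2,3)]]]
    partial_eq[OF smooth_on_has_derivative[OF assms(1,3)]] partial_eq[OF smooth_on_has_derivative[OF assms(2,3)]]
  by simp

lemma partial_cmult:
  assumes "smooth_on S f" "z \<in> S"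
  shows "partial b (\<lambda>w. c * f w) z = c * partial b f z"
  using partial_eq[OF has_derivative_mult_right[OF smooth_on_has_derivative[OF assms]]]
    partial_eq[OF smooth_on_has_derivative[OF assms]]
  by simp

text \<open>Iterated partial derivatives, the last one taken listed first; \<open>True\<close> stands for the direction \<open>x\<close>.
  Working with two coordinate directions instead of all directions keeps the number of derivatives of a
  given order finite, so that they can be bounded simultaneously.\<close>

primrec partials :: "bool list \<Rightarrow> (complex \<Rightarrow> real) \<Rightarrow> complex \<Rightarrow> real" where
  "partials [] f = f"
| "partials (b # l) f = partial b (partials l f)"

lemma smooth_on_partials: "smooth_on S f \<Longrightarrow> smooth_on S (partials l f)"
  by (induction l) (simp_all add: smooth_on_partial)

lemma partials_add:
  assumes "open S" "smooth_on S f" "smooth_on S g" "z \<in> S"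
  shows "partials l (\<lambda>w. f w + g w) z = partials l f z + partials l g z"
  using assms(4)
proof (induction l arbitrary: z)
  case (Cons b l)
  have "partial b (partials l (\<lambda>w. f w + g w)) z = partial b (\<lambda>w. partials l f w + partials l g w) z"
    by (rule partial_cong[OF assms(1) Cons.prems Cons.IH smooth_on_partials[OF smooth_on_add[OF assms(1-3)]]])
  then show ?case
    using partial_add[OF smooth_on_partials[OF assms(2)] smooth_on_partials[OF assms(3)] Cons.prems] by simp
qed simp

lemma partials_cmult:
  assumes "open S" "smooth_on S f" "z \<in> S"
  shows "partials l (\<lambda>w. c * f w) z = c * partials l f z"
  using assms(3)
proof (induction l arbitrary: z)
  case (Cons b l)
  have "partial b (partials l (\<lambda>w. c * f w)) z = partial b (\<lambda>w. c * partials l f w) z"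
    by (rule partial_cong[OF assms(1) Cons.prems Cons.IH smooth_on_partials[OF smooth_on_mult[OF assms(1) smooth_on_const assms(2)]]])
  then show ?case
    using partial_cmult[OF smooth_on_partials[OF assms(2)] Cons.prems] by simp
qed simp

lemma partials_sum:
  assumes "open S" "finite I" "\<And>i. i \<in> I \<Longrightarrow> smooth_on S (f i)" "z \<in> S"
  shows "partials l (\<lambda>w. \<Sum>i\<in>I. f i w) z = (\<Sum>i\<in>I. partials l (f i) z)"
  using assms(2,3)
proof (induction I rule: finite_induct)
  case empty
  show ?case
    using partials_cmult[OF assms(1) smooth_on_const[of S "0::real"] assms(4), of l 0] by simp
next
  case (insert i I)
  then show ?case
    using partials_add[OF assms(1) _ smooth_on_sum[OF assms(1), of I f] assms(4), of "f i" l] by simp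
qed

lemma laplacian_partials: "laplacian f z = partials [True, True] f z + partials [False, False] f z"
  by (simp add: laplacian_def partial_def[abs_def])

lemma laplacian_cmult:
  assumes "open S" "smooth_on S f" "z \<in> S"
  shows "laplacian (\<lambda>w. c * f w) z = c * laplacian f z"
  using partials_cmult[OF assms] unfolding laplacian_partials by (simp add: algebra_simps del: partials.simps)

lemma laplacian_sum:
  assumes "open S" "finite I" "\<And>i. i \<in> I \<Longrightarrow> smooth_on S (f i)" "z \<in> S"
  shows "laplacian (\<lambda>w. \<Sum>i\<in>I. f i w) z = (\<Sum>i\<in>I. laplacian (f i) z)"
  using partials_sum[OF assms] unfolding laplacian_partials by (simp add: sum.distrib del: partials.simps)

lemma smooth_on_laplacian: "open S \<Longrightarrow> smooth_on S f \<Longrightarrow> smooth_on S (laplacian f)"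
  unfolding laplacian_partials[abs_def] by (intro smooth_on_add smooth_on_partials)

lemma partials_bounded:
  assumes "smooth_on UNIV f" "compact K"
  shows "\<exists>M>0. \<forall>l. length l \<le> k \<longrightarrow> (\<forall>z\<in>K. \<bar>partials l f z\<bar> \<le> M)"
proof -
  have "\<exists>M. \<forall>z\<in>K. \<bar>partials l f z\<bar> \<le> M" for l
  proof -
    have "bounded (partials l f ` K)"
      using continuous_on_subset[OF smooth_on_continuous[OF smooth_on_partials[OF assms(1)]]] assms(2)
      by (intro compact_imp_bounded compact_continuous_image) auto
    then show ?thesis unfolding bounded_iff by auto
  qed
  then obtain M where M: "\<And>l z. z \<in> K \<Longrightarrow> \<bar>partials l f z\<bar> \<le> M l" by metis
  define A where "A = {l :: bool list. length l \<le> k}"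
  have fin: "finite A"
    using finite_lists_length_le[of "UNIV :: bool set" k] by (simp add: A_def)
  have "\<bar>partials l f z\<bar> \<le> (\<Sum>l\<in>A. \<bar>M l\<bar>) + 1" if "l \<in> A" "z \<in> K" for l z
    using M[OF that(2), of l] member_le_sum[OF that(1), of "\<lambda>l. \<bar>M l\<bar>"] fin by fastforce
  then show ?thesis
    by (intro exI[of _ "(\<Sum>l\<in>A. \<bar>M l\<bar>) + 1"]) (auto simp: A_def add_nonneg_pos sum_nonneg)
qed

text \<open>The sums \<open>F l\<close> of the termwise derivatives form a family in which the derivative of each member is
  given by two other members: termwise differentiation is legitimate because all the series converge
  uniformly. Such a family consists of smooth functions, and its members are the iterated derivatives
  of \<open>F []\<close>.\<close>

lemma partials_suminf:
  fixes f :: "nat \<Rightarrow> complex \<Rightarrow> real"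
  assumes S: "open S" "convex S" and f: "\<And>j. smooth_on S (f j)"
    and bd: "\<And>l. \<exists>a. summable a \<and> (\<forall>j. \<forall>z\<in>S. \<bar>partials l (f j) z\<bar> \<le> a j)"
  shows "smooth_on S (\<lambda>z. \<Sum>j. f j z)"
    and "\<And>l z. z \<in> S \<Longrightarrow> (\<lambda>j. partials l (f j) z) sums partials l (\<lambda>z. \<Sum>j. f j z) z"
proof -
  define F where "F l z = (\<Sum>j. partials l (f j) z)" for l z
  have unif: "uniform_limit S (\<lambda>n z. \<Sum>i<n. partials l (f i) z) (F l) sequentially" for l
  proof -
    obtain a where "summable a" "\<And>j z. z \<in> S \<Longrightarrow> \<bar>partials l (f j) z\<bar> \<le> a j"
      using bd[of l] by blast
    then show ?thesis
      unfolding F_def by (intro Weierstrass_m_test) auto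
  qed
  have summ: "(\<lambda>j. partials l (f j) z) sums F l z" if "z \<in> S" for l z
    using tendsto_uniform_limitI[OF unif that] unfolding sums_def .
  have der: "(F l has_derivative (\<lambda>h. Re h * F (True # l) z + Im h * F (False # l) z)) (at z)"
    if z: "z \<in> S" for l z
  proof -
    have "\<exists>g. \<forall>x\<in>S. (\<lambda>n. partials l (f n) x) sums g x \<and>
        (g has_derivative (\<lambda>h. Re h * F (True # l) x + Im h * F (False # l) x)) (at x within S)"
    proof (rule has_derivative_series[where f = "\<lambda>n. partials l (f n)" and x = z and l = "F l z" and
          f' = "\<lambda>n x h. Re h * partials (True # l) (f n) x + Im h * partials (False # l) (f n) x", OF S(2)])
      fix n x assume x: "x \<in> S"
      show "(partials l (f n) has_derivative
          (\<lambda>h. Re h * partials (True # l) (f n) x + Im h * partials (False # l) (f n) x)) (at x within S)"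
        using has_derivative_at_withinI[OF smooth_on_has_partials[OF smooth_on_partials[OF f] x]]
        by (simp add: partial_def)
    next
      fix e :: real assume "e > 0"
      then have e: "e / 2 > 0" by simp
      show "\<forall>\<^sub>F n in sequentially. \<forall>x\<in>S. \<forall>h.
          norm ((\<Sum>i<n. Re h * partials (True # l) (f i) x + Im h * partials (False # l) (f i) x)
            - (Re h * F (True # l) x + Im h * F (False # l) x)) \<le> e * norm h"
        using uniform_limitD[OF unif[of "True # l"] e] uniform_limitD[OF unif[of "False # l"] e]
      proof eventually_elim
        case (elim n)
        show ?case
        proof (intro ballI allI)
          fix x h assume x: "x \<in> S"
          let ?A = "(\<Sum>i<n. partials (True # l) (f i) x) - F (True # l) x"
          let ?B = "(\<Sum>i<n. partials (False # l) (f i) x) - F (False # l) x"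
          have A: "\<bar>?A\<bar> \<le> e / 2"
            using bspec[OF elim(1) x] unfolding dist_real_def by (rule less_imp_le)
          have B: "\<bar>?B\<bar> \<le> e / 2"
            using bspec[OF elim(2) x] unfolding dist_real_def by (rule less_imp_le)
          have "(\<Sum>i<n. Re h * partials (True # l) (f i) x + Im h * partials (False # l) (f i) x)
            - (Re h * F (True # l) x + Im h * F (False # l) x) = Re h * ?A + Im h * ?B"
            by (simp add: sum.distrib sum_distrib_left right_diff_distrib del: partials.simps)
          also have "norm (Re h * ?A + Im h * ?B) \<le> \<bar>Re h\<bar> * \<bar>?A\<bar> + \<bar>Im h\<bar> * \<bar>?B\<bar>"
            unfolding real_norm_def abs_mult[symmetric] by (rule abs_triangle_ineq)
          also have "\<dots> \<le> \<bar>Re h\<bar> * (e / 2) + \<bar>Im h\<bar> * (e / 2)"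
            by (rule add_mono[OF mult_left_mono[OF A abs_ge_zero] mult_left_mono[OF B abs_ge_zero]])
          also have "\<bar>Re h\<bar> * (e / 2) + \<bar>Im h\<bar> * (e / 2) \<le> norm h * (e / 2) + norm h * (e / 2)"
            using e by (intro add_mono mult_right_mono abs_Re_le_cmod abs_Im_le_cmod) simp_all
          finally show "norm ((\<Sum>i<n. Re h * partials (True # l) (f i) x + Im h * partials (False # l) (f i) x)
            - (Re h * F (True # l) x + Im h * F (False # l) x)) \<le> e * norm h"
            by (simp add: algebra_simps del: partials.simps)
        qed
      qed
    qed (rule z, rule summ[OF z])
    then obtain g where g: "\<forall>x\<in>S. (\<lambda>n. partials l (f n) x) sums g x \<and>
        (g has_derivative (\<lambda>h. Re h * F (True # l) x + Im h * F (False # l) x)) (at x within S)" ..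
    have "(g has_derivative (\<lambda>h. Re h * F (True # l) z + Im h * F (False # l) z)) (at z)"
      using conjunct2[OF bspec[OF g z]] unfolding at_within_open[OF z S(1)] .
    then show ?thesis
      by (rule has_derivative_transform_within_open[OF _ S(1) z]) (rule sums_unique2[OF conjunct1[OF bspec[OF g]] summ])
  qed
  have sm: "smooth_on S (F l)" for l
  proof -
    have "Ck_on k S (F l)" for k l
    proof (induction k arbitrary: l)
      case 0
      have "\<forall>z\<in>S. isCont (F l) z"
      proof
        fix z assume "z \<in> S"
        show "isCont (F l) z" by (rule has_derivative_continuous[OF der[OF \<open>z \<in> S\<close>]])
      qed
      then show ?case unfolding Ck_on.simps by (rule continuous_at_imp_continuous_on)
    next
      case (Suc k)
      have *: "Ck_on k S (\<lambda>z. Re h * F (True # l) z + Im h * F (False # l) z)" for h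
        by (rule Ck_on_add[OF S(1) Ck_on_mult[OF S(1) Ck_on_const Suc.IH] Ck_on_mult[OF S(1) Ck_on_const Suc.IH]])
      show ?case
        by (rule Ck_on_SucI[OF S(1) der *])
    qed
    then show ?thesis unfolding smooth_on_def by blast
  qed
  have eq: "partials l (F []) z = F l z" if "z \<in> S" for l z
    using that
  proof (induction l arbitrary: z)
    case (Cons b l)
    have "partial b (partials l (F [])) z = partial b (F l) z"
      by (rule partial_cong[OF S(1) Cons.prems Cons.IH smooth_on_partials[OF sm]])
    also have "\<dots> = F (b # l) z"
      using partial_eq[OF der[OF Cons.prems]] by (cases b) simp_all
    finally show ?case by simp
  qed simp
  have F: "F [] = (\<lambda>z. \<Sum>j. f j z)" by (simp add: F_def[abs_def])
  show "smooth_on S (\<lambda>z. \<Sum>j. f j z)" using sm[of "[]"] F by simp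
  show "(\<lambda>j. partials l (f j) z) sums partials l (\<lambda>z. \<Sum>j. f j z) z" if "z \<in> S" for l z
    using summ[OF that] eq[OF that] F by simp
qed

definition sqdist :: "complex \<Rightarrow> real \<Rightarrow> complex \<Rightarrow> real" where
  "sqdist a c z = c * ((Re z - Re a)\<^sup>2 + (Im z - Im a)\<^sup>2)"

lemma sqdist_eq: "sqdist a c z = c * (cmod (z - a))\<^sup>2"
  by (simp add: sqdist_def cmod_power2)

lemma smooth_sqdist: "smooth_on UNIV (sqdist a c)"
proof -
  have "smooth_on UNIV (\<lambda>z. c * ((Re z - Re a) * (Re z - Re a) + (Im z - Im a) * (Im z - Im a)))"
    by (intro smooth_on_add smooth_on_mult smooth_on_diff open_UNIV smooth_on_const
        smooth_on_bounded_linear[OF open_UNIV bounded_linear_Re smooth_on_ident]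
        smooth_on_bounded_linear[OF open_UNIV bounded_linear_Im smooth_on_ident])
  then show ?thesis by (simp add: sqdist_def[abs_def] power2_eq_square)
qed

lemma smooth_radial:
  fixes g :: "real \<Rightarrow> real"
  assumes "smooth_on UNIV g" shows "smooth_on UNIV (\<lambda>z. g (sqdist a c z))"
  by (rule smooth_on_compose_real[OF open_UNIV open_UNIV _ assms smooth_sqdist]) simp

lemma radial_has_derivative:
  assumes "(g has_real_derivative g') (at (sqdist a c z))"
  shows "((\<lambda>z. g (sqdist a c z)) has_derivative
    (\<lambda>h. g' * (2 * c * ((Re z - Re a) * Re h + (Im z - Im a) * Im h)))) (at z)"
proof -
  have "(sqdist a c has_derivative (\<lambda>h. 2 * c * ((Re z - Re a) * Re h + (Im z - Im a) * Im h))) (at z)"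
    unfolding sqdist_def[abs_def] by (auto intro!: derivative_eq_intros simp: algebra_simps)
  from has_derivative_compose[OF this assms[unfolded has_field_derivative_def]] show ?thesis .
qed

lemma laplacian_radial:
  assumes g: "\<And>t. (g has_real_derivative g' t) (at t)" and g': "\<And>t. (g' has_real_derivative g'' t) (at t)"
  shows "laplacian (\<lambda>z. g (sqdist a c z)) z = 4 * c * (sqdist a c z * g'' (sqdist a c z) + g' (sqdist a c z))"
proof -
  have x: "partial_x (\<lambda>z. g (sqdist a c z)) = (\<lambda>z. g' (sqdist a c z) * (2 * c * (Re z - Re a)))"
    using partial_x_eq[OF radial_has_derivative[OF g]] by (intro ext) simp
  have y: "partial_y (\<lambda>z. g (sqdist a c z)) = (\<lambda>z. g' (sqdist a c z) * (2 * c * (Im z - Im a)))"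
    using partial_y_eq[OF radial_has_derivative[OF g]] by (intro ext) simp
  note d = radial_has_derivative[OF g', of a c z]
  have "((\<lambda>z. 2 * c * (Re z - Re a)) has_derivative (\<lambda>h. 2 * c * Re h)) (at z)"
    by (auto intro!: derivative_eq_intros)
  from partial_x_eq[OF has_derivative_mult[OF d this]]
  have "partial_x (partial_x (\<lambda>z. g (sqdist a c z))) z =
      g' (sqdist a c z) * (2 * c) + g'' (sqdist a c z) * (2 * c * (Re z - Re a)) * (2 * c * (Re z - Re a))"
    unfolding x by simp
  moreover have "((\<lambda>z. 2 * c * (Im z - Im a)) has_derivative (\<lambda>h. 2 * c * Im h)) (at z)"
    by (auto intro!: derivative_eq_intros)
  from partial_y_eq[OF has_derivative_mult[OF d this]]
  have "partial_y (partial_y (\<lambda>z. g (sqdist a c z))) z =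
      g' (sqdist a c z) * (2 * c) + g'' (sqdist a c z) * (2 * c * (Im z - Im a)) * (2 * c * (Im z - Im a))"
    unfolding y by simp
  ultimately show ?thesis
    unfolding laplacian_def by (simp add: sqdist_def algebra_simps power2_eq_square)
qed

text \<open>A potential whose Laplacian is a rotation invariant bump of radius \<open>r\<close> around \<open>a\<close>. Logarithmic growth
  at infinity is harmless, because the potentials are only used on a bounded set.\<close>

definition blob_potential :: "real \<Rightarrow> complex \<Rightarrow> complex \<Rightarrow> real" where
  "blob_potential r a z = profile (sqdist a (1 / r\<^sup>2) z)"

definition blob :: "real \<Rightarrow> complex \<Rightarrow> complex \<Rightarrow> real" where
  "blob r a z = smooth_step' (sqdist a (1 / r\<^sup>2) z) / r\<^sup>2"

lemma smooth_blob_potential: "smooth_on UNIV (blob_potential r a)"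
  unfolding blob_potential_def[abs_def] by (rule smooth_radial[OF smooth_profile])

text \<open>Differentiating \<open>4 t profile' t = smooth_step t\<close> gives what the radial Laplacian asks for.\<close>

lemma laplacian_blob_potential: "laplacian (blob_potential r a) z = blob r a z"
proof -
  define q where "q t = frechet_derivative profile' (at t) 1" for t
  have q: "(profile' has_real_derivative q t) (at t)" for t
  proof -
    have d: "(profile' has_derivative frechet_derivative profile' (at t)) (at t)"
      by (rule smooth_on_has_derivative[OF smooth_profile']) simp
    have "frechet_derivative profile' (at t) h = q t * h" for h
      using linear_scale[OF has_derivative_linear[OF d], of h 1] by (simp add: q_def)
    with d show ?thesis unfolding has_field_derivative_def by (metis ext)
  qed
  let ?t = "sqdist a (1 / r\<^sup>2) z"
  have "((\<lambda>t. 4 * t * profile' t) has_real_derivative 4 * (?t * q ?t + profile' ?t)) (at ?t)"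
    by (auto intro!: derivative_eq_intros q)
  then have "(smooth_step has_real_derivative 4 * (?t * q ?t + profile' ?t)) (at ?t)"
    unfolding profile'_times .
  then have "4 * (?t * q ?t + profile' ?t) = smooth_step' ?t"
    by (rule DERIV_unique[OF _ smooth_step_has_derivative])
  with laplacian_radial[OF profile_has_derivative q, of a "1 / r\<^sup>2" z] show ?thesis
    by (simp add: blob_potential_def[abs_def] blob_def)
qed

lemma blob_nonneg: "0 \<le> blob r a z"
  by (simp add: blob_def smooth_step'_nonneg)

text \<open>That the bump is positive exactly on an annulus, and not only supported in the disk, matters
  later: the boundary of its set of positivity consists of two circles and is a null set.\<close>

lemma blob_pos: "0 < r \<Longrightarrow> 0 < blob r a z \<longleftrightarrow> r / 2 < dist a z \<and> dist a z < r"
proof -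
  assume r: "0 < r"
  have "1 / 4 < sqdist a (1 / r\<^sup>2) z \<longleftrightarrow> (r / 2)\<^sup>2 < (dist a z)\<^sup>2"
    using r by (simp add: sqdist_eq field_simps dist_norm norm_minus_commute power2_eq_square)
  also have "\<dots> \<longleftrightarrow> r / 2 < dist a z"
    using r power_mono_iff[of "dist a z" "r / 2" 2] by (simp add: not_le[symmetric])
  finally have 1: "1 / 4 < sqdist a (1 / r\<^sup>2) z \<longleftrightarrow> r / 2 < dist a z" .
  have "sqdist a (1 / r\<^sup>2) z < 1 \<longleftrightarrow> (dist a z)\<^sup>2 < r\<^sup>2"
    using r by (simp add: sqdist_eq field_simps dist_norm norm_minus_commute)
  also have "\<dots> \<longleftrightarrow> dist a z < r"
    using r power_mono_iff[of r "dist a z" 2] by (simp add: not_le[symmetric])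
  finally have 2: "sqdist a (1 / r\<^sup>2) z < 1 \<longleftrightarrow> dist a z < r" .
  show ?thesis
    using r 1 2 by (simp add: blob_def zero_less_divide_iff smooth_step'_pos)
qed

lemma smooth_blob: "smooth_on UNIV (blob r a)"
  using smooth_on_laplacian[OF open_UNIV smooth_blob_potential[of r a]]
  by (simp add: laplacian_blob_potential[abs_def])

section \<open>The sub-mean value inequality\<close>

definition polar :: "complex \<Rightarrow> real \<Rightarrow> real \<Rightarrow> complex" where
  "polar a \<rho> \<theta> = a + of_real \<rho> * cis \<theta>"

lemma polar_has_derivative_radius:
  assumes "smooth_on S F" "polar a \<rho> \<theta> \<in> S"
  shows "((\<lambda>\<rho>. F (polar a \<rho> \<theta>)) has_real_derivative
    (partial_x F (polar a \<rho> \<theta>) * cos \<theta> + partial_y F (polar a \<rho> \<theta>) * sin \<theta>)) (at \<rho>)"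
proof -
  have "((\<lambda>\<rho>. polar a \<rho> \<theta>) has_derivative (\<lambda>h. of_real h * cis \<theta>)) (at \<rho>)"
    unfolding polar_def by (auto intro!: derivative_eq_intros)
  from has_derivative_compose[OF this smooth_on_has_partials[OF assms]]
  show ?thesis
    unfolding has_field_derivative_def by (rule has_derivative_eq_rhs) (simp add: fun_eq_iff algebra_simps)
qed

lemma cis_has_derivative: "(cis has_derivative (\<lambda>h. of_real h * (\<i> * cis \<theta>))) (at \<theta>)"
proof -
  have *: "((\<lambda>\<theta>. of_real (cos \<theta>) + \<i> * of_real (sin \<theta>)) has_derivative
      (\<lambda>h. of_real (- sin \<theta> * h) + \<i> * of_real (cos \<theta> * h))) (at \<theta>)"
    by (intro has_derivative_add has_derivative_mult_right has_derivative_of_real)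
      (auto intro!: derivative_eq_intros)
  have "cis = (\<lambda>\<theta>. of_real (cos \<theta>) + \<i> * of_real (sin \<theta>))"
    by (auto simp: complex_eq_iff)
  moreover have "(\<lambda>h. of_real (- sin \<theta> * h) + \<i> * of_real (cos \<theta> * h)) = (\<lambda>h. of_real h * (\<i> * cis \<theta>))"
    by (auto simp: complex_eq_iff)
  ultimately show ?thesis using * by simp
qed

lemma polar_has_derivative_angle:
  assumes "smooth_on S F" "polar a \<rho> \<theta> \<in> S"
  shows "((\<lambda>\<theta>. F (polar a \<rho> \<theta>)) has_real_derivative
    \<rho> * (partial_y F (polar a \<rho> \<theta>) * cos \<theta> - partial_x F (polar a \<rho> \<theta>) * sin \<theta>)) (at \<theta>)"
proof -
  have "((\<lambda>\<theta>. polar a \<rho> \<theta>) has_derivative (\<lambda>h. of_real \<rho> * (of_real h * (\<i> * cis \<theta>)))) (at \<theta>)"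
    unfolding polar_def by (auto intro!: derivative_eq_intros cis_has_derivative simp: fun_eq_iff scaleR_conv_of_real)
  from has_derivative_compose[OF this smooth_on_has_partials[OF assms]]
  show ?thesis
    unfolding has_field_derivative_def by (rule has_derivative_eq_rhs) (simp add: fun_eq_iff algebra_simps)
qed

lemma continuous_on_polar:
  assumes "continuous_on S F" "\<And>\<rho> \<theta>. \<rho> \<in> A \<Longrightarrow> polar a \<rho> \<theta> \<in> S"
  shows "continuous_on (A \<times> B) (\<lambda>x. F (polar a (fst x) (snd x)))"
proof -
  have "continuous_on (A \<times> B) (\<lambda>x. polar a (fst x) (snd x))"
    unfolding polar_def by (intro continuous_intros)
  then show ?thesis
    by (rule continuous_on_compose2[OF assms(1)]) (use assms(2) in auto)
qed

lemma integral_nonneg_continuous: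
  fixes f :: "real \<Rightarrow> real"
  assumes "continuous_on {a..b} f" "\<And>x. x \<in> {a..b} \<Longrightarrow> 0 \<le> f x"
  shows "0 \<le> integral {a..b} f"
  by (rule integral_nonneg[OF integrable_continuous_interval[OF assms(1)] assms(2)])

text \<open>Let \<open>M \<rho>\<close> be the integral of \<open>f\<close> over the circle of radius \<open>\<rho>\<close> with respect to the angle. In polar coordinates
  the Laplacian gives \<open>\<rho> \<Delta>f = \<partial>\<^sub>\<rho> (\<rho> \<partial>\<^sub>\<rho> f) + \<partial>\<^sub>\<theta> T\<close>, where \<open>T\<close> is the tangential derivative of \<open>f\<close>. The last term integrates
  to \<open>0\<close> over a period, so \<open>\<rho> M' \<rho>\<close> has a nonnegative derivative. It vanishes at \<open>\<rho> = 0\<close>, hence it is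
  nonnegative, hence \<open>M\<close> increases.\<close>

lemma circle_mean_mono:
  assumes S: "open S" and f: "smooth_on S f" and lap: "\<And>z. z \<in> S \<Longrightarrow> 0 \<le> laplacian f z"
    and r: "0 < r" "cball a r \<subseteq> S"
  shows "2 * pi * f a \<le> integral {0..2 * pi} (\<lambda>\<theta>. f (polar a r \<theta>))"
proof -
  define I :: "real set" where "I = cbox 0 (2 * pi)"
  have in_S: "polar a \<rho> \<theta> \<in> S" if "\<rho> \<in> {0..r}" for \<rho> \<theta>
    using that r(2) by (auto simp: polar_def dist_norm norm_mult subset_iff)
  let ?fx = "partial_x f" and ?fy = "partial_y f"
  have fx: "smooth_on S ?fx" and fy: "smooth_on S ?fy"
    using f smooth_on_partial_x smooth_on_partial_y by auto
  define R where "R \<rho> \<theta> = ?fx (polar a \<rho> \<theta>) * cos \<theta> + ?fy (polar a \<rho> \<theta>) * sin \<theta>" for \<rho> \<theta>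
  define T where "T \<rho> \<theta> = ?fy (polar a \<rho> \<theta>) * cos \<theta> - ?fx (polar a \<rho> \<theta>) * sin \<theta>" for \<rho> \<theta>
  define R' where "R' \<rho> \<theta> =
    (partial_x ?fx (polar a \<rho> \<theta>) * cos \<theta> + partial_y ?fx (polar a \<rho> \<theta>) * sin \<theta>) * cos \<theta> +
    (partial_x ?fy (polar a \<rho> \<theta>) * cos \<theta> + partial_y ?fy (polar a \<rho> \<theta>) * sin \<theta>) * sin \<theta>" for \<rho> \<theta>
  \<comment> \<open>the angular derivative of \<open>T\<close>, written in the form that the polar Laplacian suggests\<close>
  define T' where "T' \<rho> \<theta> = \<rho> * laplacian f (polar a \<rho> \<theta>) - (R \<rho> \<theta> + \<rho> * R' \<rho> \<theta>)" for \<rho> \<theta>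
  note cont = continuous_on_polar[OF smooth_on_continuous in_S]
  have cR: "continuous_on ({0..r} \<times> I) (\<lambda>x. R (fst x) (snd x))"
    unfolding R_def by (intro continuous_intros cont fx fy)
  have cR': "continuous_on ({0..r} \<times> I) (\<lambda>x. R' (fst x) (snd x))"
    unfolding R'_def by (intro continuous_intros cont smooth_on_partial_x smooth_on_partial_y fx fy)
  have clap: "continuous_on ({0..r} \<times> I) (\<lambda>x. laplacian f (polar a (fst x) (snd x)))"
    by (intro cont smooth_on_laplacian S f)
  have cf: "continuous_on ({0..r} \<times> I) (\<lambda>x. f (polar a (fst x) (snd x)))"
    by (intro cont f)
  have slice: "continuous_on I (\<lambda>\<theta>. h \<rho> \<theta>)"
    if "continuous_on ({0..r} \<times> I) (\<lambda>x. h (fst x) (snd x))" "\<rho> \<in> {0..r}" for h :: "real \<Rightarrow> real \<Rightarrow> real" and \<rho>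
  proof -
    have c: "continuous_on I (\<lambda>\<theta>. (\<rho>, \<theta>))"
      by (intro continuous_on_Pair continuous_on_const continuous_on_id)
    have im: "(\<lambda>\<theta>. (\<rho>, \<theta>)) ` I \<subseteq> {0..r} \<times> I" using that(2) by auto
    show ?thesis using continuous_on_compose2[OF that(1) c im] unfolding fst_conv snd_conv .
  qed
  have dT: "(T \<rho> has_real_derivative T' \<rho> \<theta>) (at \<theta>)" if \<rho>: "\<rho> \<in> {0..r}" for \<rho> \<theta>
  proof -
    note in_S[OF \<rho>, of \<theta>]
    note d = polar_has_derivative_angle[OF fx this] polar_has_derivative_angle[OF fy this]
    let ?p = "polar a \<rho> \<theta>"
    \<comment> \<open>The mixed derivatives appear in both orders on both sides and need not be equal. The last term
      vanishes because of the Pythagorean identity.\<close>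
    have rearrange: "(t * (fyy * c - fxy * s)) * c + y * - s - ((t * (fyx * c - fxx * s)) * s + x * c)
       = t * (fxx + fyy) - ((x * c + y * s) + t * ((fxx * c + fyx * s) * c + (fxy * c + fyy * s) * s))
         - t * (fxx + fyy) * (1 - (c\<^sup>2 + s\<^sup>2))" for t c s x y fxx fxy fyx fyy :: real
      by (simp add: algebra_simps power2_eq_square)
    have "(T \<rho> has_real_derivative
       (\<rho> * (partial_y ?fy ?p * cos \<theta> - partial_x ?fy ?p * sin \<theta>)) * cos \<theta> + ?fy ?p * - sin \<theta>
       - ((\<rho> * (partial_y ?fx ?p * cos \<theta> - partial_x ?fx ?p * sin \<theta>)) * sin \<theta> + ?fx ?p * cos \<theta>)) (at \<theta>)"
      unfolding T_def[abs_def] by (rule derivative_eq_intros d refl)+ (simp add: algebra_simps)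
    also have "(\<rho> * (partial_y ?fy ?p * cos \<theta> - partial_x ?fy ?p * sin \<theta>)) * cos \<theta> + ?fy ?p * - sin \<theta>
       - ((\<rho> * (partial_y ?fx ?p * cos \<theta> - partial_x ?fx ?p * sin \<theta>)) * sin \<theta> + ?fx ?p * cos \<theta>)
       = T' \<rho> \<theta> - \<rho> * (partial_x ?fx ?p + partial_y ?fy ?p) * (1 - ((cos \<theta>)\<^sup>2 + (sin \<theta>)\<^sup>2))"
      unfolding T'_def R_def R'_def laplacian_def by (rule rearrange)
    finally show ?thesis by simp
  qed
  have intT: "(T' \<rho> has_integral 0) I" if \<rho>: "\<rho> \<in> {0..r}" for \<rho>
  proof -
    have "(T' \<rho> has_integral (T \<rho> (2 * pi) - T \<rho> 0)) I"
      unfolding I_def cbox_interval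
      by (rule fundamental_theorem_of_calculus)
        (use has_field_derivative_at_within[OF dT[OF \<rho>]] in \<open>auto simp: has_real_derivative_iff_has_vector_derivative[symmetric]\<close>)
    then show ?thesis by (simp add: T_def polar_def)
  qed
  define W where "W \<rho> = integral I (\<lambda>\<theta>. \<rho> * R \<rho> \<theta>)" for \<rho>
  define M where "M \<rho> = integral I (\<lambda>\<theta>. f (polar a \<rho> \<theta>))" for \<rho>
  have dM: "(M has_real_derivative integral I (R \<rho>)) (at \<rho> within {0..r})" if "\<rho> \<in> {0..r}" for \<rho>
    unfolding M_def[abs_def] I_def
  proof (rule leibniz_rule_field_derivative)
    show "((\<lambda>\<rho>. f (polar a \<rho> \<theta>)) has_real_derivative R \<rho> \<theta>) (at \<rho> within {0..r})" if "\<rho> \<in> {0..r}" for \<rho> \<theta>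
      unfolding R_def by (rule has_field_derivative_at_within[OF polar_has_derivative_radius[OF f in_S[OF that]]])
    show "(\<lambda>\<theta>. f (polar a \<rho> \<theta>)) integrable_on cbox 0 (2 * pi)" if "\<rho> \<in> {0..r}" for \<rho>
      by (rule integrable_continuous) (use slice[OF cf that] in \<open>simp add: I_def\<close>)
    show "continuous_on ({0..r} \<times> cbox 0 (2 * pi)) (\<lambda>(x, y). R x y)"
      using cR by (simp add: I_def case_prod_beta')
  qed (use that in auto)
  have dW: "(W has_real_derivative integral I (\<lambda>\<theta>. R \<rho> \<theta> + \<rho> * R' \<rho> \<theta>)) (at \<rho> within {0..r})" if "\<rho> \<in> {0..r}" for \<rho>
    unfolding W_def[abs_def] I_def
  proof (rule leibniz_rule_field_derivative)
    show "((\<lambda>\<rho>. \<rho> * R \<rho> \<theta>) has_real_derivative R \<rho> \<theta> + \<rho> * R' \<rho> \<theta>) (at \<rho> within {0..r})" if "\<rho> \<in> {0..r}" for \<rho> \<theta>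
    proof -
      note d = polar_has_derivative_radius[OF fx in_S[OF that], of \<theta>] polar_has_derivative_radius[OF fy in_S[OF that], of \<theta>]
      have "((\<lambda>\<rho>. R \<rho> \<theta>) has_real_derivative R' \<rho> \<theta>) (at \<rho>)"
        unfolding R_def R'_def by (rule DERIV_add[OF DERIV_cmult_right[OF d(1)] DERIV_cmult_right[OF d(2)]])
      from DERIV_mult[OF DERIV_ident this]
      have "((\<lambda>\<rho>. \<rho> * R \<rho> \<theta>) has_real_derivative R \<rho> \<theta> + \<rho> * R' \<rho> \<theta>) (at \<rho>)"
        by (simp add: algebra_simps)
      then show ?thesis by (rule has_field_derivative_at_within)
    qed
    show "(\<lambda>\<theta>. \<rho> * R \<rho> \<theta>) integrable_on cbox 0 (2 * pi)" if "\<rho> \<in> {0..r}" for \<rho>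
      by (rule integrable_continuous) (use slice[OF cR that] in \<open>auto simp: I_def intro!: continuous_intros\<close>)
    show "continuous_on ({0..r} \<times> cbox 0 (2 * pi)) (\<lambda>(x, y). R x y + x * R' x y)"
      using continuous_on_add[OF cR continuous_on_mult[OF continuous_on_fst[OF continuous_on_id] cR']]
      by (simp add: I_def case_prod_beta')
  qed (use that in auto)
  have W'_nonneg: "0 \<le> integral I (\<lambda>\<theta>. R \<rho> \<theta> + \<rho> * R' \<rho> \<theta>)" if \<rho>: "\<rho> \<in> {0..r}" for \<rho>
  proof -
    have c: "continuous_on I (\<lambda>\<theta>. \<rho> * laplacian f (polar a \<rho> \<theta>))"
      by (intro continuous_intros slice[OF clap \<rho>])
    have "integral I (\<lambda>\<theta>. R \<rho> \<theta> + \<rho> * R' \<rho> \<theta>) = integral I (\<lambda>\<theta>. \<rho> * laplacian f (polar a \<rho> \<theta>) - T' \<rho> \<theta>)"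
      by (simp add: T'_def)
    also have "\<dots> = integral I (\<lambda>\<theta>. \<rho> * laplacian f (polar a \<rho> \<theta>)) - integral I (T' \<rho>)"
      by (rule Henstock_Kurzweil_Integration.integral_diff)
        (use intT[OF \<rho>] c in \<open>auto simp: I_def intro: integrable_continuous_interval\<close>)
    also have "\<dots> = integral I (\<lambda>\<theta>. \<rho> * laplacian f (polar a \<rho> \<theta>))"
      using integral_unique[OF intT[OF \<rho>]] by simp
    also have "\<dots> \<ge> 0"
      using c lap[OF in_S[OF \<rho>]] \<rho> unfolding I_def cbox_interval by (intro integral_nonneg_continuous) auto
    finally show ?thesis .
  qed
  have at_within: "at \<rho> within {0..r} = at \<rho>" if "0 < \<rho>" "\<rho> < r" for \<rho>
    using that by (intro at_within_interior) auto
  have W_nonneg: "0 \<le> W \<rho>" if \<rho>: "0 < \<rho>" "\<rho> < r" for \<rho>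
  proof -
    have "W 0 \<le> W \<rho>"
    proof (rule DERIV_nonneg_imp_increasing_open[of 0 \<rho> W])
      show "0 \<le> \<rho>" using \<rho> by simp
      show "\<exists>y. (W has_real_derivative y) (at s) \<and> 0 \<le> y" if "0 < s" "s < \<rho>" for s
        using dW[of s] W'_nonneg[of s] at_within[of s] that \<rho> by auto
      have "continuous_on {0..r} W"
        by (rule DERIV_continuous_on) (rule dW)
      then show "continuous_on {0..\<rho>} W" by (rule continuous_on_subset) (use \<rho> in auto)
    qed
    then show ?thesis by (simp add: W_def)
  qed
  have "M 0 \<le> M r"
  proof (rule DERIV_nonneg_imp_increasing_open[of 0 r M])
    show "0 \<le> r" using r by simp
    show "\<exists>y. (M has_real_derivative y) (at s) \<and> 0 \<le> y" if "0 < s" "s < r" for s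
    proof -
      have "0 \<le> s * integral I (R s)"
        using W_nonneg[OF that] by (simp add: W_def)
      then have "0 \<le> integral I (R s)" using that by (simp add: zero_le_mult_iff)
      then show ?thesis using dM[of s] at_within[OF that] that by auto
    qed
    show "continuous_on {0..r} M"
      by (rule DERIV_continuous_on) (rule dM)
  qed
  moreover have "M 0 = 2 * pi * f a" by (simp add: M_def polar_def I_def)
  ultimately show ?thesis by (simp add: M_def I_def)
qed

lemma subharmonic_on_laplacian_nonneg:
  assumes "open S" "smooth_on S f" "\<And>z. z \<in> S \<Longrightarrow> 0 \<le> laplacian f z"
  shows "subharmonic_on S f"
  unfolding subharmonic_on_def
proof (intro conjI allI impI)
  fix c
  have "openin (top_of_set S) (S \<inter> f -` {..<c})"
    by (rule continuous_openin_preimage_gen[OF smooth_on_continuous[OF assms(2)] open_lessThan])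
  moreover have "S \<inter> f -` {..<c} = {z \<in> S. f z < c}" by auto
  ultimately show "openin (top_of_set S) {z \<in> S. f z < c}" by simp
next
  fix a and r :: real assume r: "0 < r \<and> cball a r \<subseteq> S"
  then have im: "polar a r ` {0..2 * pi} \<subseteq> S"
    by (auto simp: polar_def dist_norm norm_mult subset_iff)
  have "continuous_on {0..2 * pi} (polar a r)"
    unfolding polar_def by (intro continuous_intros)
  from continuous_on_compose2[OF smooth_on_continuous[OF assms(2)] this im]
  have "continuous_on {0..2 * pi} (\<lambda>\<theta>. f (a + of_real r * cis \<theta>))"
    unfolding polar_def .
  then show "(\<lambda>\<theta>. f (a + of_real r * cis \<theta>)) integrable_on {0..2 * pi}"
    by (rule integrable_continuous_interval)
  show "f a \<le> 1 / (2 * pi) * integral {0..2 * pi} (\<lambda>\<theta>. f (a + of_real r * cis \<theta>))"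
    using circle_mean_mono[OF assms(1-3), of r a] r by (simp add: polar_def field_simps)
qed

section \<open>Integrals in the plane and parallel transport along lines\<close>

lemma measurable_Complex[measurable]: "(\<lambda>(x, y). Complex x y) \<in> borel_measurable (lborel \<Otimes>\<^sub>M lborel)"
proof -
  have "(\<lambda>w :: real \<times> real. of_real (fst w) + \<i> * of_real (snd w)) \<in> borel_measurable borel"
    by (intro borel_measurable_continuous_onI continuous_intros)
  then show ?thesis by (simp add: lborel_prod Complex_eq case_prod_beta')
qed

lemma lborel_complex: "(lborel :: complex measure) = distr (lborel \<Otimes>\<^sub>M lborel) borel (\<lambda>(x, y). Complex x y)"
proof (rule lborel_eqI)
  fix l u :: complex assume le: "\<And>b. b \<in> Basis \<Longrightarrow> l \<bullet> b \<le> u \<bullet> b"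
  have *: "Re l \<le> Re u" "Im l \<le> Im u"
    using le[of 1] le[of \<i>] by (auto simp: Basis_complex_def)
  have "(\<lambda>(x, y). Complex x y) -` box l u \<inter> space (lborel \<Otimes>\<^sub>M lborel) = {Re l<..<Re u} \<times> {Im l<..<Im u}"
    by (auto simp: box_def Basis_complex_def space_pair_measure)
  then have "emeasure (distr (lborel \<Otimes>\<^sub>M lborel) borel (\<lambda>(x, y). Complex x y)) (box l u)
      = emeasure (lborel \<Otimes>\<^sub>M lborel) ({Re l<..<Re u} \<times> {Im l<..<Im u})"
    by (subst emeasure_distr) auto
  also have "\<dots> = ennreal (Re u - Re l) * ennreal (Im u - Im l)"
    using * by (subst lborel.emeasure_pair_measure_Times) auto
  also have "\<dots> = (\<Prod>b\<in>Basis. (u - l) \<bullet> b)"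
    using * by (simp add: Basis_complex_def ennreal_mult)
  finally show "emeasure (distr (lborel \<Otimes>\<^sub>M lborel) borel (\<lambda>(x, y). Complex x y)) (box l u)
      = (\<Prod>b\<in>Basis. (u - l) \<bullet> b)" .
qed simp

lemma nn_integral_complex:
  assumes [measurable]: "f \<in> borel_measurable borel"
  shows "(\<integral>\<^sup>+z. f z \<partial>lborel) = (\<integral>\<^sup>+x. \<integral>\<^sup>+y. f (Complex x y) \<partial>lborel \<partial>lborel)"
    and "(\<integral>\<^sup>+z. f z \<partial>lborel) = (\<integral>\<^sup>+y. \<integral>\<^sup>+x. f (Complex x y) \<partial>lborel \<partial>lborel)"
proof -
  have m: "(\<lambda>w. f (case w of (x, y) \<Rightarrow> Complex x y)) \<in> borel_measurable (lborel \<Otimes>\<^sub>M lborel)"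
    by (rule measurable_compose[OF measurable_Complex assms])
  have "(\<integral>\<^sup>+z. f z \<partial>lborel) = (\<integral>\<^sup>+w. f (case w of (x, y) \<Rightarrow> Complex x y) \<partial>(lborel \<Otimes>\<^sub>M lborel))"
    by (subst lborel_complex, rule nn_integral_distr) auto
  then show "(\<integral>\<^sup>+z. f z \<partial>lborel) = (\<integral>\<^sup>+x. \<integral>\<^sup>+y. f (Complex x y) \<partial>lborel \<partial>lborel)"
    and "(\<integral>\<^sup>+z. f z \<partial>lborel) = (\<integral>\<^sup>+y. \<integral>\<^sup>+x. f (Complex x y) \<partial>lborel \<partial>lborel)"
    using lborel.nn_integral_fst[OF m] lborel_pair.nn_integral_snd[OF m]
    by (simp_all add: case_prod_beta')
qed

lemma nn_integral_translate:
  fixes f :: "complex \<Rightarrow> ennreal"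
  assumes [measurable]: "f \<in> borel_measurable borel"
  shows "(\<integral>\<^sup>+z. f (c + z) \<partial>lborel) = (\<integral>\<^sup>+z. f z \<partial>lborel)"
proof -
  have "(\<integral>\<^sup>+z. f z \<partial>lborel) = (\<integral>\<^sup>+z. f z \<partial>(distr lborel borel ((+) c)))"
    by (simp add: lborel_distr_plus)
  also have "\<dots> = (\<integral>\<^sup>+z. f (c + z) \<partial>lborel)"
    by (rule nn_integral_distr) auto
  finally show ?thesis ..
qed

lemma nn_integral_Icc:
  fixes g :: "real \<Rightarrow> real"
  assumes "continuous_on {a..b} g" "\<And>s. s \<in> {a..b} \<Longrightarrow> 0 \<le> g s"
  shows "(\<integral>\<^sup>+s\<in>{a..b}. ennreal (g s) \<partial>lborel) = ennreal (integral {a..b} g)"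
proof -
  have "set_integrable lborel {a..b} g"
    by (rule borel_integrable_atLeastAtMost') (rule assms)
  then have int: "integrable lborel (\<lambda>s. indicator {a..b} s *\<^sub>R g s)"
    by (simp add: set_integrable_def)
  have "(\<integral>\<^sup>+s\<in>{a..b}. ennreal (g s) \<partial>lborel) = (\<integral>\<^sup>+s. ennreal (indicator {a..b} s *\<^sub>R g s) \<partial>lborel)"
    by (intro nn_integral_cong) (auto split: split_indicator)
  also have "\<dots> = ennreal (\<integral>s. indicator {a..b} s *\<^sub>R g s \<partial>lborel)"
    by (rule nn_integral_eq_integral[OF int]) (use assms in \<open>auto split: split_indicator\<close>)
  also have "(\<integral>s. indicator {a..b} s *\<^sub>R g s \<partial>lborel) = integral {a..b} g"
    using set_borel_integral_eq_integral(2)[OF \<open>set_integrable lborel {a..b} g\<close>]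
    by (simp add: set_lebesgue_integral_def)
  finally show ?thesis .
qed

lemma ennreal_line_integral:
  fixes f :: "complex \<Rightarrow> real"
  assumes f: "continuous_on UNIV f" "\<And>z. 0 \<le> f z"
  shows "ennreal (integral {0..\<epsilon>} (\<lambda>s. f (z + c + of_real s * d)))
      = (\<integral>\<^sup>+s\<in>{0..\<epsilon>}. ennreal (f (z + c + of_real s * d)) \<partial>lborel)"
proof (rule nn_integral_Icc[symmetric])
  have "continuous_on {0..\<epsilon>} (\<lambda>s. z + c + of_real s * d)"
    by (intro continuous_intros)
  from continuous_on_compose2[OF f(1) this]
  show "continuous_on {0..\<epsilon>} (\<lambda>s. f (z + c + of_real s * d))" by simp
qed (rule f)

lemma borel_measurable_line_integral:
  fixes f :: "complex \<Rightarrow> real"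
  assumes f: "continuous_on UNIV f" "\<And>z. 0 \<le> f z"
  shows "(\<lambda>z. ennreal (integral {0..\<epsilon>} (\<lambda>s. f (z + c + of_real s * d)))) \<in> borel_measurable borel"
proof -
  have [measurable]: "f \<in> borel_measurable borel"
    by (rule borel_measurable_continuous_onI[OF f(1)])
  show ?thesis unfolding ennreal_line_integral[OF f] by measurable
qed

text \<open>Tonelli and translation invariance: each point of the moving segment contributes the
  same amount. This turns line integrals along the sides of a square, averaged over the position of the
  square, into area integrals.\<close>

lemma nn_integral_sweep:
  fixes f :: "complex \<Rightarrow> real"
  assumes f: "continuous_on UNIV f" "\<And>z. 0 \<le> f z" and e: "0 \<le> \<epsilon>"
  shows "(\<integral>\<^sup>+z. ennreal (integral {0..\<epsilon>} (\<lambda>s. f (z + c + of_real s * d))) \<partial>lborel) = ennreal \<epsilon> * (\<integral>\<^sup>+z. f z \<partial>lborel)"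
proof -
  have [measurable]: "f \<in> borel_measurable borel"
    by (rule borel_measurable_continuous_onI[OF f(1)])
  have "(\<integral>\<^sup>+z. ennreal (integral {0..\<epsilon>} (\<lambda>s. f (z + c + of_real s * d))) \<partial>lborel)
      = (\<integral>\<^sup>+z. \<integral>\<^sup>+s. ennreal (f (z + c + of_real s * d)) * indicator {0..\<epsilon>} s \<partial>lborel \<partial>lborel)"
    unfolding ennreal_line_integral[OF f] ..
  also have "\<dots> = (\<integral>\<^sup>+s. \<integral>\<^sup>+z. ennreal (f (z + c + of_real s * d)) * indicator {0..\<epsilon>} s \<partial>lborel \<partial>lborel)"
    by (rule lborel_pair.Fubini'[symmetric]) measurable
  also have "\<dots> = (\<integral>\<^sup>+s. (\<integral>\<^sup>+z. f z \<partial>lborel) * indicator {0..\<epsilon>} s \<partial>lborel)"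
  proof (rule nn_integral_cong)
    fix s :: real
    have "(\<integral>\<^sup>+z. ennreal (f (z + c + of_real s * d)) * indicator {0..\<epsilon>} s \<partial>lborel)
        = (\<integral>\<^sup>+z. ennreal (f ((c + of_real s * d) + z)) \<partial>lborel) * indicator {0..\<epsilon>} s"
      by (subst nn_integral_multc[symmetric]) (auto simp: algebra_simps)
    then show "(\<integral>\<^sup>+z. ennreal (f (z + c + of_real s * d)) * indicator {0..\<epsilon>} s \<partial>lborel)
        = (\<integral>\<^sup>+z. f z \<partial>lborel) * indicator {0..\<epsilon>} s"
      by (subst (asm) nn_integral_translate) auto
  qed
  also have "\<dots> = (\<integral>\<^sup>+z. f z \<partial>lborel) * ennreal \<epsilon>"
    using e by (simp add: nn_integral_cmult_indicator)
  finally show ?thesis by (simp add: mult.commute)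
qed

text \<open>Cauchy--Schwarz on an interval, from the integral of \<open>(g - m)\<^sup>2\<close> with \<open>m\<close> the mean value of \<open>g\<close>.\<close>

lemma integral_square_le:
  fixes g :: "real \<Rightarrow> real"
  assumes g: "continuous_on {0..\<epsilon>} g" and e: "0 < \<epsilon>"
  shows "(integral {0..\<epsilon>} g)\<^sup>2 \<le> \<epsilon> * integral {0..\<epsilon>} (\<lambda>s. (g s)\<^sup>2)"
proof -
  define m where "m = integral {0..\<epsilon>} g / \<epsilon>"
  have m: "integral {0..\<epsilon>} g = \<epsilon> * m" using e by (simp add: m_def)
  have i: "(\<lambda>s. (g s)\<^sup>2) integrable_on {0..\<epsilon>}" "g integrable_on {0..\<epsilon>}"
    by (auto intro!: integrable_continuous_interval continuous_intros g)
  have "((\<lambda>s. (g s)\<^sup>2 - 2 * m * g s + m\<^sup>2) has_integral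
      integral {0..\<epsilon>} (\<lambda>s. (g s)\<^sup>2) - 2 * m * integral {0..\<epsilon>} g + (\<epsilon> - 0) *\<^sub>R m\<^sup>2) {0..\<epsilon>}"
    by (intro has_integral_add has_integral_diff has_integral_mult_right integrable_integral i)
      (use has_integral_const_real[of "m\<^sup>2" 0 \<epsilon>] e in simp)
  then have "0 \<le> integral {0..\<epsilon>} (\<lambda>s. (g s)\<^sup>2) - 2 * m * integral {0..\<epsilon>} g + (\<epsilon> - 0) *\<^sub>R m\<^sup>2"
  proof (rule has_integral_nonneg)
    fix s
    have "(g s)\<^sup>2 - 2 * m * g s + m\<^sup>2 = (g s - m)\<^sup>2" by (simp add: power2_diff)
    then show "0 \<le> (g s)\<^sup>2 - 2 * m * g s + m\<^sup>2" by simp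
  qed
  then have "\<epsilon> * m\<^sup>2 \<le> integral {0..\<epsilon>} (\<lambda>s. (g s)\<^sup>2)"
    by (simp add: m power2_eq_square algebra_simps)
  then have "\<epsilon> * (\<epsilon> * m\<^sup>2) \<le> \<epsilon> * integral {0..\<epsilon>} (\<lambda>s. (g s)\<^sup>2)"
    using e by simp
  then show ?thesis by (simp add: m power2_eq_square algebra_simps)
qed

text \<open>Along a line the magnetic potential can be gauged away: the phase \<open>cis (\<integral> a)\<close> turns the covariant
  derivative \<open>d\<close> of \<open>v\<close> into an ordinary one.\<close>

lemma parallel_transport:
  fixes v d :: "real \<Rightarrow> complex" and a :: "real \<Rightarrow> real"
  assumes e: "0 \<le> \<epsilon>" and a: "continuous_on {0..\<epsilon>} a" and d: "continuous_on {0..\<epsilon>} d"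
    and v: "\<And>s. s \<in> {0..\<epsilon>} \<Longrightarrow> (v has_vector_derivative (d s - \<i> * of_real (a s) * v s)) (at s)"
  shows "cmod (v \<epsilon> * cis (integral {0..\<epsilon>} a) - v 0) \<le> integral {0..\<epsilon>} (\<lambda>s. cmod (d s))"
proof -
  define \<alpha> where "\<alpha> s = integral {0..s} a" for s
  have d\<alpha>: "(\<alpha> has_vector_derivative a s) (at s within {0..\<epsilon>})" if "s \<in> {0..\<epsilon>}" for s
    unfolding \<alpha>_def[abs_def] by (rule integral_has_vector_derivative[OF a that])
  have dcis: "((\<lambda>s. cis (\<alpha> s)) has_vector_derivative (of_real (a s) * (\<i> * cis (\<alpha> s)))) (at s within {0..\<epsilon>})"
    if "s \<in> {0..\<epsilon>}" for s
    using has_derivative_compose[OF d\<alpha>[OF that, unfolded has_vector_derivative_def] cis_has_derivative]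
    unfolding has_vector_derivative_def by (rule has_derivative_eq_rhs) (simp add: fun_eq_iff scaleR_conv_of_real)
  have dw: "((\<lambda>s. v s * cis (\<alpha> s)) has_vector_derivative (d s * cis (\<alpha> s))) (at s within {0..\<epsilon>})"
    if s: "s \<in> {0..\<epsilon>}" for s
  proof -
    have "((\<lambda>s. v s * cis (\<alpha> s)) has_vector_derivative
        (v s * (of_real (a s) * (\<i> * cis (\<alpha> s))) + (d s - \<i> * of_real (a s) * v s) * cis (\<alpha> s))) (at s within {0..\<epsilon>})"
      by (rule has_vector_derivative_mult[OF has_vector_derivative_at_within[OF v[OF s]] dcis[OF s]])
    then show ?thesis by (simp add: algebra_simps)
  qed
  have "((\<lambda>s. d s * cis (\<alpha> s)) has_integral (v \<epsilon> * cis (\<alpha> \<epsilon>) - v 0 * cis (\<alpha> 0))) {0..\<epsilon>}"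
    by (rule fundamental_theorem_of_calculus[OF e dw])
  then have "integral {0..\<epsilon>} (\<lambda>s. d s * cis (\<alpha> s)) = v \<epsilon> * cis (\<alpha> \<epsilon>) - v 0"
    and int: "(\<lambda>s. d s * cis (\<alpha> s)) integrable_on {0..\<epsilon>}"
    by (auto simp: \<alpha>_def has_integral_iff)
  moreover have "cmod (integral {0..\<epsilon>} (\<lambda>s. d s * cis (\<alpha> s))) \<le> integral {0..\<epsilon>} (\<lambda>s. cmod (d s))"
    by (rule integral_norm_bound_integral[OF int])
      (auto simp: norm_mult intro!: integrable_continuous_interval continuous_on_norm d)
  ultimately show ?thesis by (simp add: \<alpha>_def)
qed

text \<open>The value \<open>u\<close> at one corner of a square is carried to the value \<open>Z\<close> at the opposite corner along both pairs of
  sides. Both results are close to \<open>Z\<close> if the covariant derivative is small on the sides, but they differ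
  by the holonomy, whose phase has nonpositive cosine, so that they are at least \<open>\<surd>2 |u|\<close> apart.\<close>

lemma transport_two_paths:
  assumes "cmod (w1 * cis a - u) \<le> I1" "cmod (Z * cis b - w1) \<le> I2"
    and "cmod (w2 * cis c - u) \<le> I3" "cmod (Z * cis d - w2) \<le> I4"
    and "cos (a + b - (c + d)) \<le> 0"
  shows "2 * (cmod u)\<^sup>2 \<le> (I1 + I2 + I3 + I4)\<^sup>2"
proof -
  have path: "cmod (Z - u * cis (- (s + t))) \<le> J + L"
    if "cmod (w * cis s - u) \<le> J" "cmod (Z * cis t - w) \<le> L" for w s t J L
  proof -
    have "cmod (Z - u * cis (- (s + t))) = cmod ((Z - u * cis (- (s + t))) * cis (s + t))"
      by (simp add: norm_mult)
    also have "(Z - u * cis (- (s + t))) * cis (s + t) = (Z * cis t - w) * cis s + (w * cis s - u)"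
      by (simp add: algebra_simps cis_mult)
    also have "cmod \<dots> \<le> cmod ((Z * cis t - w) * cis s) + cmod (w * cis s - u)"
      by (rule norm_triangle_ineq)
    also have "cmod ((Z * cis t - w) * cis s) = cmod (Z * cis t - w)"
      by (simp add: norm_mult)
    finally show ?thesis using that by linarith
  qed
  let ?s = "- (a + b)" and ?t = "- (c + d)"
  have "cmod (u * cis ?s - u * cis ?t) \<le> (I1 + I2) + (I3 + I4)"
    using norm_triangle_ineq4[of "Z - u * cis ?t" "Z - u * cis ?s"] path[OF assms(1,2)] path[OF assms(3,4)]
    by (simp add: algebra_simps)
  then have "(cmod (u * cis ?s - u * cis ?t))\<^sup>2 \<le> (I1 + I2 + I3 + I4)\<^sup>2"
    by (intro power_mono) auto
  moreover have "(cmod (u * cis ?s - u * cis ?t))\<^sup>2 = (cmod u)\<^sup>2 * (2 - 2 * cos (a + b - (c + d)))"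
  proof -
    have "cos (a + b - (c + d)) = cos ?s * cos ?t + sin ?s * sin ?t"
    proof -
      have "cos (a + b - (c + d)) = cos (?t - ?s)" by (simp add: algebra_simps)
      also have "\<dots> = cos ?t * cos ?s + sin ?t * sin ?s" by (rule cos_diff)
      finally show ?thesis by (simp only: mult.commute)
    qed
    moreover have "(cmod (cis ?s - cis ?t))\<^sup>2 = ((cos ?s)\<^sup>2 + (sin ?s)\<^sup>2) + ((cos ?t)\<^sup>2 + (sin ?t)\<^sup>2) - 2 * (cos ?s * cos ?t + sin ?s * sin ?t)"
      unfolding cmod_power2 by (simp add: power2_diff del: sin_cos_squared_add sin_cos_squared_add2)
    ultimately have "(cmod (cis ?s - cis ?t))\<^sup>2 = 2 - 2 * cos (a + b - (c + d))" by simp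
    moreover have "u * cis ?s - u * cis ?t = u * (cis ?s - cis ?t)" by (simp add: algebra_simps)
    ultimately show ?thesis by (simp add: norm_mult power_mult_distrib)
  qed
  moreover have "(cmod u)\<^sup>2 * 2 \<le> (cmod u)\<^sup>2 * (2 - 2 * cos (a + b - (c + d)))"
    using assms(5) by (intro mult_left_mono) auto
  ultimately show ?thesis by linarith
qed

text \<open>The magnetic potential drops out of the derivative of \<open>|v|\<^sup>2\<close>, because it is real:
  this derivative is twice the real part of \<open>cnj v * d\<close>, hence at most \<open>|v|\<^sup>2 + |d|\<^sup>2\<close>.\<close>

lemma square_modulus_le_line_energy:
  fixes v d :: "real \<Rightarrow> complex" and a :: "real \<Rightarrow> real"
  assumes d: "continuous_on UNIV d"
    and v: "\<And>s. (v has_vector_derivative (d s - \<i> * of_real (a s) * v s)) (at s)"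
    and v0: "\<And>s. s \<le> c \<Longrightarrow> v s = 0"
  shows "ennreal ((cmod (v x))\<^sup>2) \<le> (\<integral>\<^sup>+s. ennreal ((cmod (v s))\<^sup>2 + (cmod (d s))\<^sup>2) \<partial>lborel)"
proof (cases "c \<le> x")
  case False
  then show ?thesis using v0[of x] by simp
next
  case True
  have cv: "continuous_on UNIV v"
    by (intro continuous_at_imp_continuous_on ballI has_vector_derivative_continuous[OF v])
  have ReIm: "(Re \<circ> v has_real_derivative Re (d s - \<i> * of_real (a s) * v s)) (at s)"
    "(Im \<circ> v has_real_derivative Im (d s - \<i> * of_real (a s) * v s)) (at s)" for s
    using bounded_linear.has_vector_derivative[OF bounded_linear_Re v[of s]]
      bounded_linear.has_vector_derivative[OF bounded_linear_Im v[of s]]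
    unfolding has_real_derivative_iff_has_vector_derivative comp_def by auto
  let ?g = "\<lambda>s. 2 * (Re (v s) * Re (d s) + Im (v s) * Im (d s))"
  have dn: "((\<lambda>s. (cmod (v s))\<^sup>2) has_real_derivative ?g s) (at s)" for s
  proof -
    have "((\<lambda>s. (Re \<circ> v) s * (Re \<circ> v) s + (Im \<circ> v) s * (Im \<circ> v) s) has_real_derivative
      (Re (d s - \<i> * of_real (a s) * v s) * (Re \<circ> v) s + Re (d s - \<i> * of_real (a s) * v s) * (Re \<circ> v) s) +
      (Im (d s - \<i> * of_real (a s) * v s) * (Im \<circ> v) s + Im (d s - \<i> * of_real (a s) * v s) * (Im \<circ> v) s)) (at s)"
      by (intro DERIV_add DERIV_mult ReIm)
    moreover have "(\<lambda>s. (Re \<circ> v) s * (Re \<circ> v) s + (Im \<circ> v) s * (Im \<circ> v) s) = (\<lambda>s. (cmod (v s))\<^sup>2)"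
      by (simp add: cmod_power2 fun_eq_iff flip: power2_eq_square)
    ultimately show ?thesis by (simp add: algebra_simps)
  qed
  have g: "(?g has_integral ((cmod (v x))\<^sup>2 - (cmod (v c))\<^sup>2)) {c..x}"
    by (rule fundamental_theorem_of_calculus[OF True])
      (use has_field_derivative_at_within[OF dn] in \<open>simp add: has_real_derivative_iff_has_vector_derivative[symmetric]\<close>)
  let ?h = "\<lambda>s. (cmod (v s))\<^sup>2 + (cmod (d s))\<^sup>2"
  have ch: "continuous_on {c..x} ?h"
    by (intro continuous_intros continuous_on_subset[OF cv] continuous_on_subset[OF d]) auto
  have "(cmod (v x))\<^sup>2 \<le> integral {c..x} ?h"
  proof (rule has_integral_le[OF _ integrable_integral[OF integrable_continuous_interval[OF ch]]])
    show "(?g has_integral (cmod (v x))\<^sup>2) {c..x}" using g v0[of c] by simp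
    fix s
    have "0 \<le> (Re (v s) - Re (d s))\<^sup>2 + (Im (v s) - Im (d s))\<^sup>2" by simp
    then show "?g s \<le> ?h s"
      unfolding cmod_power2 by (simp add: power2_diff algebra_simps)
  qed
  then have "ennreal ((cmod (v x))\<^sup>2) \<le> ennreal (integral {c..x} ?h)" by (rule ennreal_leI)
  also have "\<dots> = (\<integral>\<^sup>+s\<in>{c..x}. ennreal (?h s) \<partial>lborel)"
    by (rule nn_integral_Icc[symmetric, OF ch]) simp
  also have "\<dots> \<le> (\<integral>\<^sup>+s. ennreal (?h s) \<partial>lborel)"
    by (intro nn_integral_mono) (auto split: split_indicator)
  finally show ?thesis .
qed

section \<open>Green's formula on a square\<close>

text \<open>A test function may have arbitrary values outside \<open>S\<close>. Replacing them by \<open>0\<close> makes it smooth on the whole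
  plane, so that integrals along lines and translations are available.\<close>

lemma test_function_extension:
  assumes S: "open S" and u: "u \<in> test_functions S"
  obtains v K where "smooth_on UNIV v" "compact K" "K \<subseteq> S" "\<And>z. z \<in> S \<Longrightarrow> v z = u z" "\<And>z. z \<notin> K \<Longrightarrow> v z = 0"
proof -
  define K where "K = closure (support_on S u)"
  define v where "v z = (if z \<in> S then u z else 0)" for z
  have K: "compact K" "K \<subseteq> S" and su: "smooth_on S u"
    using u by (auto simp: test_functions_def K_def)
  have v0: "v z = 0" if "z \<notin> K" for z
  proof (rule ccontr)
    assume "v z \<noteq> 0"
    then have "z \<in> support_on S u" by (auto simp: v_def support_on_def split: if_splits)
    then show False using that closure_subset by (auto simp: K_def)
  qed
  have a: "smooth_on S v"
    by (rule smooth_on_cong[OF su S]) (simp add: v_def)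
  have b: "smooth_on (- K) v"
    by (rule smooth_on_cong[OF smooth_on_const[of "- K" 0]])
      (use K v0 in \<open>auto intro: compact_imp_closed open_Compl\<close>)
  have "S \<union> - K = UNIV" using K by auto
  with smooth_on_Un[OF S _ a b] have "smooth_on UNIV v"
    using K by (simp add: compact_imp_closed open_Compl)
  then show ?thesis
    using that[of v K] K v0 by (simp add: v_def)
qed

lemma partial_xy_cong:
  assumes "open S" "z \<in> S" "\<And>w. w \<in> S \<Longrightarrow> f w = g w" "smooth_on S f"
  shows "partial_x f z = partial_x g z" "partial_y f z = partial_y g z"
proof -
  have "f differentiable at z"
    using smooth_on_has_derivative[OF assms(4,2)] by (rule differentiableI)
  then have "frechet_derivative f (at z) = frechet_derivative g (at z)"
    by (rule frechet_derivative_transform_within_open[OF _ assms(1-3)])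
  then show "partial_x f z = partial_x g z" "partial_y f z = partial_y g z"
    by (simp_all add: partial_x_def partial_y_def)
qed

lemma partial_xy_eq_0:
  fixes v :: "complex \<Rightarrow> 'b::real_normed_vector"
  assumes "compact K" "\<And>z. z \<notin> K \<Longrightarrow> v z = 0" "z \<notin> K"
  shows "partial_x v z = 0" "partial_y v z = 0"
proof -
  have "open (- K)" using assms(1) by (simp add: compact_imp_closed open_Compl)
  from partial_xy_cong[OF this, of z "\<lambda>_. 0" v] assms
  show "partial_x v z = 0" "partial_y v z = 0"
    by (auto simp: smooth_on_const partial_x_def partial_y_def)
qed

lemma set_lebesgue_integral_compact_support:
  fixes g :: "complex \<Rightarrow> real"
  assumes S: "open S" and K: "compact K" "K \<subseteq> S" and g: "continuous_on S g"
    and g0: "\<And>z. z \<in> S - K \<Longrightarrow> g z = 0"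
  shows "set_integrable lborel S g"
    and "(\<And>z. z \<in> S \<Longrightarrow> 0 \<le> g z) \<Longrightarrow>
      ennreal (LINT z:S|lborel. g z) = (\<integral>\<^sup>+z\<in>S. ennreal (g z) \<partial>lborel)"
proof -
  have eq: "(\<lambda>z. indicator S z *\<^sub>R g z) = (\<lambda>z. indicator K z *\<^sub>R g z)"
    using K(2) g0 by (auto simp: fun_eq_iff split: split_indicator)
  have int: "integrable lborel (\<lambda>z. indicator S z *\<^sub>R g z)"
    unfolding eq by (rule borel_integrable_compact[OF K(1) continuous_on_subset[OF g K(2)]])
  then show "set_integrable lborel S g" by (simp add: set_integrable_def)
  assume pos: "\<And>z. z \<in> S \<Longrightarrow> 0 \<le> g z"
  have "ennreal (LINT z:S|lborel. g z) = (\<integral>\<^sup>+z. ennreal (indicator S z *\<^sub>R g z) \<partial>lborel)"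
    unfolding set_lebesgue_integral_def
    by (rule nn_integral_eq_integral[OF int, symmetric]) (use pos in \<open>auto split: split_indicator\<close>)
  also have "\<dots> = (\<integral>\<^sup>+z\<in>S. ennreal (g z) \<partial>lborel)"
    by (intro nn_integral_cong) (auto split: split_indicator)
  finally show "ennreal (LINT z:S|lborel. g z) = (\<integral>\<^sup>+z\<in>S. ennreal (g z) \<partial>lborel)" .
qed

text \<open>The flux through the square with lower left corner \<open>z\<close>, as an iterated integral.\<close>

definition square_flux :: "(complex \<Rightarrow> real) \<Rightarrow> complex \<Rightarrow> real \<Rightarrow> real" where
  "square_flux B z \<epsilon> = integral {0..\<epsilon>} (\<lambda>t. integral {0..\<epsilon>} (\<lambda>s. B (z + Complex s t)))"

lemma square_in_ball:
  assumes "cmod z < 1" "0 \<le> s" "s \<le> 1" "0 \<le> t" "t \<le> 1"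
  shows "z + Complex s t \<in> ball 0 4"
proof -
  have "cmod (z + Complex s t) \<le> cmod z + (\<bar>s\<bar> + \<bar>t\<bar>)"
    using norm_triangle_ineq[of z "Complex s t"] cmod_le[of "Complex s t"] by simp
  then show ?thesis using assms by simp
qed

lemma line_has_vector_derivative:
  assumes "smooth_on T v" "z + of_real s * e \<in> T"
  shows "((\<lambda>s. v (z + of_real s * e)) has_vector_derivative
    (Re e *\<^sub>R partial_x v (z + of_real s * e) + Im e *\<^sub>R partial_y v (z + of_real s * e))) (at s)"
proof -
  have "((\<lambda>s. z + of_real s * e) has_derivative (\<lambda>h. of_real h * e)) (at s)"
    by (auto intro!: derivative_eq_intros simp: fun_eq_iff scaleR_conv_of_real)
  from has_derivative_compose[OF this smooth_on_has_partials[OF assms]]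
  show ?thesis
    unfolding has_vector_derivative_def
    by (rule has_derivative_eq_rhs) (simp add: fun_eq_iff scaleR_right_distrib)
qed

lemma continuous_on_square:
  fixes h :: "complex \<Rightarrow> 'b::topological_space"
  assumes h: "continuous_on (ball 0 4) h" and z: "cmod z < 1" and e: "\<epsilon> \<le> 1"
  shows "continuous_on ({0..\<epsilon>} \<times> {0..\<epsilon>}) (\<lambda>x. h (z + Complex (fst x) (snd x)))"
proof -
  have "continuous_on ({0..\<epsilon>} \<times> {0..\<epsilon>}) (\<lambda>x. z + Complex (fst x) (snd x))"
    unfolding Complex_eq by (intro continuous_intros)
  moreover have "(\<lambda>x. z + Complex (fst x) (snd x)) ` ({0..\<epsilon>} \<times> {0..\<epsilon>}) \<subseteq> ball 0 4"
    using square_in_ball[OF z] e by (auto simp del: mem_ball)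
  ultimately show ?thesis by (rule continuous_on_compose2[OF h])
qed

lemma integrable_on_square:
  fixes h :: "complex \<Rightarrow> real"
  assumes h: "continuous_on (ball 0 4) h" and z: "cmod z < 1" and e: "0 < \<epsilon>" "\<epsilon> \<le> 1"
  shows "t \<in> {0..\<epsilon>} \<Longrightarrow> (\<lambda>s. h (z + Complex s t)) integrable_on {0..\<epsilon>}"
    and "s \<in> {0..\<epsilon>} \<Longrightarrow> (\<lambda>t. h (z + Complex s t)) integrable_on {0..\<epsilon>}"
    and "(\<lambda>t. integral {0..\<epsilon>} (\<lambda>s. h (z + Complex s t))) integrable_on {0..\<epsilon>}"
proof -
  have inB: "z + Complex s t \<in> ball 0 4" if "s \<in> {0..\<epsilon>}" "t \<in> {0..\<epsilon>}" for s t
    using square_in_ball[OF z, of s t] that e by (auto simp del: mem_ball)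
  have c: "continuous_on {0..\<epsilon>} (\<lambda>s. z + Complex s t)" "continuous_on {0..\<epsilon>} (\<lambda>s. z + Complex t s)" for t
    unfolding Complex_eq by (intro continuous_intros)+
  show "(\<lambda>s. h (z + Complex s t)) integrable_on {0..\<epsilon>}" if t: "t \<in> {0..\<epsilon>}"
    by (rule integrable_continuous_interval[OF continuous_on_compose2[OF h c(1)]])
      (use inB[OF _ t] in \<open>auto simp del: mem_ball\<close>)
  show "(\<lambda>t. h (z + Complex s t)) integrable_on {0..\<epsilon>}" if s: "s \<in> {0..\<epsilon>}"
    by (rule integrable_continuous_interval[OF continuous_on_compose2[OF h c(2)]])
      (use inB[OF s] in \<open>auto simp del: mem_ball\<close>)
  have "continuous_on ({0..\<epsilon>} \<times> {0..\<epsilon>}) (prod.swap :: real \<times> real \<Rightarrow> _)" by (intro continuous_intros)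
  moreover have "prod.swap ` ({0..\<epsilon>} \<times> {0..\<epsilon>}) \<subseteq> {0..\<epsilon>} \<times> {0..\<epsilon>}" by auto
  ultimately have "continuous_on ({0..\<epsilon>} \<times> {0..\<epsilon>}) (\<lambda>x. h (z + Complex (fst (prod.swap x)) (snd (prod.swap x))))"
    by (rule continuous_on_compose2[OF continuous_on_square[OF h z e(2)]])
  then have "continuous_on ({0..\<epsilon>} \<times> cbox 0 \<epsilon>) (\<lambda>(t, s). h (z + Complex s t))"
    by (simp add: case_prod_beta')
  from integral_continuous_on_param[OF this]
  show "(\<lambda>t. integral {0..\<epsilon>} (\<lambda>s. h (z + Complex s t))) integrable_on {0..\<epsilon>}"
    by (intro integrable_continuous_interval) simp
qed

text \<open>The left side is the circulation of the vector potential \<open>(\<psi>\<^sub>y, -\<psi>\<^sub>x)\<close> around the square, in the order in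
  which the two paths between opposite corners collect it; its curl is \<open>-\<Delta>\<psi>\<close>.\<close>

lemma green_square:
  assumes \<psi>: "smooth_on (ball 0 4) \<psi>" and z: "cmod z < 1" and e: "0 < \<epsilon>" "\<epsilon> \<le> 1"
  shows "integral {0..\<epsilon>} (\<lambda>s. partial_y \<psi> (z + Complex s 0)) + integral {0..\<epsilon>} (\<lambda>t. - partial_x \<psi> (z + Complex \<epsilon> t))
    - (integral {0..\<epsilon>} (\<lambda>t. - partial_x \<psi> (z + Complex 0 t)) + integral {0..\<epsilon>} (\<lambda>s. partial_y \<psi> (z + Complex s \<epsilon>)))
    = - square_flux (laplacian \<psi>) z \<epsilon>"
proof -
  let ?xx = "partial_x (partial_x \<psi>)" and ?yy = "partial_y (partial_y \<psi>)"
  have sx: "smooth_on (ball 0 4) (partial_x \<psi>)" and sy: "smooth_on (ball 0 4) (partial_y \<psi>)"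
    using \<psi> smooth_on_partial_x smooth_on_partial_y by auto
  have cxx: "continuous_on (ball 0 4) ?xx" and cyy: "continuous_on (ball 0 4) ?yy"
    using sx sy smooth_on_partial_x smooth_on_partial_y smooth_on_continuous by blast+
  note c2 = continuous_on_square[OF _ z e(2)]
  have inB: "z + Complex s t \<in> ball 0 4" if "s \<in> {0..\<epsilon>}" "t \<in> {0..\<epsilon>}" for s t
    using square_in_ball[OF z, of s t] that e by (auto simp del: mem_ball)
  note int = integrable_on_square(1)[OF _ z e] integrable_on_square(2)[OF _ z e]
  have x: "integral {0..\<epsilon>} (\<lambda>s. ?xx (z + Complex s t)) = partial_x \<psi> (z + Complex \<epsilon> t) - partial_x \<psi> (z + Complex 0 t)"
    if t: "t \<in> {0..\<epsilon>}" for t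
  proof (rule integral_unique, rule fundamental_theorem_of_calculus)
    fix s assume s: "s \<in> {0..\<epsilon>}"
    have eq: "z + Complex 0 t + of_real s * 1 = z + Complex s t" for s by (simp add: complex_eq_iff)
    from line_has_vector_derivative[OF sx, of "z + Complex 0 t" s 1] inB[OF s t]
    have "((\<lambda>s. partial_x \<psi> (z + Complex s t)) has_vector_derivative ?xx (z + Complex s t)) (at s)"
      unfolding eq by simp
    then show "((\<lambda>s. partial_x \<psi> (z + Complex s t)) has_vector_derivative ?xx (z + Complex s t)) (at s within {0..\<epsilon>})"
      by (rule has_vector_derivative_at_within)
  qed (use e in simp)
  have y: "integral {0..\<epsilon>} (\<lambda>t. ?yy (z + Complex s t)) = partial_y \<psi> (z + Complex s \<epsilon>) - partial_y \<psi> (z + Complex s 0)"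
    if s: "s \<in> {0..\<epsilon>}" for s
  proof (rule integral_unique, rule fundamental_theorem_of_calculus)
    fix t assume t: "t \<in> {0..\<epsilon>}"
    have eq: "z + Complex s 0 + of_real t * \<i> = z + Complex s t" for t by (simp add: complex_eq_iff)
    from line_has_vector_derivative[OF sy, of "z + Complex s 0" t \<i>] inB[OF s t]
    have "((\<lambda>t. partial_y \<psi> (z + Complex s t)) has_vector_derivative ?yy (z + Complex s t)) (at t)"
      unfolding eq by simp
    then show "((\<lambda>t. partial_y \<psi> (z + Complex s t)) has_vector_derivative ?yy (z + Complex s t)) (at t within {0..\<epsilon>})"
      by (rule has_vector_derivative_at_within)
  qed (use e in simp)
  have e0: "0 \<in> {0..\<epsilon>}" "\<epsilon> \<in> {0..\<epsilon>}" using e by auto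
  note cx = smooth_on_continuous[OF sx] and cy = smooth_on_continuous[OF sy]
  have X: "integral {0..\<epsilon>} (\<lambda>t. - partial_x \<psi> (z + Complex \<epsilon> t)) - integral {0..\<epsilon>} (\<lambda>t. - partial_x \<psi> (z + Complex 0 t))
      = - integral {0..\<epsilon>} (\<lambda>t. integral {0..\<epsilon>} (\<lambda>s. ?xx (z + Complex s t)))"
  proof -
    have "integral {0..\<epsilon>} (\<lambda>t. integral {0..\<epsilon>} (\<lambda>s. ?xx (z + Complex s t)))
        = integral {0..\<epsilon>} (\<lambda>t. partial_x \<psi> (z + Complex \<epsilon> t) - partial_x \<psi> (z + Complex 0 t))"
      by (rule integral_cong) (rule x)
    also have "\<dots> = integral {0..\<epsilon>} (\<lambda>t. partial_x \<psi> (z + Complex \<epsilon> t)) - integral {0..\<epsilon>} (\<lambda>t. partial_x \<psi> (z + Complex 0 t))"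
      by (rule Henstock_Kurzweil_Integration.integral_diff[OF int(2)[OF cx e0(2)] int(2)[OF cx e0(1)]])
    finally show ?thesis by simp
  qed
  have Y: "integral {0..\<epsilon>} (\<lambda>s. partial_y \<psi> (z + Complex s 0)) - integral {0..\<epsilon>} (\<lambda>s. partial_y \<psi> (z + Complex s \<epsilon>))
      = - integral {0..\<epsilon>} (\<lambda>t. integral {0..\<epsilon>} (\<lambda>s. ?yy (z + Complex s t)))"
  proof -
    have "integral {0..\<epsilon>} (\<lambda>t. integral {0..\<epsilon>} (\<lambda>s. ?yy (z + Complex s t)))
        = integral {0..\<epsilon>} (\<lambda>s. integral {0..\<epsilon>} (\<lambda>t. ?yy (z + Complex s t)))"
      using integral_swap_continuous[of 0 0 \<epsilon> \<epsilon> "\<lambda>s t. ?yy (z + Complex s t)"] c2[OF cyy]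
      by (simp add: case_prod_beta' cbox_Pair_eq)
    also have "\<dots> = integral {0..\<epsilon>} (\<lambda>s. partial_y \<psi> (z + Complex s \<epsilon>) - partial_y \<psi> (z + Complex s 0))"
      by (rule integral_cong) (rule y)
    also have "\<dots> = integral {0..\<epsilon>} (\<lambda>s. partial_y \<psi> (z + Complex s \<epsilon>)) - integral {0..\<epsilon>} (\<lambda>s. partial_y \<psi> (z + Complex s 0))"
      by (rule Henstock_Kurzweil_Integration.integral_diff[OF int(1)[OF cy e0(2)] int(1)[OF cy e0(1)]])
    finally show ?thesis by simp
  qed
  note par = integrable_on_square(3)[OF _ z e]
  have "square_flux (laplacian \<psi>) z \<epsilon> = integral {0..\<epsilon>} (\<lambda>t. integral {0..\<epsilon>} (\<lambda>s. ?xx (z + Complex s t)) + integral {0..\<epsilon>} (\<lambda>s. ?yy (z + Complex s t)))"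
    unfolding square_flux_def laplacian_def
  proof (rule integral_cong)
    fix t assume t: "t \<in> {0..\<epsilon>}"
    show "integral {0..\<epsilon>} (\<lambda>s. ?xx (z + Complex s t) + ?yy (z + Complex s t))
      = integral {0..\<epsilon>} (\<lambda>s. ?xx (z + Complex s t)) + integral {0..\<epsilon>} (\<lambda>s. ?yy (z + Complex s t))"
      by (rule Henstock_Kurzweil_Integration.integral_add[OF int(1)[OF cxx t] int(1)[OF cyy t]])
  qed
  also have "\<dots> = integral {0..\<epsilon>} (\<lambda>t. integral {0..\<epsilon>} (\<lambda>s. ?xx (z + Complex s t))) + integral {0..\<epsilon>} (\<lambda>t. integral {0..\<epsilon>} (\<lambda>s. ?yy (z + Complex s t)))"
    by (rule Henstock_Kurzweil_Integration.integral_add[OF par[OF cxx] par[OF cyy]])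
  finally show ?thesis using X Y by linarith
qed

section \<open>Two a priori estimates for the magnetic gradient\<close>

text \<open>This is where the Aharonov--Bohm effect enters. If the flux through the square is close to an odd multiple of
  \<open>\<pi>\<close>, then \<open>u\<close> cannot be nearly parallel along the whole boundary, and \<open>|u|\<close> at the corner is controlled by
  the covariant derivative on the sides. The factor \<open>2 \<epsilon>\<close> comes from squaring a sum of four terms and from
  Cauchy--Schwarz on sides of length \<open>\<epsilon>\<close>.\<close>

lemma square_transport:
  assumes \<psi>: "smooth_on (ball 0 4) \<psi>" and v: "smooth_on UNIV v"
    and z: "cmod z < 1" and e: "0 < \<epsilon>" "\<epsilon> \<le> 1"
    and p: "continuous_on UNIV p" "\<And>w. w \<in> ball 0 4 \<Longrightarrow> p w = partial_x v w + \<i> * of_real (partial_y \<psi> w) * v w"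
    and q: "continuous_on UNIV q" "\<And>w. w \<in> ball 0 4 \<Longrightarrow> q w = partial_y v w - \<i> * of_real (partial_x \<psi> w) * v w"
    and flux: "cos (square_flux (laplacian \<psi>) z \<epsilon>) \<le> 0"
  shows "(cmod (v z))\<^sup>2 \<le> 2 * \<epsilon> * (
      integral {0..\<epsilon>} (\<lambda>s. (cmod (p (z + 0 + of_real s * 1)))\<^sup>2) +
      integral {0..\<epsilon>} (\<lambda>s. (cmod (p (z + Complex 0 \<epsilon> + of_real s * 1)))\<^sup>2) +
      integral {0..\<epsilon>} (\<lambda>s. (cmod (q (z + 0 + of_real s * \<i>)))\<^sup>2) +
      integral {0..\<epsilon>} (\<lambda>s. (cmod (q (z + Complex \<epsilon> 0 + of_real s * \<i>)))\<^sup>2))"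
proof -
  have inB: "z + Complex s t \<in> ball 0 4" if "s \<in> {0..\<epsilon>}" "t \<in> {0..\<epsilon>}" for s t
    using square_in_ball[OF z, of s t] that e by (auto simp del: mem_ball)
  have cx: "continuous_on (ball 0 4) (\<lambda>w. - partial_x \<psi> w)"
    by (intro continuous_on_minus smooth_on_continuous[OF smooth_on_partial_x[OF \<psi>]])
  have cy: "continuous_on (ball 0 4) (partial_y \<psi>)"
    by (rule smooth_on_continuous[OF smooth_on_partial_y[OF \<psi>]])
  have side: "cmod (v (z + Complex s0 t0 + of_real \<epsilon> * e) * cis (integral {0..\<epsilon>} (\<lambda>s. A (z + Complex s0 t0 + of_real s * e)))
        - v (z + Complex s0 t0)) \<le> integral {0..\<epsilon>} (\<lambda>s. cmod (D (z + Complex s0 t0 + of_real s * e)))"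
    if A: "continuous_on (ball 0 4) A" and D: "continuous_on UNIV D"
      and st: "\<And>s. s \<in> {0..\<epsilon>} \<Longrightarrow> z + Complex s0 t0 + of_real s * e \<in> ball 0 4"
      and DA: "\<And>w. w \<in> ball 0 4 \<Longrightarrow> D w - \<i> * of_real (A w) * v w = Re e *\<^sub>R partial_x v w + Im e *\<^sub>R partial_y v w"
    for A :: "complex \<Rightarrow> real" and D :: "complex \<Rightarrow> complex" and s0 t0 and e :: complex
  proof -
    have c: "continuous_on {0..\<epsilon>} (\<lambda>s. z + Complex s0 t0 + of_real s * e)"
      by (intro continuous_intros)
    have "cmod (v (z + Complex s0 t0 + of_real \<epsilon> * e) * cis (integral {0..\<epsilon>} (\<lambda>s. A (z + Complex s0 t0 + of_real s * e)))
        - v (z + Complex s0 t0 + of_real 0 * e)) \<le> integral {0..\<epsilon>} (\<lambda>s. cmod (D (z + Complex s0 t0 + of_real s * e)))"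
    proof (rule parallel_transport)
      show "continuous_on {0..\<epsilon>} (\<lambda>s. A (z + Complex s0 t0 + of_real s * e))"
        by (rule continuous_on_compose2[OF A c]) (use st in \<open>auto simp del: mem_ball\<close>)
      show "continuous_on {0..\<epsilon>} (\<lambda>s. D (z + Complex s0 t0 + of_real s * e))"
        by (rule continuous_on_compose2[OF D c]) simp
      fix s assume s: "s \<in> {0..\<epsilon>}"
      show "((\<lambda>s. v (z + Complex s0 t0 + of_real s * e)) has_vector_derivative
          D (z + Complex s0 t0 + of_real s * e) - \<i> * of_real (A (z + Complex s0 t0 + of_real s * e)) * v (z + Complex s0 t0 + of_real s * e)) (at s)"
        unfolding DA[OF st[OF s]] by (rule line_has_vector_derivative[OF v]) simp
    qed (use e in simp)
    then show ?thesis by simp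
  qed
  have e0: "0 \<in> {0..\<epsilon>}" "\<epsilon> \<in> {0..\<epsilon>}" using e by auto
  have cpl: "z + Complex s0 t0 + of_real s * 1 = z + Complex (s0 + s) t0"
    "z + Complex s0 t0 + of_real s * \<i> = z + Complex s0 (t0 + s)" for s0 t0 s
    by (simp_all add: complex_eq_iff)
  have px: "p w - \<i> * of_real (partial_y \<psi> w) * v w = Re 1 *\<^sub>R partial_x v w + Im 1 *\<^sub>R partial_y v w"
    and qy: "q w - \<i> * of_real (- partial_x \<psi> w) * v w = Re \<i> *\<^sub>R partial_x v w + Im \<i> *\<^sub>R partial_y v w"
    if "w \<in> ball 0 4" for w
    using p(2)[OF that] q(2)[OF that] by simp_all
  define P where "P s0 t0 = integral {0..\<epsilon>} (\<lambda>s. cmod (p (z + Complex s0 t0 + of_real s * 1)))" for s0 t0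
  define Q where "Q s0 t0 = integral {0..\<epsilon>} (\<lambda>s. cmod (q (z + Complex s0 t0 + of_real s * \<i>)))" for s0 t0
  have bottom: "cmod (v (z + Complex \<epsilon> 0) * cis (integral {0..\<epsilon>} (\<lambda>s. partial_y \<psi> (z + Complex s 0))) - v (z + Complex 0 0)) \<le> P 0 0"
    using side[OF cy p(1) _ px, of 0 0] inB[OF _ e0(1)] unfolding cpl P_def by simp
  have top: "cmod (v (z + Complex \<epsilon> \<epsilon>) * cis (integral {0..\<epsilon>} (\<lambda>s. partial_y \<psi> (z + Complex s \<epsilon>))) - v (z + Complex 0 \<epsilon>)) \<le> P 0 \<epsilon>"
    using side[OF cy p(1) _ px, of 0 \<epsilon>] inB[OF _ e0(2)] unfolding cpl P_def by simp
  have left: "cmod (v (z + Complex 0 \<epsilon>) * cis (integral {0..\<epsilon>} (\<lambda>t. - partial_x \<psi> (z + Complex 0 t))) - v (z + Complex 0 0)) \<le> Q 0 0"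
    using side[OF cx q(1) _ qy, of 0 0] inB[OF e0(1)] unfolding cpl Q_def by simp
  have right: "cmod (v (z + Complex \<epsilon> \<epsilon>) * cis (integral {0..\<epsilon>} (\<lambda>t. - partial_x \<psi> (z + Complex \<epsilon> t))) - v (z + Complex \<epsilon> 0)) \<le> Q \<epsilon> 0"
    using side[OF cx q(1) _ qy, of \<epsilon> 0] inB[OF e0(2)] unfolding cpl Q_def by simp
  have "2 * (cmod (v (z + Complex 0 0)))\<^sup>2 \<le> (P 0 0 + Q \<epsilon> 0 + Q 0 0 + P 0 \<epsilon>)\<^sup>2"
    by (rule transport_two_paths[OF bottom right left top])
      (use green_square[OF \<psi> z e] flux in simp)
  moreover have "(a + b + c + d)\<^sup>2 \<le> 4 * (a\<^sup>2 + b\<^sup>2 + c\<^sup>2 + d\<^sup>2)" for a b c d :: real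
  proof -
    have "0 \<le> (a - b)\<^sup>2 + (a - c)\<^sup>2 + (a - d)\<^sup>2 + (b - c)\<^sup>2 + (b - d)\<^sup>2 + (c - d)\<^sup>2" by simp
    then show ?thesis by (simp add: power2_eq_square algebra_simps)
  qed
  note this[of "P 0 0" "Q \<epsilon> 0" "Q 0 0" "P 0 \<epsilon>"]
  moreover have sq: "(integral {0..\<epsilon>} (\<lambda>s. cmod (D (w + of_real s * e))))\<^sup>2 \<le> \<epsilon> * integral {0..\<epsilon>} (\<lambda>s. (cmod (D (w + of_real s * e)))\<^sup>2)"
    if D: "continuous_on UNIV D" for D :: "complex \<Rightarrow> complex" and w e
  proof (rule integral_square_le[OF _ e(1)])
    have c: "continuous_on {0..\<epsilon>} (\<lambda>s. w + of_real s * e)"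
      by (intro continuous_intros)
    show "continuous_on {0..\<epsilon>} (\<lambda>s. cmod (D (w + of_real s * e)))"
      by (rule continuous_on_norm[OF continuous_on_compose2[OF D c]]) simp
  qed
  have "(P s0 t0)\<^sup>2 \<le> \<epsilon> * integral {0..\<epsilon>} (\<lambda>s. (cmod (p (z + Complex s0 t0 + of_real s * 1)))\<^sup>2)"
    "(Q s0 t0)\<^sup>2 \<le> \<epsilon> * integral {0..\<epsilon>} (\<lambda>s. (cmod (q (z + Complex s0 t0 + of_real s * \<i>)))\<^sup>2)" for s0 t0
    unfolding P_def Q_def by (rule sq[OF p(1)], rule sq[OF q(1)])
  note this(1)[of 0 0] this(1)[of 0 \<epsilon>] this(2)[of 0 0] this(2)[of \<epsilon> 0]
  moreover have "Complex 0 0 = 0" by (simp add: complex_eq_iff)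
  ultimately show ?thesis by (simp add: algebra_simps)
qed

lemma measurable_Complex_pair[measurable (raw)]:
  assumes "f \<in> borel_measurable M" "g \<in> borel_measurable M"
  shows "(\<lambda>x. Complex (f x) (g x)) \<in> borel_measurable M"
  unfolding Complex_eq using assms by measurable

text \<open>The value \<open>|v|\<^sup>2\<close> at a point is bounded by the energy on the horizontal line and by the energy on
  the vertical line through the point. The product of the two bounds is a function of \<open>y\<close> times a function of
  \<open>x\<close>, so its area integral factorises.\<close>

lemma ladyzhenskaya:
  fixes v p q :: "complex \<Rightarrow> complex" and a1 a2 :: "complex \<Rightarrow> real"
  assumes v: "smooth_on UNIV v" and v0: "\<And>z. z \<notin> ball 0 1 \<Longrightarrow> v z = 0"
    and p: "continuous_on UNIV p" "\<And>w. p w = partial_x v w + \<i> * of_real (a1 w) * v w"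
    and q: "continuous_on UNIV q" "\<And>w. q w = partial_y v w + \<i> * of_real (a2 w) * v w"
  shows "(\<integral>\<^sup>+z. ennreal ((cmod (v z))^4) \<partial>lborel)
    \<le> (\<integral>\<^sup>+z. ennreal ((cmod (v z))\<^sup>2 + (cmod (p z))\<^sup>2 + (cmod (q z))\<^sup>2) \<partial>lborel)\<^sup>2"
proof -
  define e where "e z = (cmod (v z))\<^sup>2 + (cmod (p z))\<^sup>2 + (cmod (q z))\<^sup>2" for z
  have [measurable]: "v \<in> borel_measurable borel" "p \<in> borel_measurable borel" "q \<in> borel_measurable borel"
    using smooth_on_continuous[OF v] p(1) q(1) by (auto intro: borel_measurable_continuous_onI)
  have [measurable]: "e \<in> borel_measurable borel" unfolding e_def[abs_def] by measurable
  define F where "F y = (\<integral>\<^sup>+s. ennreal (e (Complex s y)) \<partial>lborel)" for y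
  define G where "G x = (\<integral>\<^sup>+t. ennreal (e (Complex x t)) \<partial>lborel)" for x
  have [measurable]: "F \<in> borel_measurable borel" "G \<in> borel_measurable borel"
    unfolding F_def[abs_def] G_def[abs_def] by measurable
  have out: "v (Complex x y) = 0" if "x \<le> -1 \<or> y \<le> -1" for x y
  proof (rule v0)
    have "1 \<le> cmod (Complex x y)"
      using that abs_Re_le_cmod[of "Complex x y"] abs_Im_le_cmod[of "Complex x y"] by auto
    then show "Complex x y \<notin> ball 0 1" by simp
  qed
  have cl: "continuous_on UNIV (\<lambda>s. D (w + of_real s * e))" if "continuous_on UNIV D" for D :: "complex \<Rightarrow> complex" and w e
  proof -
    have c: "continuous_on UNIV (\<lambda>s. w + of_real s * e)" by (intro continuous_intros)
    show ?thesis by (rule continuous_on_compose2[OF that c]) simp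
  qed
  have cpl: "Complex 0 y + of_real s * 1 = Complex s y" "Complex y 0 + of_real s * \<i> = Complex y s" for s y
    by (simp_all add: complex_eq_iff)
  have H: "ennreal ((cmod (v (Complex x y)))\<^sup>2) \<le> F y" for x y
  proof -
    have "ennreal ((cmod (v (Complex x y)))\<^sup>2) \<le> (\<integral>\<^sup>+s. ennreal ((cmod (v (Complex s y)))\<^sup>2 + (cmod (p (Complex s y)))\<^sup>2) \<partial>lborel)"
    proof (rule square_modulus_le_line_energy[where a = "\<lambda>s. a1 (Complex s y)" and c = "-1"])
      show "continuous_on UNIV (\<lambda>s. p (Complex s y))"
        using cl[OF p(1), of "Complex 0 y" 1] unfolding cpl .
      show "((\<lambda>s. v (Complex s y)) has_vector_derivative p (Complex s y) - \<i> * of_real (a1 (Complex s y)) * v (Complex s y)) (at s)" for s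
        using line_has_vector_derivative[OF v, of "Complex 0 y" s 1] unfolding cpl p(2) by simp
    qed (use out in auto)
    also have "\<dots> \<le> F y"
      unfolding F_def e_def by (intro nn_integral_mono ennreal_leI) simp
    finally show ?thesis .
  qed
  have V: "ennreal ((cmod (v (Complex x y)))\<^sup>2) \<le> G x" for x y
  proof -
    have "ennreal ((cmod (v (Complex x y)))\<^sup>2) \<le> (\<integral>\<^sup>+t. ennreal ((cmod (v (Complex x t)))\<^sup>2 + (cmod (q (Complex x t)))\<^sup>2) \<partial>lborel)"
    proof (rule square_modulus_le_line_energy[where a = "\<lambda>t. a2 (Complex x t)" and c = "-1"])
      show "continuous_on UNIV (\<lambda>t. q (Complex x t))"
        using cl[OF q(1), of "Complex x 0" \<i>] unfolding cpl .
      show "((\<lambda>t. v (Complex x t)) has_vector_derivative q (Complex x t) - \<i> * of_real (a2 (Complex x t)) * v (Complex x t)) (at t)" for t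
        using line_has_vector_derivative[OF v, of "Complex x 0" t \<i>] unfolding cpl q(2) by simp
    qed (use out in auto)
    also have "\<dots> \<le> G x"
      unfolding G_def e_def by (intro nn_integral_mono ennreal_leI) simp
    finally show ?thesis .
  qed
  have "(\<integral>\<^sup>+z. ennreal ((cmod (v z))^4) \<partial>lborel) = (\<integral>\<^sup>+x. \<integral>\<^sup>+y. ennreal ((cmod (v (Complex x y)))^4) \<partial>lborel \<partial>lborel)"
    by (rule nn_integral_complex(1)) measurable
  also have "\<dots> \<le> (\<integral>\<^sup>+x. \<integral>\<^sup>+y. G x * F y \<partial>lborel \<partial>lborel)"
  proof (intro nn_integral_mono)
    fix x y
    have "ennreal ((cmod (v (Complex x y)))^4) = ennreal ((cmod (v (Complex x y)))\<^sup>2) * ennreal ((cmod (v (Complex x y)))\<^sup>2)"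
      by (simp add: ennreal_mult[symmetric] flip: power_add)
    also have "\<dots> \<le> G x * F y" by (rule mult_mono[OF V H]) auto
    finally show "ennreal ((cmod (v (Complex x y)))^4) \<le> G x * F y" .
  qed
  also have "\<dots> = (\<integral>\<^sup>+x. G x \<partial>lborel) * (\<integral>\<^sup>+y. F y \<partial>lborel)"
    by (simp add: nn_integral_cmult nn_integral_multc)
  also have "\<dots> = (\<integral>\<^sup>+z. ennreal (e z) \<partial>lborel)\<^sup>2"
    using nn_integral_complex[of "\<lambda>z. ennreal (e z)"] unfolding G_def F_def by (simp add: power2_eq_square)
  finally show ?thesis unfolding e_def .
qed

section \<open>A lower bound for the magnetic ground state energy\<close>

text \<open>If the energy of a normalised \<open>u\<close> were below \<open>k\<close>, then each of the three sets would carry at most a quarter of its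
  mass. On \<open>G\<close> this is parallel transport around squares of side \<open>\<epsilon>\<close>, averaged over their position; on \<open>H\<close> the
  electric term alone is large enough; and \<open>R\<close> is too small to carry mass, since the \<open>L\<^sup>4\<close> norm of \<open>u\<close>
  is bounded in terms of the energy.\<close>

lemma lambda_m_ge:
  fixes k \<epsilon> :: real
  assumes \<psi>: "smooth_on (ball 0 4) \<psi>" and lap: "\<And>z. z \<in> ball 0 1 \<Longrightarrow> 0 \<le> laplacian \<psi> z"
    and k: "0 \<le> k" and e: "0 < \<epsilon>" "\<epsilon> \<le> 1" "16 * \<epsilon>\<^sup>2 * k \<le> 1"
    and [measurable]: "G \<in> sets borel" "H \<in> sets borel" "R \<in> sets borel"
    and cover: "ball 0 1 \<subseteq> G \<union> H \<union> R"
    and flux: "\<And>z. z \<in> G \<inter> ball 0 1 \<Longrightarrow> cos (square_flux (laplacian \<psi>) z \<epsilon>) \<le> 0"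
    and big: "\<And>z. z \<in> H \<inter> ball 0 1 \<Longrightarrow> 4 * k + 1 \<le> laplacian \<psi> z"
    and small: "emeasure lborel R \<le> ennreal (1 / (16 * (1 + k)\<^sup>2))"
  shows "ereal k \<le> lambda_m (ball 0 1) \<psi>"
  unfolding lambda_m_def
proof (rule INF_greatest, rule ccontr)
  let ?S = "ball (0::complex) 1" and ?T = "ball (0::complex) 4"
  fix u assume "u \<in> {u \<in> test_functions ?S. L2_norm_on ?S u = 1}"
  then have u: "u \<in> test_functions ?S" and nu: "L2_norm_on ?S u = 1" by auto
  define E1 where "E1 = (LINT z:?S|lborel. (norm (magnetic_gradient \<psi> u z))\<^sup>2)"
  define E2 where "E2 = (LINT z:?S|lborel. laplacian \<psi> z * (cmod (u z))\<^sup>2)"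
  assume "\<not> ereal k \<le> ereal (E1 + E2)"
  then have Ek: "E1 + E2 < k" by simp
  have ST: "?S \<subseteq> ?T" by auto
  obtain v K where v: "smooth_on UNIV v" and K: "compact K" "K \<subseteq> ?S"
    and vu: "\<And>z. z \<in> ?S \<Longrightarrow> v z = u z" and v0: "\<And>z. z \<notin> K \<Longrightarrow> v z = 0"
    using test_function_extension[OF open_ball u] by blast
  have oK: "open (- K)" using K by (simp add: compact_imp_closed open_Compl)
  \<comment> \<open>The covariant derivatives vanish off \<open>K\<close>, so they are continuous on the whole plane although \<open>\<psi>\<close> is only
    smooth on a disk.\<close>
  define p where "p z = partial_x v z + \<i> * of_real (partial_y \<psi> z) * v z" for z
  define q where "q z = partial_y v z - \<i> * of_real (partial_x \<psi> z) * v z" for z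
  have p0: "p z = 0" and q0: "q z = 0" if "z \<notin> K" for z
    using partial_xy_eq_0[OF K(1) v0 that] v0[OF that] by (simp_all add: p_def q_def)
  have pq: "magnetic_gradient \<psi> u z = (p z, q z)" if "z \<in> ?S" for z
    using partial_xy_cong[OF open_ball that vu, of ] smooth_on_subset[OF v subset_UNIV] vu[OF that]
    by (simp add: magnetic_gradient_def p_def q_def)
  have glue: "continuous_on UNIV w" if "continuous_on ?T w" "\<And>z. z \<notin> K \<Longrightarrow> w z = 0" for w :: "complex \<Rightarrow> complex"
  proof -
    have "continuous_on (- K) w"
      using continuous_on_cong[of "- K" "- K" w "\<lambda>_. 0"] that(2) by simp
    from continuous_on_open_Un[OF open_ball oK that(1) this]
    have "continuous_on (?T \<union> - K) w" .
    moreover have "?T \<union> - K = UNIV" using K(2) ST by blast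
    ultimately show ?thesis by simp
  qed
  have cv: "continuous_on A v" for A
    using smooth_continuous_on[OF v] .
  have c\<psi>: "continuous_on ?T (partial_x \<psi>)" "continuous_on ?T (partial_y \<psi>)"
    by (rule smooth_on_continuous[OF smooth_on_partial_x[OF \<psi>]], rule smooth_on_continuous[OF smooth_on_partial_y[OF \<psi>]])
  have cvx: "continuous_on A (partial_x v)" "continuous_on A (partial_y v)" for A
    using smooth_continuous_on[OF smooth_on_partial_x[OF v]]
      smooth_continuous_on[OF smooth_on_partial_y[OF v]] by auto
  have cp: "continuous_on UNIV p"
    by (rule glue[OF _ p0]) (unfold p_def, intro continuous_on_add continuous_on_mult continuous_on_of_real continuous_on_const cvx c\<psi> cv)
  have cq: "continuous_on UNIV q"
    by (rule glue[OF _ q0]) (unfold q_def, intro continuous_on_diff continuous_on_mult continuous_on_of_real continuous_on_const cvx c\<psi> cv)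
  have [measurable]: "v \<in> borel_measurable borel" "p \<in> borel_measurable borel" "q \<in> borel_measurable borel"
    using cv cp cq by (auto intro: borel_measurable_continuous_onI)
  have extend: "(\<integral>\<^sup>+z\<in>?S. ennreal (g z) \<partial>lborel) = (\<integral>\<^sup>+z. ennreal (h z) \<partial>lborel)"
    if "\<And>z. z \<in> ?S \<Longrightarrow> g z = h z" "\<And>z. z \<notin> K \<Longrightarrow> h z = 0" for g h :: "complex \<Rightarrow> real"
  proof (rule nn_integral_cong)
    fix z
    have "h z = 0" if "z \<notin> ?S" using that \<open>\<And>z. z \<notin> K \<Longrightarrow> h z = 0\<close> K(2) by blast
    then show "ennreal (g z) * indicator ?S z = ennreal (h z)"
      using that(1)[of z] by (simp split: split_indicator)
  qed
  have u0: "u z = 0" if "z \<in> ?S - K" for z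
    using that vu[of z] v0[of z] by simp

  have N: "(\<integral>\<^sup>+z. ennreal ((cmod (v z))\<^sup>2) \<partial>lborel) = 1"
  proof -
    have "continuous_on ?S (\<lambda>z. (cmod (u z))\<^sup>2)"
      by (rule continuous_on_cong[THEN iffD1, OF refl _ continuous_on_power[OF continuous_on_norm[OF cv]]]) (simp add: vu)
    moreover have "(cmod (u z))\<^sup>2 = 0" if "z \<in> ?S - K" for z
      using that vu[of z] v0[of z] by simp
    ultimately have "ennreal (LINT z:?S|lborel. (cmod (u z))\<^sup>2) = (\<integral>\<^sup>+z\<in>?S. ennreal ((cmod (u z))\<^sup>2) \<partial>lborel)"
      by (intro set_lebesgue_integral_compact_support(2)[OF open_ball K]) auto
    also have "\<dots> = (\<integral>\<^sup>+z. ennreal ((cmod (v z))\<^sup>2) \<partial>lborel)"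
      by (rule extend) (simp_all add: vu v0)
    finally show ?thesis using nu by (simp add: L2_norm_on_def)
  qed
  have E1: "(\<integral>\<^sup>+z. ennreal ((cmod (p z))\<^sup>2 + (cmod (q z))\<^sup>2) \<partial>lborel) = ennreal E1"
  proof -
    have eq: "(norm (magnetic_gradient \<psi> u z))\<^sup>2 = (cmod (p z))\<^sup>2 + (cmod (q z))\<^sup>2" if "z \<in> ?S" for z
      by (simp add: pq[OF that] norm_Pair)
    have "continuous_on ?S (\<lambda>z. (cmod (p z))\<^sup>2 + (cmod (q z))\<^sup>2)"
      by (intro continuous_on_add continuous_on_power continuous_on_norm continuous_on_subset[OF cp subset_UNIV] continuous_on_subset[OF cq subset_UNIV])
    then have "continuous_on ?S (\<lambda>z. (norm (magnetic_gradient \<psi> u z))\<^sup>2)"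
      using eq by (simp cong: continuous_on_cong_simp)
    then have "ennreal E1 = (\<integral>\<^sup>+z\<in>?S. ennreal ((norm (magnetic_gradient \<psi> u z))\<^sup>2) \<partial>lborel)"
      unfolding E1_def by (intro set_lebesgue_integral_compact_support(2)[OF open_ball K]) (simp_all add: eq p0 q0)
    also have "\<dots> = (\<integral>\<^sup>+z. ennreal ((cmod (p z))\<^sup>2 + (cmod (q z))\<^sup>2) \<partial>lborel)"
      by (rule extend) (simp_all add: eq p0 q0)
    finally show ?thesis ..
  qed
  have c\<Delta>: "continuous_on ?S (\<lambda>z. laplacian \<psi> z * (cmod (v z))\<^sup>2)"
    by (intro continuous_on_mult continuous_on_power continuous_on_norm cv
        continuous_on_subset[OF smooth_on_continuous[OF smooth_on_laplacian[OF open_ball \<psi>]] ST])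
  have E2: "(\<integral>\<^sup>+z\<in>?S. ennreal (laplacian \<psi> z * (cmod (v z))\<^sup>2) \<partial>lborel) = ennreal E2"
  proof -
    from c\<Delta> have "continuous_on ?S (\<lambda>z. laplacian \<psi> z * (cmod (u z))\<^sup>2)"
      using vu by (simp cong: continuous_on_cong_simp)
    then have "ennreal E2 = (\<integral>\<^sup>+z\<in>?S. ennreal (laplacian \<psi> z * (cmod (u z))\<^sup>2) \<partial>lborel)"
      unfolding E2_def by (intro set_lebesgue_integral_compact_support(2)[OF open_ball K])
        (use lap u0 in \<open>auto simp del: mem_ball\<close>)
    also have "\<dots> = (\<integral>\<^sup>+z\<in>?S. ennreal (laplacian \<psi> z * (cmod (v z))\<^sup>2) \<partial>lborel)"
      using vu by (intro nn_integral_cong) (auto split: split_indicator simp del: mem_ball)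
    finally show ?thesis ..
  qed
  have E1_nonneg: "0 \<le> E1" and E2_nonneg: "0 \<le> E2"
    unfolding E1_def E2_def set_lebesgue_integral_def using lap
    by (auto intro!: integral_nonneg_AE simp: indicator_def simp del: mem_ball)

  have G: "(\<integral>\<^sup>+z\<in>G. ennreal ((cmod (v z))\<^sup>2) \<partial>lborel) \<le> ennreal (1 / 4)"
  proof -
    define L where "L w c d z = ennreal (integral {0..\<epsilon>} (\<lambda>s. (cmod (w (z + c + of_real s * d)))\<^sup>2))" for w :: "complex \<Rightarrow> complex" and c d z
    have L: "L w c d \<in> borel_measurable borel" "(\<integral>\<^sup>+z. L w c d z \<partial>lborel) = ennreal \<epsilon> * (\<integral>\<^sup>+z. ennreal ((cmod (w z))\<^sup>2) \<partial>lborel)"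
      if "continuous_on UNIV w" for w c d
      unfolding L_def
      by (rule borel_measurable_line_integral nn_integral_sweep; use that e in \<open>simp add: continuous_on_power continuous_on_norm\<close>)+
    note [measurable] = L(1)[OF cp] L(1)[OF cq]
    have "(\<integral>\<^sup>+z\<in>G. ennreal ((cmod (v z))\<^sup>2) \<partial>lborel)
      \<le> (\<integral>\<^sup>+z. ennreal (2 * \<epsilon>) * (L p 0 1 z + L p (Complex 0 \<epsilon>) 1 z + L q 0 \<i> z + L q (Complex \<epsilon> 0) \<i> z) \<partial>lborel)"
      (is "(\<integral>\<^sup>+z. ?l z \<partial>lborel) \<le> (\<integral>\<^sup>+z. ?r z \<partial>lborel)")
    proof (rule nn_integral_mono)
      fix z :: complex
      show "?l z \<le> ?r z"
      proof (cases "z \<in> G \<inter> ?S")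
        case True
        then have z: "cmod z < 1" by simp
        have i: "0 \<le> integral {0..\<epsilon>} (\<lambda>s. (cmod (w (z + c + of_real s * d)))\<^sup>2)" if w: "continuous_on UNIV w" for w :: "complex \<Rightarrow> complex" and c d
        proof (rule integral_nonneg_continuous)
          have c: "continuous_on {0..\<epsilon>} (\<lambda>s. z + c + of_real s * d)" by (intro continuous_intros)
          show "continuous_on {0..\<epsilon>} (\<lambda>s. (cmod (w (z + c + of_real s * d)))\<^sup>2)"
            by (rule continuous_on_power[OF continuous_on_norm[OF continuous_on_compose2[OF w c]]]) simp
        qed simp
        have "ennreal ((cmod (v z))\<^sup>2) \<le> ennreal (2 * \<epsilon> * (
            integral {0..\<epsilon>} (\<lambda>s. (cmod (p (z + 0 + of_real s * 1)))\<^sup>2) +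
            integral {0..\<epsilon>} (\<lambda>s. (cmod (p (z + Complex 0 \<epsilon> + of_real s * 1)))\<^sup>2) +
            integral {0..\<epsilon>} (\<lambda>s. (cmod (q (z + 0 + of_real s * \<i>)))\<^sup>2) +
            integral {0..\<epsilon>} (\<lambda>s. (cmod (q (z + Complex \<epsilon> 0 + of_real s * \<i>)))\<^sup>2)))"
          by (rule ennreal_leI, rule square_transport[OF \<psi> v z e(1,2) cp p_def cq q_def flux[OF True]])
        also have "\<dots> = ?r z"
          unfolding L_def using e i[OF cp] i[OF cq]
          by (subst ennreal_mult) (auto simp del: add_0_right mult_1_right intro!: add_nonneg_nonneg)
        finally show ?thesis using True by simp
      next
        case False
        then have "z \<notin> G \<or> z \<notin> K" using K(2) by blast
        then show ?thesis using v0[of z] by (auto split: split_indicator)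
      qed
    qed
    also have "\<dots> = ennreal (2 * \<epsilon>) * (ennreal \<epsilon> * (\<integral>\<^sup>+z. ennreal ((cmod (p z))\<^sup>2) \<partial>lborel) + ennreal \<epsilon> * (\<integral>\<^sup>+z. ennreal ((cmod (p z))\<^sup>2) \<partial>lborel)
        + ennreal \<epsilon> * (\<integral>\<^sup>+z. ennreal ((cmod (q z))\<^sup>2) \<partial>lborel) + ennreal \<epsilon> * (\<integral>\<^sup>+z. ennreal ((cmod (q z))\<^sup>2) \<partial>lborel))"
      by (simp add: nn_integral_cmult nn_integral_add L(2)[OF cp] L(2)[OF cq])
    also have "\<dots> = ennreal (2 * \<epsilon>) * (ennreal (2 * \<epsilon>) * ((\<integral>\<^sup>+z. ennreal ((cmod (p z))\<^sup>2) \<partial>lborel) + (\<integral>\<^sup>+z. ennreal ((cmod (q z))\<^sup>2) \<partial>lborel)))"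
    proof -
      have "ennreal (2 * \<epsilon>) = ennreal \<epsilon> + ennreal \<epsilon>" using e by (simp flip: ennreal_plus)
      then show ?thesis by (simp add: distrib_left distrib_right ac_simps)
    qed
    also have "(\<integral>\<^sup>+z. ennreal ((cmod (p z))\<^sup>2) \<partial>lborel) + (\<integral>\<^sup>+z. ennreal ((cmod (q z))\<^sup>2) \<partial>lborel) = ennreal E1"
      by (simp add: nn_integral_add flip: E1)
    also have "ennreal (2 * \<epsilon>) * (ennreal (2 * \<epsilon>) * ennreal E1) = ennreal (4 * \<epsilon>\<^sup>2 * E1)"
      using e E1_nonneg by (simp add: power2_eq_square flip: ennreal_mult)
    also have "\<dots> \<le> ennreal (1 / 4)"
    proof (rule ennreal_leI)
      have "4 * \<epsilon>\<^sup>2 * E1 \<le> 4 * \<epsilon>\<^sup>2 * k"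
        using Ek E2_nonneg by (intro mult_left_mono) auto
      then show "4 * \<epsilon>\<^sup>2 * E1 \<le> 1 / 4" using e(3) by linarith
    qed
    finally show ?thesis .
  qed

  have H: "(\<integral>\<^sup>+z\<in>H. ennreal ((cmod (v z))\<^sup>2) \<partial>lborel) \<le> ennreal (1 / 4)"
  proof -
    from c\<Delta> have "(\<lambda>z. indicator ?S z *\<^sub>R (laplacian \<psi> z * (cmod (v z))\<^sup>2)) \<in> borel_measurable borel"
      by (intro borel_measurable_continuous_on_indicator) auto
    then have "(\<lambda>z. ennreal (indicator ?S z *\<^sub>R (laplacian \<psi> z * (cmod (v z))\<^sup>2))) \<in> borel_measurable borel"
      by measurable
    moreover have "(\<lambda>z. ennreal (indicator ?S z *\<^sub>R (laplacian \<psi> z * (cmod (v z))\<^sup>2)))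
        = (\<lambda>z. ennreal (laplacian \<psi> z * (cmod (v z))\<^sup>2) * indicator ?S z)"
      by (auto split: split_indicator)
    ultimately have [measurable]: "(\<lambda>z. ennreal (laplacian \<psi> z * (cmod (v z))\<^sup>2) * indicator ?S z) \<in> borel_measurable borel"
      by simp
    have "(\<integral>\<^sup>+z\<in>H. ennreal ((cmod (v z))\<^sup>2) \<partial>lborel)
      \<le> (\<integral>\<^sup>+z. ennreal (1 / (4 * k + 1)) * (ennreal (laplacian \<psi> z * (cmod (v z))\<^sup>2) * indicator ?S z) \<partial>lborel)"
      (is "(\<integral>\<^sup>+z. ?l z \<partial>lborel) \<le> (\<integral>\<^sup>+z. ?r z \<partial>lborel)")
    proof (rule nn_integral_mono)
      fix z :: complex
      show "?l z \<le> ?r z"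
      proof (cases "z \<in> H \<inter> ?S")
        case True
        have "(4 * k + 1) * (cmod (v z))\<^sup>2 \<le> laplacian \<psi> z * (cmod (v z))\<^sup>2"
          by (rule mult_right_mono[OF big[OF True]]) simp
        then have "(cmod (v z))\<^sup>2 \<le> 1 / (4 * k + 1) * (laplacian \<psi> z * (cmod (v z))\<^sup>2)"
          using k by (simp add: field_simps)
        then have "ennreal ((cmod (v z))\<^sup>2) \<le> ennreal (1 / (4 * k + 1)) * ennreal (laplacian \<psi> z * (cmod (v z))\<^sup>2)"
          using k lap[of z] True by (subst ennreal_mult[symmetric]) (auto intro!: ennreal_leI simp del: mem_ball)
        then show ?thesis using True by simp
      next
        case False
        then have "z \<notin> H \<or> z \<notin> K" using K(2) by blast
        then show ?thesis using v0[of z] by (auto split: split_indicator)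
      qed
    qed
    also have "\<dots> = ennreal (1 / (4 * k + 1)) * ennreal E2"
      by (subst nn_integral_cmult) (simp_all add: E2)
    also have "\<dots> = ennreal (1 / (4 * k + 1) * E2)"
      using k E2_nonneg by (simp flip: ennreal_mult)
    also have "\<dots> \<le> ennreal (1 / 4)"
      using k Ek E1_nonneg by (intro ennreal_leI) (simp add: field_simps)
    finally show ?thesis .
  qed

  have R: "(\<integral>\<^sup>+z\<in>R. ennreal ((cmod (v z))\<^sup>2) \<partial>lborel) \<le> ennreal (1 / 4)"
  proof -
    \<comment> \<open>With this \<open>s\<close>, both terms of \<open>|v|\<^sup>2 \<le> s / 2 + |v|\<^sup>4 / (2 s)\<close> contribute an eighth on \<open>R\<close>.\<close>
    define s where "s = 4 * (1 + k)\<^sup>2"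
    have s: "0 < s" using k by (simp add: s_def)
    have "(\<integral>\<^sup>+z. ennreal ((cmod (v z))^4) \<partial>lborel)
        \<le> (\<integral>\<^sup>+z. ennreal ((cmod (v z))\<^sup>2 + (cmod (p z))\<^sup>2 + (cmod (q z))\<^sup>2) \<partial>lborel)\<^sup>2"
    proof (rule ladyzhenskaya[OF v _ cp p_def cq])
      show "q w = partial_y v w + \<i> * of_real (- partial_x \<psi> w) * v w" for w
        by (simp add: q_def)
    qed (use v0 K(2) in blast)
    also have "(\<integral>\<^sup>+z. ennreal ((cmod (v z))\<^sup>2 + (cmod (p z))\<^sup>2 + (cmod (q z))\<^sup>2) \<partial>lborel)
        = (\<integral>\<^sup>+z. ennreal ((cmod (v z))\<^sup>2) + ennreal ((cmod (p z))\<^sup>2 + (cmod (q z))\<^sup>2) \<partial>lborel)"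
      by (intro nn_integral_cong) (simp add: add.assoc flip: ennreal_plus)
    also have "\<dots> = 1 + ennreal E1"
      using N E1 by (subst nn_integral_add) (simp_all del: ennreal_plus)
    also have "\<dots> \<le> ennreal (1 + k)"
      using E1_nonneg E2_nonneg Ek by (simp flip: ennreal_1 ennreal_plus)
    also have "(ennreal (1 + k))\<^sup>2 = ennreal ((1 + k)\<^sup>2)"
      by (rule ennreal_power) (use k in simp)
    finally have L4: "(\<integral>\<^sup>+z. ennreal ((cmod (v z))^4) \<partial>lborel) \<le> ennreal ((1 + k)\<^sup>2)"
      by (simp add: power_mono)
    have "(\<integral>\<^sup>+z\<in>R. ennreal ((cmod (v z))\<^sup>2) \<partial>lborel)
      \<le> (\<integral>\<^sup>+z. ennreal (s / 2) * indicator R z + ennreal (1 / (2 * s)) * ennreal ((cmod (v z))^4) \<partial>lborel)"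
    proof (rule nn_integral_mono)
      fix z :: complex
      have "0 \<le> ((cmod (v z))\<^sup>2 - s)\<^sup>2 / (2 * s)" using s by simp
      also have "((cmod (v z))\<^sup>2 - s)\<^sup>2 = (cmod (v z))^4 - 2 * s * (cmod (v z))\<^sup>2 + s\<^sup>2"
        by (simp add: power2_diff mult.assoc mult.commute)
      also have "\<dots> / (2 * s) = s / 2 + 1 / (2 * s) * (cmod (v z))^4 - (cmod (v z))\<^sup>2"
        using s by (simp add: field_simps power2_eq_square)
      finally have "(cmod (v z))\<^sup>2 \<le> s / 2 + 1 / (2 * s) * (cmod (v z))^4" by simp
      then have "ennreal ((cmod (v z))\<^sup>2) \<le> ennreal (s / 2) + ennreal (1 / (2 * s)) * ennreal ((cmod (v z))^4)"
        using s by (subst ennreal_mult[symmetric]) (auto intro!: ennreal_leI simp flip: ennreal_plus)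
      then show "ennreal ((cmod (v z))\<^sup>2) * indicator R z \<le> ennreal (s / 2) * indicator R z + ennreal (1 / (2 * s)) * ennreal ((cmod (v z))^4)"
        by (simp split: split_indicator)
    qed
    also have "\<dots> = ennreal (s / 2) * emeasure lborel R + ennreal (1 / (2 * s)) * (\<integral>\<^sup>+z. ennreal ((cmod (v z))^4) \<partial>lborel)"
      by (subst nn_integral_add) (simp_all add: nn_integral_cmult nn_integral_cmult_indicator)
    also have "\<dots> \<le> ennreal (s / 2) * ennreal (1 / (16 * (1 + k)\<^sup>2)) + ennreal (1 / (2 * s)) * ennreal ((1 + k)\<^sup>2)"
      by (intro add_mono mult_left_mono small L4) simp_all
    also have "\<dots> = ennreal (s / 2 * (1 / (16 * (1 + k)\<^sup>2)) + 1 / (2 * s) * (1 + k)\<^sup>2)"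
      using s k by (simp flip: ennreal_mult ennreal_plus)
    also have "s / 2 * (1 / (16 * (1 + k)\<^sup>2)) + 1 / (2 * s) * (1 + k)\<^sup>2 = 1 / 4"
      using k by (simp add: s_def field_simps)
    finally show ?thesis .
  qed

  have "1 \<le> (\<integral>\<^sup>+z. ennreal ((cmod (v z))\<^sup>2) * indicator G z + (ennreal ((cmod (v z))\<^sup>2) * indicator H z + ennreal ((cmod (v z))\<^sup>2) * indicator R z) \<partial>lborel)"
    (is "1 \<le> (\<integral>\<^sup>+z. ?r z \<partial>lborel)")
    unfolding N[symmetric]
  proof (rule nn_integral_mono)
    fix z :: complex
    show "ennreal ((cmod (v z))\<^sup>2) \<le> ?r z"
    proof (cases "z \<in> ?S")
      case True
      then show ?thesis using cover by (auto split: split_indicator simp del: mem_ball)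
    next
      case False
      then have "z \<notin> K" using K(2) by blast
      then show ?thesis by (simp add: v0)
    qed
  qed
  also have "\<dots> = (\<integral>\<^sup>+z\<in>G. ennreal ((cmod (v z))\<^sup>2) \<partial>lborel) + ((\<integral>\<^sup>+z\<in>H. ennreal ((cmod (v z))\<^sup>2) \<partial>lborel) + (\<integral>\<^sup>+z\<in>R. ennreal ((cmod (v z))\<^sup>2) \<partial>lborel))"
    by (simp add: nn_integral_add)
  also have "\<dots> \<le> ennreal (1 / 4) + (ennreal (1 / 4) + ennreal (1 / 4))"
    by (intro add_mono G H R)
  also have "\<dots> = ennreal (1 / 4 + (1 / 4 + 1 / 4))"
  proof -
    have "ennreal (1 / 4 + 1 / 4) = ennreal (1 / 4) + ennreal (1 / 4)"
      "ennreal (1 / 4 + (1 / 4 + 1 / 4)) = ennreal (1 / 4) + ennreal (1 / 4 + 1 / 4)"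
      by (rule ennreal_plus; simp)+
    then show ?thesis by (simp only:)
  qed
  finally show False by (simp flip: ennreal_1)
qed

section \<open>Capacity and the electric ground state energy\<close>

lemma emeasure_ball_le: "0 \<le> r \<Longrightarrow> emeasure lborel (ball (a::complex) r) \<le> ennreal (4 * r\<^sup>2)"
proof -
  assume r: "0 \<le> r"
  have "ball a r \<subseteq> cbox (a - Complex r r) (a + Complex r r)"
  proof
    fix z assume "z \<in> ball a r"
    then have "cmod (z - a) < r" by (simp add: dist_norm norm_minus_commute)
    then have "\<bar>Re z - Re a\<bar> \<le> r" "\<bar>Im z - Im a\<bar> \<le> r"
      using abs_Re_le_cmod[of "z - a"] abs_Im_le_cmod[of "z - a"] by auto
    then show "z \<in> cbox (a - Complex r r) (a + Complex r r)"
      by (auto simp: mem_box Basis_complex_def abs_le_iff)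
  qed
  then have "emeasure lborel (ball a r) \<le> emeasure lborel (cbox (a - Complex r r) (a + Complex r r))"
    by (rule emeasure_mono) simp
  also have "\<dots> = ennreal (4 * r\<^sup>2)"
    using r by (subst emeasure_lborel_cbox) (auto simp: Basis_complex_def power2_eq_square ennreal_mult[symmetric])
  finally show ?thesis .
qed

lemma smooth_step'_bounded: "\<exists>B>0. \<forall>t. smooth_step' t \<le> B"
proof -
  have "compact (smooth_step' ` {1/4..1})"
    by (intro compact_continuous_image continuous_on_subset[OF smooth_on_continuous[OF smooth_smooth_step']]) auto
  then have "bounded (smooth_step' ` {1/4..1})" by (rule compact_imp_bounded)
  then obtain B where B: "\<And>t. t \<in> {1/4..1} \<Longrightarrow> norm (smooth_step' t) \<le> B"
    unfolding bounded_iff by blast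
  have "smooth_step' t \<le> \<bar>B\<bar> + 1" for t
  proof (cases "t \<in> {1/4..1}")
    case True
    then show ?thesis using B[OF True] by simp
  next
    case False
    then show ?thesis using smooth_step'_eq_0[of t] by auto
  qed
  then show ?thesis by (intro exI[of _ "\<bar>B\<bar> + 1"]) auto
qed

text \<open>A point of the plane has zero capacity. The cutoff is the average of \<open>N\<close> copies of one bump, shrunk by the
  factors \<open>2\<^sup>i\<close>. In the plane each copy has the same Dirichlet energy, and the
  gradients live on disjoint annuli, so the energy of the average is of order \<open>N / N\<^sup>2\<close>.\<close>

lemma capacity_cutoff:
  fixes a :: complex
  assumes \<tau>: "0 < \<tau>"
  obtains \<eta> :: "complex \<Rightarrow> real" and r where "smooth_on UNIV \<eta>" "0 < r" "\<And>z. 0 \<le> \<eta> z" "\<And>z. \<eta> z \<le> 1"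
    "\<And>z. z \<in> ball a r \<Longrightarrow> \<eta> z = 1" "\<And>z. z \<notin> ball a \<tau> \<Longrightarrow> \<eta> z = 0"
    "(\<integral>\<^sup>+z. ennreal ((partial_x \<eta> z)\<^sup>2 + (partial_y \<eta> z)\<^sup>2) \<partial>lborel) \<le> ennreal \<tau>"
proof -
  obtain B where B: "0 < B" "\<And>t. smooth_step' t \<le> B"
    using smooth_step'_bounded by blast
  obtain N0 :: nat where "16 * B\<^sup>2 / \<tau> < real N0" using reals_Archimedean2 by blast
  then obtain N where N: "0 < N" "16 * B\<^sup>2 / real N \<le> \<tau>"
    using \<tau> B(1) by (intro that[of "Suc N0"]) (auto simp: field_simps intro: less_imp_le order_trans)
  define c :: "nat \<Rightarrow> real" where "c i = 4 ^ i / \<tau>\<^sup>2" for i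
  have c: "0 < c i" for i using \<tau> by (simp add: c_def)
  have c_mono: "4 * c i \<le> c j" if "i < j" for i j
  proof -
    have "(4::real) ^ Suc i \<le> 4 ^ j" using that by (intro power_increasing) auto
    then show ?thesis using \<tau> by (simp add: c_def field_simps)
  qed
  define q where "q = 1 / real N"
  have q: "0 < q" "real N * q = 1" using N(1) by (auto simp: q_def)
  define \<eta> where "\<eta> z = q * (\<Sum>i<N. 1 - smooth_step (sqdist a (c i) z))" for z
  have sm: "smooth_on UNIV \<eta>"
    unfolding \<eta>_def[abs_def]
    by (intro smooth_on_sum smooth_on_mult smooth_on_diff smooth_on_const smooth_radial smooth_smooth_step open_UNIV)
  define d where "d i z = smooth_step' (sqdist a (c i) z)" for i z
  have der: "(\<eta> has_derivative (\<lambda>h. q * (\<Sum>i<N. 0 - d i z * (2 * c i * ((Re z - Re a) * Re h + (Im z - Im a) * Im h))))) (at z)" for z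
    unfolding \<eta>_def[abs_def] d_def
    by (intro has_derivative_mult_right has_derivative_sum has_derivative_diff has_derivative_const radial_has_derivative smooth_step_has_derivative)
  have disj: "d i z = 0 \<or> d j z = 0" if "i < j" for i j z
  proof (rule ccontr)
    assume "\<not> ?thesis"
    then have "1 / 4 < c i * (cmod (z - a))\<^sup>2" "c j * (cmod (z - a))\<^sup>2 < 1"
      using smooth_step'_pos[of "sqdist a (c i) z"] smooth_step'_pos[of "sqdist a (c j) z"]
        smooth_step'_nonneg[of "sqdist a (c i) z"] smooth_step'_nonneg[of "sqdist a (c j) z"]
      by (auto simp: d_def sqdist_eq)
    moreover have "4 * c i * (cmod (z - a))\<^sup>2 \<le> c j * (cmod (z - a))\<^sup>2"
      by (rule mult_right_mono[OF c_mono[OF that]]) simp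
    ultimately show False by linarith
  qed
  define g where "g z = (\<Sum>i<N. c i * d i z)" for z
  have sum_g: "(\<Sum>i<N. 0 - d i z * (2 * c i * X)) = - (2 * X) * g z" for X z
    by (simp add: g_def sum_distrib_left sum_negf mult_ac)
  have px: "partial_x \<eta> z = - (2 * q * (Re z - Re a)) * g z" for z
  proof -
    have "partial_x \<eta> z = q * (\<Sum>i<N. 0 - d i z * (2 * c i * ((Re z - Re a) * Re 1 + (Im z - Im a) * Im 1)))"
      by (rule partial_x_eq[OF der])
    also have "\<dots> = q * (\<Sum>i<N. 0 - d i z * (2 * c i * (Re z - Re a)))" by simp
    also have "\<dots> = q * (- (2 * (Re z - Re a)) * g z)" by (simp only: sum_g)
    finally show ?thesis by (simp add: algebra_simps)
  qed
  have py: "partial_y \<eta> z = - (2 * q * (Im z - Im a)) * g z" for z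
  proof -
    have "partial_y \<eta> z = q * (\<Sum>i<N. 0 - d i z * (2 * c i * ((Re z - Re a) * Re \<i> + (Im z - Im a) * Im \<i>)))"
      by (rule partial_y_eq[OF der])
    also have "\<dots> = q * (\<Sum>i<N. 0 - d i z * (2 * c i * (Im z - Im a)))" by simp
    also have "\<dots> = q * (- (2 * (Im z - Im a)) * g z)" by (simp only: sum_g)
    finally show ?thesis by (simp add: algebra_simps)
  qed
  have g2: "(g z)\<^sup>2 = (\<Sum>i<N. (c i)\<^sup>2 * (d i z)\<^sup>2)" for z
  proof -
    have "(g z)\<^sup>2 = (\<Sum>i<N. \<Sum>j<N. (c i * d i z) * (c j * d j z))"
      by (simp add: g_def power2_eq_square sum_product)
    also have "\<dots> = (\<Sum>i<N. \<Sum>j<N. if j = i then (c i)\<^sup>2 * (d i z)\<^sup>2 else 0)"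
    proof (intro sum.cong refl)
      fix i j
      show "(c i * d i z) * (c j * d j z) = (if j = i then (c i)\<^sup>2 * (d i z)\<^sup>2 else 0)"
        using disj[of i j z] disj[of j i z] by (cases i j rule: linorder_cases) (auto simp: power2_eq_square)
    qed
    also have "\<dots> = (\<Sum>i<N. (c i)\<^sup>2 * (d i z)\<^sup>2)" by simp
    finally show ?thesis .
  qed
  \<comment> \<open>the \<open>i\<close>-th gradient lives in the disk of radius \<open>\<rho> i\<close>, whose area is compensated by the weight \<open>w i\<close>\<close>
  define \<rho> where "\<rho> i = 1 / sqrt (c i)" for i
  define w where "w i = 4 * c i * B\<^sup>2 * q\<^sup>2" for i
  have w: "0 \<le> w i" for i using c[of i] by (simp add: w_def)
  have bound: "(partial_x \<eta> z)\<^sup>2 + (partial_y \<eta> z)\<^sup>2 \<le> (\<Sum>i<N. w i * indicator (ball a (\<rho> i)) z)" for z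
  proof -
    have "(partial_x \<eta> z)\<^sup>2 + (partial_y \<eta> z)\<^sup>2 = 4 * (cmod (z - a))\<^sup>2 * q\<^sup>2 * (g z)\<^sup>2"
      unfolding px py cmod_power2 by (simp add: power2_eq_square algebra_simps)
    also have "\<dots> = (\<Sum>i<N. 4 * (cmod (z - a))\<^sup>2 * q\<^sup>2 * ((c i)\<^sup>2 * (d i z)\<^sup>2))"
      by (simp add: g2 sum_distrib_left)
    also have "\<dots> \<le> (\<Sum>i<N. w i * indicator (ball a (\<rho> i)) z)"
    proof (rule sum_mono)
      fix i
      show "4 * (cmod (z - a))\<^sup>2 * q\<^sup>2 * ((c i)\<^sup>2 * (d i z)\<^sup>2) \<le> w i * indicator (ball a (\<rho> i)) z"
      proof (cases "d i z = 0")
        case True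
        then show ?thesis using w[of i] by simp
      next
        case False
        then have lt: "c i * (cmod (z - a))\<^sup>2 < 1"
          using smooth_step'_pos[of "sqdist a (c i) z"] smooth_step'_nonneg[of "sqdist a (c i) z"]
          by (auto simp: d_def sqdist_eq)
        have "(cmod (z - a))\<^sup>2 < (\<rho> i)\<^sup>2"
          using lt c[of i] by (simp add: \<rho>_def power_divide field_simps)
        then have "cmod (z - a) < \<rho> i"
          by (rule power2_less_imp_less) (use c[of i] in \<open>simp add: \<rho>_def\<close>)
        then have z: "z \<in> ball a (\<rho> i)" by (simp add: dist_norm norm_minus_commute)
        have "(d i z)\<^sup>2 \<le> B\<^sup>2"
          using B(2) smooth_step'_nonneg by (intro power_mono) (auto simp: d_def)
        then have "(c i * (cmod (z - a))\<^sup>2) * (d i z)\<^sup>2 \<le> 1 * B\<^sup>2"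
          using lt c[of i] by (intro mult_mono) auto
        then have "4 * c i * q\<^sup>2 * ((c i * (cmod (z - a))\<^sup>2) * (d i z)\<^sup>2) \<le> 4 * c i * q\<^sup>2 * (1 * B\<^sup>2)"
          using c[of i] by (intro mult_left_mono) auto
        then show ?thesis using z by (simp add: w_def power2_eq_square algebra_simps)
      qed
    qed
    finally show ?thesis .
  qed
  have "(\<integral>\<^sup>+z. ennreal ((partial_x \<eta> z)\<^sup>2 + (partial_y \<eta> z)\<^sup>2) \<partial>lborel)
      \<le> (\<integral>\<^sup>+z. (\<Sum>i<N. ennreal (w i) * indicator (ball a (\<rho> i)) z) \<partial>lborel)"
    (is "(\<integral>\<^sup>+z. ?l z \<partial>lborel) \<le> (\<integral>\<^sup>+z. ?r z \<partial>lborel)")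
  proof (rule nn_integral_mono)
    fix z
    have "ennreal ((partial_x \<eta> z)\<^sup>2 + (partial_y \<eta> z)\<^sup>2) \<le> ennreal (\<Sum>i<N. w i * indicator (ball a (\<rho> i)) z)"
      by (rule ennreal_leI[OF bound])
    also have "\<dots> = (\<Sum>i<N. ennreal (w i * indicator (ball a (\<rho> i)) z))"
      using w by (intro sum_ennreal[symmetric]) auto
    also have "\<dots> = (\<Sum>i<N. ennreal (w i) * indicator (ball a (\<rho> i)) z)"
      by (intro sum.cong refl) (auto split: split_indicator)
    finally show "?l z \<le> ?r z" .
  qed
  also have "\<dots> = (\<Sum>i<N. ennreal (w i) * emeasure lborel (ball a (\<rho> i)))"
  proof (subst nn_integral_sum)
    show "(\<lambda>z. ennreal (w i) * indicator (ball a (\<rho> i)) z) \<in> borel_measurable lborel" for i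
      by (intro borel_measurable_times_ennreal borel_measurable_const borel_measurable_indicator) simp
    show "(\<Sum>i<N. \<integral>\<^sup>+z. ennreal (w i) * indicator (ball a (\<rho> i)) z \<partial>lborel)
        = (\<Sum>i<N. ennreal (w i) * emeasure lborel (ball a (\<rho> i)))"
      by (intro sum.cong refl nn_integral_cmult_indicator) simp
  qed
  also have "\<dots> \<le> (\<Sum>i<N. ennreal (16 * B\<^sup>2 * q\<^sup>2))"
  proof (rule sum_mono)
    fix i
    have "0 \<le> \<rho> i" using c[of i] by (simp add: \<rho>_def)
    then have "ennreal (w i) * emeasure lborel (ball a (\<rho> i))
        \<le> ennreal (w i) * ennreal (4 * (\<rho> i)\<^sup>2)"
      by (intro mult_left_mono emeasure_ball_le) auto
    also have "\<dots> = ennreal (w i * (4 * (\<rho> i)\<^sup>2))"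
      using w[of i] by (intro ennreal_mult[symmetric]) auto
    also have "w i * (4 * (\<rho> i)\<^sup>2) = 16 * B\<^sup>2 * q\<^sup>2"
      using c[of i] by (simp add: w_def \<rho>_def power_divide field_simps)
    finally show "ennreal (w i) * emeasure lborel (ball a (\<rho> i)) \<le> ennreal (16 * B\<^sup>2 * q\<^sup>2)" .
  qed
  also have "\<dots> = ennreal (real N * (16 * B\<^sup>2 * q\<^sup>2))"
    by (simp add: ennreal_mult ennreal_of_nat_eq_real_of_nat)
  also have "real N * (16 * B\<^sup>2 * q\<^sup>2) = 16 * B\<^sup>2 / real N"
    using N(1) by (simp add: q_def power2_eq_square)
  also have "ennreal \<dots> \<le> ennreal \<tau>" by (rule ennreal_leI[OF N(2)])
  finally have energy: "(\<integral>\<^sup>+z. ennreal ((partial_x \<eta> z)\<^sup>2 + (partial_y \<eta> z)\<^sup>2) \<partial>lborel) \<le> ennreal \<tau>" .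
  have nonneg: "0 \<le> \<eta> z" for z
    unfolding \<eta>_def using smooth_step_le_1 q by (intro mult_nonneg_nonneg sum_nonneg) auto
  have le1: "\<eta> z \<le> 1" for z
  proof -
    have "\<eta> z \<le> q * (\<Sum>i<N. 1)"
      unfolding \<eta>_def using smooth_step_nonneg q by (intro mult_left_mono sum_mono) auto
    then show ?thesis using q by (simp add: mult.commute)
  qed
  define r where "r = \<tau> / 2 ^ Suc N"
  have one: "\<eta> z = 1" if "z \<in> ball a r" for z
  proof -
    have zr: "cmod (z - a) < r" using that by (simp add: dist_norm norm_minus_commute)
    have "smooth_step (sqdist a (c i) z) = 0" if "i < N" for i
    proof (rule smooth_step_eq_0)
      have "sqdist a (c i) z \<le> c i * r\<^sup>2"
        unfolding sqdist_eq using zr c[of i] by (intro mult_left_mono power_mono) auto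
      also have "r\<^sup>2 = \<tau>\<^sup>2 / 4 ^ Suc N"
        by (simp add: r_def power_divide power_mult_distrib power2_eq_square flip: power_mult_distrib)
      also have "c i * (\<tau>\<^sup>2 / 4 ^ Suc N) = 4 ^ i / 4 ^ N / 4"
        using \<tau> by (simp add: c_def)
      also have "\<dots> \<le> 1 / 4"
        using power_increasing[of i N "4::real"] that by (simp add: divide_le_eq)
      finally show "sqdist a (c i) z \<le> 1 / 4" .
    qed
    then have "\<eta> z = q * (\<Sum>i<N. 1)" unfolding \<eta>_def by simp
    then show ?thesis using q by (simp add: mult.commute)
  qed
  have zero: "\<eta> z = 0" if "z \<notin> ball a \<tau>" for z
  proof -
    have z\<tau>: "\<tau> \<le> cmod (z - a)" using that by (simp add: dist_norm norm_minus_commute)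
    have "smooth_step (sqdist a (c i) z) = 1" for i
    proof (rule smooth_step_eq_1)
      have "1 \<le> c i * \<tau>\<^sup>2" using \<tau> by (simp add: c_def)
      also have "\<dots> \<le> sqdist a (c i) z"
        unfolding sqdist_eq using z\<tau> \<tau> c[of i] by (intro mult_left_mono power_mono) auto
      finally show "1 \<le> sqdist a (c i) z" .
    qed
    then show ?thesis by (simp add: \<eta>_def)
  qed
  have "0 < r" using \<tau> by (simp add: r_def)
  then show ?thesis
    using that[OF sm _ nonneg le1 one zero energy] by blast
qed

definition dirichlet :: "(complex \<Rightarrow> complex) \<Rightarrow> real" where
  "dirichlet v = (LINT z:ball 0 1|lborel. (norm (gradient v z))\<^sup>2)"

definition mass :: "(complex \<Rightarrow> complex) \<Rightarrow> real" where
  "mass v = (LINT z:ball 0 1|lborel. (cmod (v z))\<^sup>2)"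

text \<open>The bound by \<open>1\<close> ensures that the term \<open>v \<nabla>\<eta>\<close> in the gradient of \<open>(1 - \<eta>) v\<close> is not larger than \<open>\<nabla>\<eta>\<close>.\<close>

definition trial :: "(complex \<Rightarrow> complex) \<Rightarrow> bool" where
  "trial v \<longleftrightarrow> smooth_on UNIV v \<and> (\<exists>K. compact K \<and> K \<subseteq> ball 0 1 \<and> (\<forall>z. z \<notin> K \<longrightarrow> v z = 0)) \<and> (\<forall>z. cmod (v z) \<le> 1)"

lemma continuous_on_gradient:
  assumes "smooth_on UNIV v" shows "continuous_on A (\<lambda>z. (norm (gradient v z))\<^sup>2)"
  unfolding gradient_def
  by (intro continuous_on_power continuous_on_norm continuous_on_Pair
    smooth_continuous_on[OF smooth_on_partial_x[OF assms]]
    smooth_continuous_on[OF smooth_on_partial_y[OF assms]])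

lemma trial_integrable:
  assumes "trial v"
  shows "set_integrable lborel (ball 0 1) (\<lambda>z. (norm (gradient v z))\<^sup>2)"
    and "set_integrable lborel (ball 0 1) (\<lambda>z. (cmod (v z))\<^sup>2)"
    and "continuous_on (ball 0 1) B \<Longrightarrow> set_integrable lborel (ball 0 1) (\<lambda>z. B z * (cmod (v z))\<^sup>2)"
proof -
  obtain K where v: "smooth_on UNIV v" and K: "compact K" "K \<subseteq> ball 0 1" and v0: "\<And>z. z \<notin> K \<Longrightarrow> v z = 0"
    using assms by (auto simp: trial_def)
  have cv: "continuous_on A (\<lambda>z. (cmod (v z))\<^sup>2)" for A
    by (intro continuous_on_power continuous_on_norm smooth_continuous_on[OF v])
  show "set_integrable lborel (ball 0 1) (\<lambda>z. (norm (gradient v z))\<^sup>2)"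
    using partial_xy_eq_0[OF K(1) v0]
    by (intro set_lebesgue_integral_compact_support(1)[OF open_ball K continuous_on_gradient[OF v]])
      (auto simp: gradient_def)
  show "set_integrable lborel (ball 0 1) (\<lambda>z. (cmod (v z))\<^sup>2)"
    by (intro set_lebesgue_integral_compact_support(1)[OF open_ball K cv]) (auto simp: v0)
  show "set_integrable lborel (ball 0 1) (\<lambda>z. B z * (cmod (v z))\<^sup>2)" if "continuous_on (ball 0 1) B"
    by (intro set_lebesgue_integral_compact_support(1)[OF open_ball K continuous_on_mult[OF that cv]]) (auto simp: v0)
qed

lemma gradient_cutoff_le:
  assumes v: "smooth_on UNIV v" "cmod (v z) \<le> 1" and \<eta>: "smooth_on UNIV \<eta>" "0 \<le> \<eta> z" "\<eta> z \<le> 1" and t: "0 < t"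
  shows "(norm (gradient (\<lambda>z. of_real (1 - \<eta> z) * v z) z))\<^sup>2
    \<le> (1 + t) * (norm (gradient v z))\<^sup>2 + (1 + 1 / t) * ((partial_x \<eta> z)\<^sup>2 + (partial_y \<eta> z)\<^sup>2)"
proof -
  note dv = smooth_on_has_partials[OF v(1) UNIV_I, of z] and d\<eta> = smooth_on_has_partials[OF \<eta>(1) UNIV_I, of z]
  have d: "((\<lambda>z. of_real (1 - \<eta> z) * v z) has_derivative
     (\<lambda>h. of_real (1 - \<eta> z) * (Re h *\<^sub>R partial_x v z + Im h *\<^sub>R partial_y v z) +
        of_real (0 - (Re h *\<^sub>R partial_x \<eta> z + Im h *\<^sub>R partial_y \<eta> z)) * v z)) (at z)"
    by (intro has_derivative_mult has_derivative_of_real has_derivative_diff has_derivative_const dv d\<eta>)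
  have one: "(cmod (of_real (1 - \<eta> z) * w - of_real y * v z))\<^sup>2 \<le> (1 + t) * (cmod w)\<^sup>2 + (1 + 1 / t) * y\<^sup>2" for w y
  proof -
    have "cmod (of_real (1 - \<eta> z) * w - of_real y * v z) \<le> (1 - \<eta> z) * cmod w + \<bar>y\<bar> * cmod (v z)"
      using norm_triangle_ineq4[of "of_real (1 - \<eta> z) * w" "of_real y * v z"] \<eta>(3)
      by (simp only: norm_mult norm_of_real real_norm_def)
    also have "\<dots> \<le> 1 * cmod w + \<bar>y\<bar> * 1"
      using \<eta> v(2) by (intro add_mono mult_mono) auto
    finally have "(cmod (of_real (1 - \<eta> z) * w - of_real y * v z))\<^sup>2 \<le> (cmod w + \<bar>y\<bar>)\<^sup>2"
      by (intro power_mono) auto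
    also have "\<dots> \<le> (1 + t) * (cmod w)\<^sup>2 + (1 + 1 / t) * y\<^sup>2"
    proof -
      have "0 \<le> (t * cmod w - \<bar>y\<bar>)\<^sup>2 / t" using t by simp
      also have "\<dots> = t * (cmod w)\<^sup>2 - 2 * cmod w * \<bar>y\<bar> + y\<^sup>2 / t"
        using t by (simp add: power2_diff power_mult_distrib field_simps power2_eq_square)
      finally show ?thesis by (simp add: power2_sum algebra_simps)
    qed
    finally show ?thesis .
  qed
  have "(norm (gradient (\<lambda>z. of_real (1 - \<eta> z) * v z) z))\<^sup>2
    = (cmod (of_real (1 - \<eta> z) * partial_x v z - of_real (partial_x \<eta> z) * v z))\<^sup>2
    + (cmod (of_real (1 - \<eta> z) * partial_y v z - of_real (partial_y \<eta> z) * v z))\<^sup>2"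
    using partial_x_eq[OF d] partial_y_eq[OF d] by (simp add: gradient_def norm_Pair)
  also have "\<dots> \<le> ((1 + t) * (cmod (partial_x v z))\<^sup>2 + (1 + 1 / t) * (partial_x \<eta> z)\<^sup>2)
     + ((1 + t) * (cmod (partial_y v z))\<^sup>2 + (1 + 1 / t) * (partial_y \<eta> z)\<^sup>2)"
    by (intro add_mono one)
  also have "\<dots> = (1 + t) * (norm (gradient v z))\<^sup>2 + (1 + 1 / t) * ((partial_x \<eta> z)\<^sup>2 + (partial_y \<eta> z)\<^sup>2)"
    by (simp add: gradient_def norm_Pair algebra_simps)
  finally show ?thesis .
qed

text \<open>Strict inequalities for the two integrals leave room for a further cutoff of small energy, and
  they hold again afterwards. In this form the step can be repeated infinitely often without keeping account of
  the errors.\<close>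

lemma trial_remove_point:
  assumes v: "trial v" and g: "dirichlet v < g" and m: "m < mass v"
  obtains v' r where "trial v'" "0 < r" "\<And>z. z \<in> ball a r \<Longrightarrow> v' z = 0" "\<And>z. v z = 0 \<Longrightarrow> v' z = 0"
    "dirichlet v' < g" "m < mass v'"
proof -
  let ?S = "ball (0::complex) 1"
  obtain K where sv: "smooth_on UNIV v" and K: "compact K" "K \<subseteq> ?S" and v0: "\<And>z. z \<notin> K \<Longrightarrow> v z = 0"
    and v1: "\<And>z. cmod (v z) \<le> 1"
    using v by (auto simp: trial_def)
  have D0: "0 \<le> dirichlet v"
    unfolding dirichlet_def set_lebesgue_integral_def by (intro integral_nonneg_AE) auto
  \<comment> \<open>Half of the room up to \<open>g\<close> is spent on the factor \<open>1 + t\<close>, a quarter of it on the energy of the cutoff.\<close>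
  define t where "t = (g - dirichlet v) / (2 * (dirichlet v + 1))"
  have t: "0 < t" using g D0 by (simp add: t_def)
  have t1: "t * dirichlet v \<le> (g - dirichlet v) / 2"
  proof -
    have "t * dirichlet v \<le> t * (dirichlet v + 1)" using t by simp
    also have "\<dots> = (g - dirichlet v) / 2" using D0 by (simp add: t_def field_simps)
    finally show ?thesis .
  qed
  define \<tau> where "\<tau> = min (min 1 ((mass v - m) / 8)) ((g - dirichlet v) / (4 * (1 + 1 / t)))"
  have "0 < (g - dirichlet v) / (4 * (1 + 1 / t))"
    using t g by (intro divide_pos_pos mult_pos_pos add_pos_pos) auto
  moreover have "0 < (mass v - m) / 8" using m by simp
  moreover have "0 < min (min 1 x) y \<and> min (min 1 x) y \<le> 1 \<and> min (min 1 x) y \<le> x \<and> min (min 1 x) y \<le> y"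
    if "0 < y" "0 < x" for x y :: real using that by auto
  ultimately have \<tau>: "0 < \<tau>" "\<tau> \<le> 1" "\<tau> \<le> (mass v - m) / 8" "\<tau> \<le> (g - dirichlet v) / (4 * (1 + 1 / t))"
    unfolding \<tau>_def by blast+
  obtain \<eta> r where \<eta>: "smooth_on UNIV \<eta>" "0 < r" "\<And>z. 0 \<le> \<eta> z" "\<And>z. \<eta> z \<le> 1"
    "\<And>z. z \<in> ball a r \<Longrightarrow> \<eta> z = 1" "\<And>z. z \<notin> ball a \<tau> \<Longrightarrow> \<eta> z = 0"
    "(\<integral>\<^sup>+z. ennreal ((partial_x \<eta> z)\<^sup>2 + (partial_y \<eta> z)\<^sup>2) \<partial>lborel) \<le> ennreal \<tau>"
    using capacity_cutoff[OF \<tau>(1), of a] by blast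
  define v' where "v' z = of_real (1 - \<eta> z) * v z" for z
  have sv': "smooth_on UNIV v'"
    unfolding v'_def[abs_def]
    by (intro smooth_on_mult smooth_on_bounded_linear[OF open_UNIV bounded_linear_of_real] smooth_on_diff smooth_on_const \<eta> sv open_UNIV)
  have v'1: "cmod (v' z) \<le> 1" for z
  proof -
    have "cmod (v' z) = (1 - \<eta> z) * cmod (v z)" 
      unfolding v'_def norm_mult norm_of_real using \<eta>(4)[of z] by simp
    also have "\<dots> \<le> 1 * 1" using \<eta>(3,4) v1 by (intro mult_mono) auto
    finally show ?thesis by simp
  qed
  have v'0: "v' z = 0" if "z \<notin> K" for z using v0[OF that] by (simp add: v'_def)
  have tv': "trial v'"
    unfolding trial_def using sv' K v'0 v'1 by blast
  let ?e = "\<lambda>z. (partial_x \<eta> z)\<^sup>2 + (partial_y \<eta> z)\<^sup>2"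
  have ce: "continuous_on A ?e" for A
    by (intro continuous_on_add continuous_on_power
      smooth_continuous_on[OF smooth_on_partial_x[OF \<eta>(1)]]
      smooth_continuous_on[OF smooth_on_partial_y[OF \<eta>(1)]])
  have [measurable]: "?e \<in> borel_measurable borel" by (rule borel_measurable_continuous_onI[OF ce])
  have ie: "integrable lborel ?e"
  proof (rule integrableI_nonneg)
    show "(\<integral>\<^sup>+z. ennreal (?e z) \<partial>lborel) < \<infinity>"
      using \<eta>(7) by (rule order.strict_trans1) simp
  qed auto
  have "ennreal (integral\<^sup>L lborel ?e) \<le> ennreal \<tau>"
    using \<eta>(7) nn_integral_eq_integral[OF ie] by simp
  then have e\<tau>: "integral\<^sup>L lborel ?e \<le> \<tau>" using \<tau> by simp
  have ise: "set_integrable lborel ?S ?e"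
    unfolding set_integrable_def by (rule integrable_mult_indicator[OF _ ie]) simp
  have se: "(LINT z:?S|lborel. ?e z) \<le> \<tau>"
  proof -
    have "(LINT z:?S|lborel. ?e z) \<le> integral\<^sup>L lborel ?e"
      unfolding set_lebesgue_integral_def
      by (rule integral_mono[OF ise[unfolded set_integrable_def] ie]) (auto split: split_indicator)
    then show ?thesis using e\<tau> by linarith
  qed
  have i1: "set_integrable lborel ?S (\<lambda>z. (1 + t) * (norm (gradient v z))\<^sup>2)"
    by (rule set_integrable_mult_right) (rule trial_integrable(1)[OF v])
  have i2: "set_integrable lborel ?S (\<lambda>z. (1 + 1 / t) * ?e z)"
    by (rule set_integrable_mult_right) (rule ise)
  have "dirichlet v' \<le> (LINT z:?S|lborel. (1 + t) * (norm (gradient v z))\<^sup>2 + (1 + 1 / t) * ?e z)"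
    unfolding dirichlet_def
  proof (rule set_integral_mono[OF trial_integrable(1)[OF tv'] set_integral_add(1)[OF i1 i2]])
    show "(norm (gradient v' z))\<^sup>2 \<le> (1 + t) * (norm (gradient v z))\<^sup>2 + (1 + 1 / t) * ?e z" for z
      unfolding v'_def[abs_def] by (rule gradient_cutoff_le[OF sv v1 \<eta>(1,3,4) t])
  qed
  also have "\<dots> = (1 + t) * dirichlet v + (1 + 1 / t) * (LINT z:?S|lborel. ?e z)"
    unfolding dirichlet_def set_integral_add(2)[OF i1 i2] set_integral_mult_right ..
  also have "\<dots> \<le> (1 + t) * dirichlet v + (1 + 1 / t) * \<tau>"
    using se t by (intro add_left_mono mult_left_mono) auto
  also have "\<dots> \<le> dirichlet v + (g - dirichlet v) / 2 + (g - dirichlet v) / 4"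
  proof -
    have "(1 + 1 / t) * \<tau> \<le> (1 + 1 / t) * ((g - dirichlet v) / (4 * (1 + 1 / t)))"
      using \<tau>(4) t by (intro mult_left_mono) auto
    also have "\<dots> = (g - dirichlet v) / 4"
    proof -
      have "w * (x / (4 * w)) = x / 4" if "0 < w" for w x :: real using that by simp
      moreover have "0 < 1 + 1 / t" using t by (simp add: add_pos_pos)
      ultimately show ?thesis by blast
    qed
    finally show ?thesis using t1 by (simp add: algebra_simps)
  qed
  also have "\<dots> < g"
  proof -
    have "d + (e - d) / 2 + (e - d) / 4 < e" if "d < e" for d e :: real
      using that by (simp add: field_simps)
    then show ?thesis using g by blast
  qed
  finally have D: "dirichlet v' < g" .
  have ib: "integrable lborel (indicator (ball a \<tau>) :: complex \<Rightarrow> real)"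
    using emeasure_ball_le[of \<tau> a] \<tau> by (intro integrable_real_indicator) (auto simp: less_top[symmetric] top_unique)
  have mb: "measure lborel (ball a \<tau>) \<le> 4 * \<tau>\<^sup>2"
    using emeasure_ball_le[of \<tau> a] \<tau> unfolding measure_def
    by (intro enn2real_leI) auto
  have isb: "set_integrable lborel ?S (indicator (ball a \<tau>) :: complex \<Rightarrow> real)"
    unfolding set_integrable_def by (rule integrable_mult_indicator[OF _ ib]) simp
  have "mass v \<le> (LINT z:?S|lborel. (cmod (v' z))\<^sup>2 + indicator (ball a \<tau>) z)"
    unfolding mass_def
  proof (rule set_integral_mono)
    fix z
    show "(cmod (v z))\<^sup>2 \<le> (cmod (v' z))\<^sup>2 + indicator (ball a \<tau>) z"
    proof (cases "z \<in> ball a \<tau>")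
      case True
      have "(cmod (v z))\<^sup>2 \<le> 1" using v1[of z] by (simp add: power_le_one)
      then show ?thesis using True by (simp add: add_increasing)
    next
      case False
      then show ?thesis using \<eta>(6)[OF False] by (simp add: v'_def)
    qed
  qed (use trial_integrable(2)[OF v] trial_integrable(2)[OF tv'] isb in \<open>auto intro: set_integral_add(1)\<close>)
  also have "\<dots> = mass v' + (LINT z:?S|lborel. indicator (ball a \<tau>) z)"
    unfolding mass_def by (rule set_integral_add(2)[OF trial_integrable(2)[OF tv'] isb])
  also have "(LINT z:?S|lborel. indicator (ball a \<tau>) z) \<le> integral\<^sup>L lborel (indicator (ball a \<tau>) :: complex \<Rightarrow> real)"
    unfolding set_lebesgue_integral_def
    by (rule integral_mono[OF isb[unfolded set_integrable_def] ib]) (auto split: split_indicator)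
  also have "integral\<^sup>L lborel (indicator (ball a \<tau>) :: complex \<Rightarrow> real) = measure lborel (ball a \<tau>)"
    by simp
  also note mb
  also have "4 * \<tau>\<^sup>2 \<le> 4 * \<tau>" using \<tau>(1,2) by (simp add: power2_eq_square mult_le_one)
  finally have "m < mass v'" using \<tau>(3) m by simp
  then show ?thesis
    using that[OF tv' \<eta>(2) _ _ D] \<eta>(5) by (auto simp: v'_def)
qed

lemma trial_remove_points:
  assumes "finite A" and v: "trial v" and g: "dirichlet v < g" and m: "m < mass v"
  shows "\<exists>v' r. trial v' \<and> 0 < r \<and> (\<forall>a\<in>A. \<forall>z\<in>ball a r. v' z = 0) \<and> (\<forall>z. v z = 0 \<longrightarrow> v' z = 0) \<and>
    dirichlet v' < g \<and> m < mass v'"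
  using assms(1)
proof (induction A rule: finite_induct)
  case empty
  show ?case using v g m by (intro exI[of _ v] exI[of _ 1]) auto
next
  case (insert a A)
  then obtain v1 r1 where v1: "trial v1" "0 < r1" "\<forall>a\<in>A. \<forall>z\<in>ball a r1. v1 z = 0" "\<forall>z. v z = 0 \<longrightarrow> v1 z = 0"
    "dirichlet v1 < g" "m < mass v1" by blast
  obtain v2 r2 where v2: "trial v2" "0 < r2" "\<And>z. z \<in> ball a r2 \<Longrightarrow> v2 z = 0" "\<And>z. v1 z = 0 \<Longrightarrow> v2 z = 0"
    "dirichlet v2 < g" "m < mass v2"
    using trial_remove_point[OF v1(1,5,6), of a] by blast
  show ?case
  proof (intro exI[of _ v2] exI[of _ "min r1 r2"] conjI ballI allI impI)
    fix b z assume bz: "b \<in> insert a A" "z \<in> ball b (min r1 r2)"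
    then consider "b = a" | "b \<in> A" by blast
    then show "v2 z = 0"
    proof cases
      case 1
      then show ?thesis using v2(3)[of z] bz(2) by simp
    next
      case 2
      then have "v1 z = 0" using v1(3) bz(2) by simp
      then show ?thesis by (rule v2(4))
    qed
  qed (use v1 v2 in auto)
qed

lemma trial_exists: "\<exists>v. trial v \<and> 0 < mass v"
proof -
  obtain \<eta> :: "complex \<Rightarrow> real" and r where \<eta>: "smooth_on UNIV \<eta>" "0 < r" "\<And>z. 0 \<le> \<eta> z" "\<And>z. \<eta> z \<le> 1"
    "\<And>z. z \<in> ball 0 r \<Longrightarrow> \<eta> z = 1" "\<And>z. z \<notin> ball 0 (1/2) \<Longrightarrow> \<eta> z = 0"
  proof -
    have "(0::real) < 1 / 2" by simp
    then show ?thesis by (rule capacity_cutoff[of "1 / 2" 0]) (rule that)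
  qed
  define v :: "complex \<Rightarrow> complex" where "v z = of_real (\<eta> z)" for z
  have v: "trial v"
    unfolding trial_def
  proof (intro conjI exI[of _ "cball 0 (1/2)"] allI impI)
    show "smooth_on UNIV v"
      unfolding v_def[abs_def] by (rule smooth_on_bounded_linear[OF open_UNIV bounded_linear_of_real \<eta>(1)])
    show "v z = 0" if "z \<notin> cball 0 (1/2)" for z
      using \<eta>(6)[of z] that by (auto simp: v_def)
    show "cmod (v z) \<le> 1" for z using \<eta>(3,4)[of z] by (simp add: v_def)
  qed auto
  let ?b = "ball (0::complex) (min r 1)"
  have ib: "integrable lborel (indicator ?b :: complex \<Rightarrow> real)"
    using emeasure_ball_le[of "min r 1" 0] \<eta>(2) by (intro integrable_real_indicator) (auto simp: less_top[symmetric] top_unique)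
  have "0 < measure lborel ?b"
    using \<eta>(2) by (intro content_ball_pos) auto
  also have "measure lborel ?b = integral\<^sup>L lborel (indicator ?b :: complex \<Rightarrow> real)" by simp
  also have "\<dots> \<le> mass v"
    unfolding mass_def set_lebesgue_integral_def
  proof (rule integral_mono[OF ib trial_integrable(2)[OF v, unfolded set_integrable_def]])
    fix z
    show "indicator ?b z \<le> indicator (ball 0 1) z *\<^sub>R (cmod (v z))\<^sup>2"
      using \<eta>(5)[of z] by (auto simp: v_def split: split_indicator)
  qed
  finally show ?thesis using v by blast
qed

text \<open>The normalised \<open>v\<close> is a competitor, with Dirichlet part at most \<open>g / m\<close> and potential part at most \<open>1\<close>.\<close>

lemma lambda_e_le:
  assumes v: "trial v" and g: "dirichlet v < g" and m: "m < mass v" "0 < m"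
    and \<psi>: "smooth_on (ball 0 1) \<psi>" and bd: "\<And>z. z \<in> ball 0 1 \<Longrightarrow> laplacian \<psi> z * (cmod (v z))\<^sup>2 \<le> (cmod (v z))\<^sup>2"
  shows "lambda_e (ball 0 1) \<psi> \<le> ereal (g / m + 1)"
proof -
  let ?S = "ball (0::complex) 1"
  obtain K where sv: "smooth_on UNIV v" and K: "compact K" "K \<subseteq> ?S" and v0: "\<And>z. z \<notin> K \<Longrightarrow> v z = 0"
    using v by (auto simp: trial_def)
  define M where "M = mass v"
  have M: "0 < M" "m < M" using m by (auto simp: M_def)
  define c where "c = 1 / sqrt M"
  have c: "0 < c" "c\<^sup>2 = 1 / M" using M by (auto simp: c_def power_divide)
  define u where "u z = of_real c * v z" for z
  have su: "smooth_on UNIV u"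
    unfolding u_def[abs_def] by (intro smooth_on_mult smooth_on_const sv open_UNIV)
  have "support_on ?S u \<subseteq> K" using v0 by (auto simp: support_on_def u_def)
  then have "closure (support_on ?S u) \<subseteq> K"
    using K(1) by (intro closure_minimal compact_imp_closed)
  then have cl: "K \<inter> closure (support_on ?S u) = closure (support_on ?S u)" by blast
  have "compact (closure (support_on ?S u))"
    using compact_Int_closed[OF K(1) closed_closure, of "support_on ?S u"] unfolding cl .
  then have tu: "u \<in> test_functions ?S"
    using K(2) cl smooth_on_subset[OF su subset_UNIV] unfolding test_functions_def by blast
  have mu: "(cmod (u z))\<^sup>2 = c\<^sup>2 * (cmod (v z))\<^sup>2" for z
    by (simp add: u_def norm_mult power_mult_distrib)
  have "L2_norm_on ?S u = 1"
    unfolding L2_norm_on_def mu using M c by (simp add: M_def mass_def)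
  with tu have "lambda_e ?S \<psi> \<le> ereal ((LINT z:?S|lborel. (norm (gradient u z))\<^sup>2) + (LINT z:?S|lborel. laplacian \<psi> z * (cmod (u z))\<^sup>2))"
    unfolding lambda_e_def by (intro INF_lower) auto
  also have "(LINT z:?S|lborel. (norm (gradient u z))\<^sup>2) = c\<^sup>2 * dirichlet v"
  proof -
    have "(norm (gradient u z))\<^sup>2 = c\<^sup>2 * (norm (gradient v z))\<^sup>2" for z
    proof -
      have d: "(u has_derivative (\<lambda>h. of_real c * (Re h *\<^sub>R partial_x v z + Im h *\<^sub>R partial_y v z))) (at z)"
        unfolding u_def[abs_def] by (rule has_derivative_mult_right[OF smooth_on_has_partials[OF sv UNIV_I]])
      show ?thesis
        using partial_x_eq[OF d] partial_y_eq[OF d]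
        by (simp add: gradient_def norm_Pair norm_mult power_mult_distrib algebra_simps)
    qed
    then show ?thesis by (simp add: dirichlet_def)
  qed
  also have "(LINT z:?S|lborel. laplacian \<psi> z * (cmod (u z))\<^sup>2) = c\<^sup>2 * (LINT z:?S|lborel. laplacian \<psi> z * (cmod (v z))\<^sup>2)"
  proof -
    have eq: "laplacian \<psi> z * (cmod (u z))\<^sup>2 = c\<^sup>2 * (laplacian \<psi> z * (cmod (v z))\<^sup>2)" for z
      unfolding mu by (rule mult.left_commute)
    show ?thesis unfolding eq by (rule set_integral_mult_right)
  qed
  finally have "lambda_e ?S \<psi> \<le> ereal (c\<^sup>2 * dirichlet v + c\<^sup>2 * (LINT z:?S|lborel. laplacian \<psi> z * (cmod (v z))\<^sup>2))" .
  also have "\<dots> \<le> ereal (g / m + 1)"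
  proof -
    have "(LINT z:?S|lborel. laplacian \<psi> z * (cmod (v z))\<^sup>2) \<le> M"
      unfolding M_def mass_def
      by (rule set_integral_mono[OF trial_integrable(3)[OF v] trial_integrable(2)[OF v]])
        (use bd smooth_on_continuous[OF smooth_on_laplacian[OF open_ball \<psi>]] in auto)
    then have "c\<^sup>2 * (LINT z:?S|lborel. laplacian \<psi> z * (cmod (v z))\<^sup>2) \<le> c\<^sup>2 * M"
      using c(1) by (intro mult_left_mono) auto
    moreover have "c\<^sup>2 * M = 1" "c\<^sup>2 * dirichlet v = dirichlet v / M" using c(2) M by simp_all
    moreover have "0 \<le> dirichlet v"
      unfolding dirichlet_def set_lebesgue_integral_def by (intro integral_nonneg_AE) auto
    then have "dirichlet v / M \<le> g / m"
      using g m M by (intro frac_le) auto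
    ultimately show ?thesis by simp
  qed
  finally show ?thesis .
qed

section \<open>Lattices of blobs and their flux\<close>

lemma blob_translate: "blob r a z = blob r 0 (z - a)"
  by (simp add: blob_def sqdist_def)

lemma blob_eq_0: "0 < r \<Longrightarrow> r \<le> dist a z \<Longrightarrow> blob r a z = 0"
  using blob_pos[of r a z] blob_nonneg[of r a z] by linarith

text \<open>For \<open>i < 8 m\<close> these are the points of mesh \<open>1 / m\<close> in \<open>[-4, 4)\<close>. If \<open>|x| < 1\<close>, then the intervals of length \<open>1 / m\<close>
  that begin at the points \<open>x - grid m i\<close> tile an interval containing \<open>{-1..1}\<close>.\<close>

definition grid :: "nat \<Rightarrow> nat \<Rightarrow> real" where
  "grid m i = real i / real m - 4"

lemma integral_shift_Icc:
  fixes h :: "real \<Rightarrow> real"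
  shows "integral {0..\<epsilon>} (\<lambda>s. h (c + s)) = integral {c..c + \<epsilon>} h"
  using integral_shift_real_ivl[of "c" c "c + \<epsilon>" h] by (simp add: add.commute)

text \<open>The translated intervals are adjacent, and together they cover the support of \<open>h\<close>. Therefore the sum
  does not depend on \<open>x\<close>.\<close>

lemma tiling:
  fixes h :: "real \<Rightarrow> real"
  assumes h: "continuous_on UNIV h" "\<And>s. 1 \<le> \<bar>s\<bar> \<Longrightarrow> h s = 0" and m: "0 < m" and x: "\<bar>x\<bar> < 1"
  shows "(\<Sum>i<8 * m. integral {0..1 / real m} (\<lambda>s. h (x - grid m i + s))) = integral {-1..1} h"
proof -
  define \<epsilon> where "\<epsilon> = 1 / real m"
  have e: "0 < \<epsilon>" "\<epsilon> \<le> 1" using m by (auto simp: \<epsilon>_def)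
  define c where "c = x + 4 + \<epsilon>"
  have int: "h integrable_on {a..b}" for a b
    by (rule integrable_continuous_interval[OF continuous_on_subset[OF h(1) subset_UNIV]])
  have "(\<Sum>i<L. integral {c - (real i + 1) * \<epsilon>..c - real i * \<epsilon>} h) = integral {c - real L * \<epsilon>..c} h" for L
  proof (induction L)
    case (Suc L)
    have "integral {c - (real L + 1) * \<epsilon>..c - real L * \<epsilon>} h + integral {c - real L * \<epsilon>..c} h = integral {c - (real L + 1) * \<epsilon>..c} h"
      by (rule Henstock_Kurzweil_Integration.integral_combine[OF _ _ int]) (use e in \<open>auto simp: algebra_simps\<close>)
    then show ?case using Suc by (simp add: algebra_simps)
  qed simp
  moreover have "integral {0..1 / real m} (\<lambda>s. h (x - grid m i + s)) = integral {c - (real i + 1) * \<epsilon>..c - real i * \<epsilon>} h" for i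
    unfolding integral_shift_Icc by (simp add: grid_def c_def \<epsilon>_def algebra_simps add_divide_distrib)
  ultimately have "(\<Sum>i<8 * m. integral {0..1 / real m} (\<lambda>s. h (x - grid m i + s))) = integral {c - real (8 * m) * \<epsilon>..c} h"
    by simp
  also have "c - real (8 * m) * \<epsilon> = c - 8" using m by (simp add: \<epsilon>_def)
  also have "integral {c - 8..c} h = integral {-1..1} h"
  proof -
    have le: "c - 8 \<le> -1" "1 \<le> c" using x e by (auto simp: c_def)
    have "integral {c - 8..-1} h + integral {-1..c} h = integral {c - 8..c} h"
      by (rule Henstock_Kurzweil_Integration.integral_combine[OF _ _ int]) (use le in auto)
    moreover have "integral {-1..1} h + integral {1..c} h = integral {-1..c} h"
      by (rule Henstock_Kurzweil_Integration.integral_combine[OF _ _ int]) (use le in auto)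
    moreover have "integral {c - 8..-1} h = integral {c - 8..-1} (\<lambda>_. 0)"
      by (rule integral_cong) (use h(2) in auto)
    moreover have "integral {1..c} h = integral {1..c} (\<lambda>_. 0)"
      by (rule integral_cong) (use h(2) in auto)
    ultimately show ?thesis by simp
  qed
  finally show ?thesis .
qed

definition blob_mass :: "real \<Rightarrow> real" where
  "blob_mass r = integral {-1..1} (\<lambda>t. integral {-1..1} (\<lambda>s. blob r 0 (Complex s t)))"

lemma continuous_blob_section: "continuous_on UNIV (\<lambda>s. blob r 0 (Complex s t))"
proof -
  have "continuous_on UNIV (\<lambda>s. Complex s t)" unfolding Complex_eq by (intro continuous_intros)
  from continuous_on_compose2[OF smooth_on_continuous[OF smooth_blob] this] show ?thesis by simp
qed

lemma continuous_blob_section_integral: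
  "continuous_on UNIV (\<lambda>t. integral {-1..1} (\<lambda>s. blob r 0 (Complex s t)))"
proof -
  have c: "continuous_on (UNIV \<times> cbox (-1) 1) (\<lambda>x :: real \<times> real. Complex (snd x) (fst x))"
    unfolding Complex_eq by (intro continuous_intros)
  have "continuous_on (UNIV \<times> cbox (-1) 1) (\<lambda>x :: real \<times> real. blob r 0 (Complex (snd x) (fst x)))"
    using continuous_on_compose2[OF smooth_on_continuous[OF smooth_blob] c] by simp
  then have "continuous_on (UNIV \<times> cbox (-1) 1) (\<lambda>(t :: real, s :: real). blob r 0 (Complex s t))"
    by (simp add: case_prod_beta')
  from integral_continuous_on_param[OF this] show ?thesis by simp
qed

lemma integral_pos_continuous:
  fixes h :: "real \<Rightarrow> real"
  assumes h: "continuous_on UNIV h" "\<And>s. 0 \<le> h s" and s: "s \<in> {-1..1}" "0 < h s"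
  shows "0 < integral {-1..1} h"
proof -
  have c: "continuous_on {-1..1} h" using continuous_on_subset[OF h(1) subset_UNIV] .
  have "integral {-1..1} h \<noteq> 0"
    using integral_eq_0_iff[OF c] h(2) s by force
  moreover have "0 \<le> integral {-1..1} h" by (rule integral_nonneg_continuous[OF c h(2)])
  ultimately show ?thesis by linarith
qed

lemma blob_mass_pos:
  assumes "0 < r" "r \<le> 1" shows "0 < blob_mass r"
proof -
  have "0 < integral {-1..1} (\<lambda>s. blob r 0 (Complex s 0))"
  proof (rule integral_pos_continuous[OF continuous_blob_section blob_nonneg])
    show "3 * r / 4 \<in> {-1..1}" using assms by auto
    have "cmod (Complex (3 * r / 4) 0) = 3 * r / 4" using assms by (simp add: complex_norm)
    then show "0 < blob r 0 (Complex (3 * r / 4) 0)"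
      unfolding blob_pos[OF assms(1)] dist_norm using assms by (simp add: norm_minus_commute)
  qed
  then show ?thesis
    unfolding blob_mass_def
    by (intro integral_pos_continuous[OF continuous_blob_section_integral, of r 0])
      (auto intro!: integral_nonneg_continuous blob_nonneg continuous_on_subset[OF continuous_blob_section])
qed

definition lattice_density :: "nat \<Rightarrow> real \<Rightarrow> complex \<Rightarrow> real" where
  "lattice_density m r z = (\<Sum>p\<in>{..<8 * m} \<times> {..<8 * m}. blob r (Complex (grid m (fst p)) (grid m (snd p))) z)"

text \<open>Every square near the unit disk whose side is the mesh is a period cell, wherever its corner lies. So
  its flux is the mass of one blob, even if its boundary cuts through blobs. The tiling argument is used once
  in each coordinate.\<close>

lemma square_flux_lattice_density:
  assumes m: "0 < m" and r: "0 < r" "r \<le> 1" and z: "cmod z < 1"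
  shows "square_flux (lattice_density m r) z (1 / real m) = blob_mass r"
proof -
  let ?I = "{..<8 * m}"
  let ?\<epsilon> = "1 / real m"
  define H where "H t = integral {-1..1} (\<lambda>s. blob r 0 (Complex s t))" for t
  have xy: "\<bar>Re z\<bar> < 1" "\<bar>Im z\<bar> < 1"
    using z abs_Re_le_cmod[of z] abs_Im_le_cmod[of z] by auto
  have vanish: "blob r 0 (Complex s t) = 0" if "1 \<le> \<bar>s\<bar> \<or> 1 \<le> \<bar>t\<bar>" for s t
  proof (rule blob_eq_0[OF r(1)])
    show "r \<le> dist 0 (Complex s t)"
      using that r abs_Re_le_cmod[of "Complex s t"] abs_Im_le_cmod[of "Complex s t"] by auto
  qed
  have inner: "integral {0..?\<epsilon>} (\<lambda>s. lattice_density m r (z + Complex s t)) = (\<Sum>j\<in>?I. H (Im z - grid m j + t))" for t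
  proof -
    have "lattice_density m r (z + Complex s t) = (\<Sum>j\<in>?I. \<Sum>i\<in>?I. blob r 0 (Complex (Re z - grid m i + s) (Im z - grid m j + t)))" for s
    proof -
      have "z + Complex s t - Complex (grid m i) (grid m j) = Complex (Re z - grid m i + s) (Im z - grid m j + t)" for i j
        by (simp add: complex_eq_iff)
      then have "lattice_density m r (z + Complex s t) = (\<Sum>(i, j)\<in>?I \<times> ?I. blob r 0 (Complex (Re z - grid m i + s) (Im z - grid m j + t)))"
        unfolding lattice_density_def by (subst blob_translate) (simp add: case_prod_beta')
      also have "\<dots> = (\<Sum>i\<in>?I. \<Sum>j\<in>?I. blob r 0 (Complex (Re z - grid m i + s) (Im z - grid m j + t)))"
        by (simp add: sum.cartesian_product)
      also have "\<dots> = (\<Sum>j\<in>?I. \<Sum>i\<in>?I. blob r 0 (Complex (Re z - grid m i + s) (Im z - grid m j + t)))"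
        by (rule sum.swap)
      finally show ?thesis .
    qed
    then have "integral {0..?\<epsilon>} (\<lambda>s. lattice_density m r (z + Complex s t))
        = integral {0..?\<epsilon>} (\<lambda>s. \<Sum>j\<in>?I. \<Sum>i\<in>?I. blob r 0 (Complex (Re z - grid m i + s) (Im z - grid m j + t)))"
      by simp
    also have "\<dots> = (\<Sum>j\<in>?I. \<Sum>i\<in>?I. integral {0..?\<epsilon>} (\<lambda>s. blob r 0 (Complex (Re z - grid m i + s) (Im z - grid m j + t))))"
    proof -
      have int: "(\<lambda>s. blob r 0 (Complex (Re z - grid m i + s) (Im z - grid m j + t))) integrable_on {0..?\<epsilon>}" for i j
      proof (rule integrable_continuous_interval)
        have "continuous_on {0..?\<epsilon>} (\<lambda>s. Re z - grid m i + s)" by (intro continuous_intros)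
        from continuous_on_compose2[OF continuous_blob_section this]
        show "continuous_on {0..?\<epsilon>} (\<lambda>s. blob r 0 (Complex (Re z - grid m i + s) (Im z - grid m j + t)))" by simp
      qed
      show ?thesis
        by (subst integral_sum) (auto intro!: integrable_sum int sum.cong integral_sum)
    qed
    also have "\<dots> = (\<Sum>j\<in>?I. H (Im z - grid m j + t))"
      unfolding H_def
      by (intro sum.cong refl tiling[OF continuous_blob_section _ m xy(1)]) (use vanish in auto)
    finally show ?thesis .
  qed
  have cH: "continuous_on UNIV H" unfolding H_def[abs_def] by (rule continuous_blob_section_integral)
  have "square_flux (lattice_density m r) z ?\<epsilon> = integral {0..?\<epsilon>} (\<lambda>t. \<Sum>j\<in>?I. H (Im z - grid m j + t))"
    unfolding square_flux_def inner ..
  also have "\<dots> = (\<Sum>j\<in>?I. integral {0..?\<epsilon>} (\<lambda>t. H (Im z - grid m j + t)))"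
  proof (rule integral_sum)
    fix j
    have "continuous_on {0..?\<epsilon>} (\<lambda>s. Im z - grid m j + s)" by (intro continuous_intros)
    from continuous_on_compose2[OF cH this]
    show "(\<lambda>t. H (Im z - grid m j + t)) integrable_on {0..?\<epsilon>}"
      by (intro integrable_continuous_interval) simp
  qed simp
  also have "\<dots> = integral {-1..1} H"
    by (rule tiling[OF cH _ m xy(2)]) (use vanish in \<open>simp add: H_def\<close>)
  finally show ?thesis by (simp add: blob_mass_def H_def[abs_def])
qed

text \<open>The condition makes the part of the \<open>\<delta>\<close>-neighbourhood of \<open>P\<close> that lies outside \<open>P\<close> shrink to a null set
  as \<open>\<delta>\<close> tends to \<open>0\<close>.\<close>

definition tame :: "complex set \<Rightarrow> bool" where
  "tame P \<longleftrightarrow> open P \<and> closure P - P \<in> null_sets lborel"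

lemma tame_Un: assumes "tame P" "tame Q" shows "tame (P \<union> Q)"
proof -
  have "(closure P - P) \<union> (closure Q - Q) \<in> null_sets lborel"
    using assms by (intro null_sets.Un) (auto simp: tame_def)
  moreover have "closure (P \<union> Q) - (P \<union> Q) \<subseteq> (closure P - P) \<union> (closure Q - Q)" by auto
  moreover have "closure (P \<union> Q) - (P \<union> Q) \<in> sets lborel"
    using assms by (simp add: tame_def open_Un)
  ultimately show ?thesis
    using assms unfolding tame_def by (auto intro: null_sets_subset)
qed

lemma tame_empty: "tame {}"
  by (simp add: tame_def)

lemma tame_UN: "finite I \<Longrightarrow> (\<And>i. i \<in> I \<Longrightarrow> tame (P i)) \<Longrightarrow> tame (\<Union>i\<in>I. P i)"
  by (induction I rule: finite_induct) (auto intro: tame_Un tame_empty)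

lemma null_sphere: "sphere (a::complex) r \<in> null_sets lborel"
proof -
  have "sphere a r \<in> null_sets lebesgue"
    using negligible_sphere by (simp add: negligible_iff_null_sets)
  then show ?thesis by (simp add: null_sets_completion_iff)
qed

lemma tame_blob: assumes "0 < r" shows "tame {z. 0 < blob r a z}"
proof -
  let ?P = "{z. 0 < blob r a z}"
  have P: "?P = ball a r \<inter> - cball a (r / 2)"
    unfolding blob_pos[OF assms] by auto
  have op: "open ?P" unfolding P by (intro open_Int open_ball open_Compl closed_cball)
  have "closure ?P \<subseteq> {z. r / 2 \<le> dist a z} \<inter> cball a r"
  proof (rule closure_minimal)
    show "closed ({z. r / 2 \<le> dist a z} \<inter> cball a r)"
      by (intro closed_Int closed_cball closed_Collect_le continuous_intros)
  qed (auto simp: P)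
  then have "closure ?P - ?P \<subseteq> sphere a (r / 2) \<union> sphere a r"
    by (auto simp: P)
  moreover have "sphere a (r / 2) \<union> sphere a r \<in> null_sets lborel"
    by (intro null_sets.Un null_sphere)
  moreover have "closure ?P - ?P \<in> sets lborel" using op by simp
  ultimately show ?thesis using op unfolding tame_def by (auto intro: null_sets_subset)
qed

lemma lattice_density_pos: "{z. 0 < lattice_density m r z} = (\<Union>p\<in>{..<8 * m} \<times> {..<8 * m}. {z. 0 < blob r (Complex (grid m (fst p)) (grid m (snd p))) z})"
proof -
  have "0 < lattice_density m r z \<longleftrightarrow> (\<exists>p\<in>{..<8 * m} \<times> {..<8 * m}. 0 < blob r (Complex (grid m (fst p)) (grid m (snd p))) z)" for z
  proof -
    have nz: "lattice_density m r z = 0 \<longleftrightarrow> (\<forall>p\<in>{..<8 * m} \<times> {..<8 * m}. blob r (Complex (grid m (fst p)) (grid m (snd p))) z = 0)"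
      unfolding lattice_density_def by (rule sum_nonneg_eq_0_iff) (auto simp: blob_nonneg)
    have "0 \<le> lattice_density m r z"
      unfolding lattice_density_def by (intro sum_nonneg blob_nonneg)
    then have "0 < lattice_density m r z \<longleftrightarrow> lattice_density m r z \<noteq> 0" by auto
    also have "\<dots> \<longleftrightarrow> (\<exists>p\<in>{..<8 * m} \<times> {..<8 * m}. 0 < blob r (Complex (grid m (fst p)) (grid m (snd p))) z)"
      unfolding nz using blob_nonneg by (metis less_eq_real_def less_irrefl)
    finally show ?thesis .
  qed
  then show ?thesis unfolding set_eq_iff UN_iff mem_Collect_eq by blast
qed

lemma tame_lattice_density: "0 < r \<Longrightarrow> tame {z. 0 < lattice_density m r z}"
  unfolding lattice_density_pos by (intro tame_UN tame_blob) auto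

lemma square_flux_mono:
  assumes z: "cmod z < 1" and e: "0 < \<epsilon>" "\<epsilon> \<le> 1"
    and f: "continuous_on (ball 0 4) f" and g: "continuous_on (ball 0 4) g"
    and le: "\<And>s t. s \<in> {0..\<epsilon>} \<Longrightarrow> t \<in> {0..\<epsilon>} \<Longrightarrow> f (z + Complex s t) \<le> g (z + Complex s t)"
  shows "square_flux f z \<epsilon> \<le> square_flux g z \<epsilon>"
  unfolding square_flux_def
  by (intro integral_le integrable_on_square(1)[OF _ z e] integrable_on_square(3)[OF _ z e] f g le)

lemma square_flux_affine:
  assumes z: "cmod z < 1" and m: "0 < m" and r: "0 < r" "r \<le> 1"
  shows "square_flux (\<lambda>w. a * lattice_density m r w + b) z (1 / real m) = a * blob_mass r + b / (real m)\<^sup>2"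
proof -
  let ?\<epsilon> = "1 / real m" and ?L = "\<lambda>s t. lattice_density m r (z + Complex s t)"
  have "smooth_on UNIV (lattice_density m r)"
    unfolding lattice_density_def[abs_def] by (intro smooth_on_sum smooth_blob open_UNIV)
  then have c: "continuous_on (ball 0 4) (lattice_density m r)"
    using smooth_on_continuous continuous_on_subset subset_UNIV by blast
  have e: "0 < ?\<epsilon>" "?\<epsilon> \<le> 1" using m by auto
  note int = integrable_on_square[OF c z e]
  have "integral {0..?\<epsilon>} (\<lambda>s. a * ?L s t + b) = a * integral {0..?\<epsilon>} (\<lambda>s. ?L s t) + b * ?\<epsilon>" if t: "t \<in> {0..?\<epsilon>}" for t
  proof (rule integral_unique)
    show "((\<lambda>s. a * ?L s t + b) has_integral a * integral {0..?\<epsilon>} (\<lambda>s. ?L s t) + b * ?\<epsilon>) {0..?\<epsilon>}"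
      by (intro has_integral_add has_integral_mult_right integrable_integral int(1)[OF t])
        (use has_integral_const_real[of b 0 ?\<epsilon>] e in \<open>simp add: mult.commute\<close>)
  qed
  then have "square_flux (\<lambda>w. a * lattice_density m r w + b) z ?\<epsilon>
      = integral {0..?\<epsilon>} (\<lambda>t. a * integral {0..?\<epsilon>} (\<lambda>s. ?L s t) + b * ?\<epsilon>)"
    unfolding square_flux_def by (intro integral_cong)
  also have "\<dots> = a * square_flux (lattice_density m r) z ?\<epsilon> + b * ?\<epsilon> * ?\<epsilon>"
  proof (rule integral_unique)
    show "((\<lambda>t. a * integral {0..?\<epsilon>} (\<lambda>s. ?L s t) + b * ?\<epsilon>) has_integral
        a * square_flux (lattice_density m r) z ?\<epsilon> + b * ?\<epsilon> * ?\<epsilon>) {0..?\<epsilon>}"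
      unfolding square_flux_def
      by (intro has_integral_add has_integral_mult_right integrable_integral int(3))
        (use has_integral_const_real[of "b * ?\<epsilon>" 0 ?\<epsilon>] e in \<open>simp_all add: mult.commute\<close>)
  qed
  finally show ?thesis
    using square_flux_lattice_density[OF m r z] by (simp add: power2_eq_square)
qed

section \<open>One stage of the construction\<close>

lemma eventually_small_measure:
  fixes A :: "nat \<Rightarrow> complex set"
  assumes A: "\<And>i. A i \<in> sets borel" "decseq A" "\<And>i. A i \<subseteq> ball 0 1" and null: "(\<Inter>i. A i) \<in> null_sets lborel" and \<delta>: "0 < \<delta>"
  shows "\<exists>N. \<forall>i\<ge>N. emeasure lborel (A i) \<le> ennreal \<delta>"
proof -
  have le: "emeasure lborel (A i) \<le> emeasure lborel (ball (0::complex) 1)" for i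
    using A by (intro emeasure_mono) auto
  have fin: "emeasure lborel (A i) \<noteq> \<infinity>" for i
  proof -
    have "emeasure lborel (A i) \<le> ennreal (4 * 1\<^sup>2)"
      by (rule order_trans[OF le emeasure_ball_le]) simp
    also have "\<dots> < \<infinity>" by (rule ennreal_less_top[folded infinity_ennreal_def])
    finally show ?thesis by simp
  qed
  have "(\<lambda>i. emeasure lborel (A i)) \<longlonglongrightarrow> emeasure lborel (\<Inter>i. A i)"
    using A fin by (intro Lim_emeasure_decseq) auto
  then have "(\<lambda>i. emeasure lborel (A i)) \<longlonglongrightarrow> 0"
    using null by (simp add: null_sets_def)
  then have "\<forall>\<^sub>F i in sequentially. emeasure lborel (A i) < ennreal \<delta>"
    by (rule order_tendstoD(2)) (use \<delta> in simp)
  then obtain N where "\<forall>i\<ge>N. emeasure lborel (A i) < ennreal \<delta>"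
    unfolding eventually_sequentially ..
  then show ?thesis by (intro exI[of _ N]) (simp add: less_imp_le)
qed

lemma tube_small:
  assumes P: "tame P" and \<delta>: "0 < \<delta>"
  shows "\<exists>N. \<forall>i\<ge>N. emeasure lborel (ball 0 1 \<inter> (\<Union>w\<in>P. ball w (3 / real (Suc i))) - P) \<le> ennreal \<delta>"
proof (rule eventually_small_measure[OF _ _ _ _ \<delta>])
  let ?A = "\<lambda>i. ball 0 1 \<inter> (\<Union>w\<in>P. ball w (3 / real (Suc i))) - P"
  have op: "open P" using P by (simp add: tame_def)
  show meas: "?A i \<in> sets borel" for i
    using op by (intro sets.Diff borel_open open_Int open_UN ballI open_ball) auto
  show "decseq ?A"
  proof (rule decseq_SucI)
    fix i
    have "3 / real (Suc (Suc i)) \<le> 3 / real (Suc i)" by (intro divide_left_mono) auto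
    then have "ball w (3 / real (Suc (Suc i))) \<subseteq> ball w (3 / real (Suc i))" for w :: complex
      by (intro subset_ball)
    then show "?A (Suc i) \<subseteq> ?A i" by blast
  qed
  have "(\<Inter>i. ?A i) \<subseteq> closure P - P"
  proof
    fix z assume z: "z \<in> (\<Inter>i. ?A i)"
    have "z \<in> closure P"
      unfolding closure_approachable
    proof (intro allI impI)
      fix e :: real assume "0 < e"
      then obtain i where "3 / e < real i" using reals_Archimedean2 by blast
      then have i: "3 / real (Suc i) < e" using \<open>0 < e\<close> by (simp add: field_simps)
      obtain w where "w \<in> P" "dist w z < 3 / real (Suc i)" using z by auto
      then show "\<exists>w\<in>P. dist w z < e" using i by (intro bexI[of _ w]) auto
    qed
    then show "z \<in> closure P - P" using z by auto
  qed
  moreover have "(\<Inter>i. ?A i) \<in> sets lborel" using meas by (intro sets.countable_INT') auto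
  ultimately show "(\<Inter>i. ?A i) \<in> null_sets lborel"
    using P null_sets_subset[of "closure P - P" lborel "\<Inter>i. ?A i"] unfolding tame_def by simp
qed auto

lemma sublevel_small:
  fixes \<beta> :: "complex \<Rightarrow> real"
  assumes \<beta>: "continuous_on UNIV \<beta>" and c: "0 < c" and \<delta>: "0 < \<delta>"
  shows "\<exists>N. \<forall>i\<ge>N. emeasure lborel {z \<in> ball 0 1. 0 < \<beta> z \<and> \<beta> z < c / real (Suc i)} \<le> ennreal \<delta>"
proof (rule eventually_small_measure[OF _ _ _ _ \<delta>])
  have [measurable]: "\<beta> \<in> borel_measurable borel" by (rule borel_measurable_continuous_onI[OF \<beta>])
  let ?A = "\<lambda>i. {z \<in> ball 0 1. 0 < \<beta> z \<and> \<beta> z < c / real (Suc i)}"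
  show "?A i \<in> sets borel" for i by measurable
  show "decseq ?A"
  proof (rule decseq_SucI)
    fix i
    have "c / real (Suc (Suc i)) \<le> c / real (Suc i)" using c by (intro divide_left_mono) auto
    then show "?A (Suc i) \<subseteq> ?A i" by force
  qed
  have "(\<Inter>i. ?A i) = {}"
  proof (rule equals0I)
    fix z assume z: "z \<in> (\<Inter>i. ?A i)"
    then have pos: "0 < \<beta> z" by auto
    obtain i where "c / \<beta> z < real i" using reals_Archimedean2 by blast
    then have "c / real (Suc i) < \<beta> z" using pos c by (simp add: field_simps)
    moreover have "\<beta> z < c / real (Suc i)" using z by auto
    ultimately show False by simp
  qed
  then show "(\<Inter>i. ?A i) \<in> null_sets lborel" by simp
qed auto

lemma cos_nonpos_beyond_pi:
  assumes "pi \<le> x" "x \<le> pi + 1" shows "cos x \<le> 0"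
proof -
  have "0 \<le> cos (x - pi)"
    using assms pi_ge_two by (intro cos_ge_zero) auto
  then show ?thesis by (simp add: cos_diff)
qed

text \<open>The density \<open>\<beta>\<close> is the sum of the Laplacians chosen so far. The choices are made in this order.
  First the mesh \<open>\<epsilon>\<close>: it makes the flux argument strong enough, and only few points of the unit disk outside
  \<open>{z. 0 < \<beta> z}\<close> have an \<open>\<epsilon>\<close>-square that meets this set. Then the radius \<open>r\<close> of the blobs: the capacity of the
  lattice points allows a trial function that vanishes on all blobs. Finally the number \<open>n\<close>: it makes \<open>n \<beta>\<close> large
  on all of \<open>{z. 0 < \<beta> z}\<close> except for a set of small measure. The strength of the blobs is adjusted so that
  \<open>n\<close> times the new Laplacian has flux exactly \<open>\<pi>\<close> through each \<open>\<epsilon>\<close>-square; as it is of order \<open>1 / n\<close>, a large \<open>n\<close> makes the new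
  potential as small as desired in any \<open>C\<^sup>k\<close> norm.

  The last conclusion is formulated for all potentials \<open>\<psi>\<close> with approximately the right Laplacian, because it
  has to survive the addition of all later stages.\<close>

lemma next_stage:
  fixes \<beta> :: "complex \<Rightarrow> real" and k :: nat
  assumes \<beta>: "continuous_on UNIV \<beta>" "\<And>z. 0 \<le> \<beta> z" "tame {z. 0 < \<beta> z}"
    and v: "trial v" "\<And>z. v z \<noteq> 0 \<Longrightarrow> \<beta> z = 0" "dirichlet v < g" "\<mu> < mass v" and d: "0 < d"
  obtains \<phi> v' d' n where "smooth_on UNIV \<phi>" "\<And>z. 0 \<le> laplacian \<phi> z" "tame {z. 0 < \<beta> z + laplacian \<phi> z}"
    "\<And>l z. length l \<le> k + 2 \<Longrightarrow> z \<in> ball 0 4 \<Longrightarrow> \<bar>partials l \<phi> z\<bar> \<le> d / 4"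
    "trial v'" "\<And>z. v' z \<noteq> 0 \<Longrightarrow> \<beta> z + laplacian \<phi> z = 0" "dirichlet v' < g" "\<mu> < mass v'"
    "0 < d'" "d' \<le> d / 2" "k \<le> n"
    "\<And>\<psi>. smooth_on (ball 0 4) \<psi> \<Longrightarrow>
      (\<And>z. z \<in> ball 0 4 \<Longrightarrow> \<beta> z + laplacian \<phi> z \<le> laplacian \<psi> z \<and> laplacian \<psi> z \<le> \<beta> z + laplacian \<phi> z + d') \<Longrightarrow>
      ereal (real k) \<le> lambda_m (ball 0 1) (\<lambda>z. real n * \<psi> z)"
proof -
  define P where "P = {z. 0 < \<beta> z}"
  define \<kappa> where "\<kappa> = 1 / (16 * (1 + real k)\<^sup>2)"
  have \<kappa>: "0 < \<kappa> / 2" by (simp add: \<kappa>_def)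
  \<comment> \<open>The mesh depends only on \<open>\<beta>\<close> and \<open>k\<close>. The tube has radius \<open>3 \<epsilon>\<close>, more than the diameter of a square.\<close>
  obtain N1 where N1: "\<And>i. N1 \<le> i \<Longrightarrow> emeasure lborel (ball 0 1 \<inter> (\<Union>w\<in>P. ball w (3 / real (Suc i))) - P) \<le> ennreal (\<kappa> / 2)"
    using tube_small[OF \<beta>(3) \<kappa>] unfolding P_def by blast
  define m where "m = Suc (max N1 (16 * k))"
  define \<epsilon> where "\<epsilon> = 1 / real m"
  have m: "0 < m" by (simp add: m_def)
  have e: "0 < \<epsilon>" "\<epsilon> \<le> 1" by (auto simp: \<epsilon>_def m_def)
  have tube: "emeasure lborel (ball 0 1 \<inter> (\<Union>w\<in>P. ball w (3 * \<epsilon>)) - P) \<le> ennreal (\<kappa> / 2)"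
    using N1[of "max N1 (16 * k)"] by (simp add: \<epsilon>_def m_def)
  have ek: "16 * \<epsilon>\<^sup>2 * real k \<le> 1"
  proof -
    have "16 * real k \<le> real m" by (simp add: m_def)
    also have "\<dots> \<le> (real m)\<^sup>2" using m by (simp add: power2_eq_square)
    finally show ?thesis using m by (simp add: \<epsilon>_def field_simps)
  qed
  \<comment> \<open>The radius depends on the number of lattice points, which is fixed by now.\<close>
  define I where "I = {..<8 * m} \<times> {..<8 * m}"
  define a where "a p = Complex (grid m (fst p)) (grid m (snd p))" for p
  have finI: "finite I" by (simp add: I_def)
  obtain v' r0 where v': "trial v'" "0 < r0" "\<And>b z. b \<in> a ` I \<Longrightarrow> z \<in> ball b r0 \<Longrightarrow> v' z = 0"
    "\<And>z. v z = 0 \<Longrightarrow> v' z = 0" "dirichlet v' < g" "\<mu> < mass v'"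
    using trial_remove_points[OF finite_imageI[OF finI, of a] v(1,3,4)] by blast
  define r where "r = min r0 1"
  have r: "0 < r" "r \<le> 1" "r \<le> r0" using v'(2) by (auto simp: r_def)
  define F where "F z = (\<Sum>p\<in>I. blob_potential r (a p) z)" for z
  have smF: "smooth_on UNIV F"
    unfolding F_def[abs_def] by (intro smooth_on_sum smooth_blob_potential open_UNIV)
  have lapF: "laplacian F z = lattice_density m r z" for z
    unfolding F_def[abs_def] lattice_density_def a_def I_def
    by (subst laplacian_sum[OF open_UNIV]) (auto simp: smooth_blob_potential laplacian_blob_potential)
  obtain M where M: "0 < M" "\<And>l z. length l \<le> k + 2 \<Longrightarrow> z \<in> cball 0 4 \<Longrightarrow> \<bar>partials l F z\<bar> \<le> M"
  proof -
    from partials_bounded[OF smF compact_cball[of 0 4], of "k + 2"] obtain M where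
      M: "0 < M" "\<forall>l. length l \<le> k + 2 \<longrightarrow> (\<forall>z\<in>cball 0 4. \<bar>partials l F z\<bar> \<le> M)" by (elim exE conjE)
    show ?thesis by (rule that[OF M(1)]) (rule M(2)[rule_format])
  qed
  define C where "C = blob_mass r"
  have C: "0 < C" unfolding C_def by (rule blob_mass_pos[OF r(1,2)])
  \<comment> \<open>Nothing chosen so far depends on \<open>n\<close>. The third bound serves the smallness of the new potential.\<close>
  obtain N2 where N2: "\<And>i. N2 \<le> i \<Longrightarrow> emeasure lborel {z \<in> ball 0 1. 0 < \<beta> z \<and> \<beta> z < (4 * real k + 1) / real (Suc i)} \<le> ennreal (\<kappa> / 2)"
  proof -
    have "0 < 4 * real k + 1" by simp
    from sublevel_small[OF \<beta>(1) this \<kappa>] show ?thesis using that by blast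
  qed
  obtain N3 :: nat where N3: "4 * pi * M / (C * d) < real N3" using reals_Archimedean2 by blast
  define n where "n = Suc (max k (max N2 N3))"
  have n: "0 < n" "k \<le> n" by (auto simp: n_def)
  have sub: "emeasure lborel {z \<in> ball 0 1. 0 < \<beta> z \<and> \<beta> z < (4 * real k + 1) / real n} \<le> ennreal (\<kappa> / 2)"
    using N2[of "max k (max N2 N3)"] by (simp add: n_def)
  define c where "c = pi / (real n * C)"
  have c: "0 < c" using n C by (simp add: c_def)
  have cM: "c * M \<le> d / 4"
  proof -
    have "4 * pi * M / (C * d) \<le> real n" using N3 by (simp add: n_def)
    then have "4 * pi * M \<le> real n * (C * d)" using C d by (simp add: pos_divide_le_eq)
    then show ?thesis using n C by (simp add: c_def field_simps)
  qed
  define \<phi> where "\<phi> z = c * F z" for z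
  have sm: "smooth_on UNIV \<phi>"
    unfolding \<phi>_def[abs_def] by (intro smooth_on_mult smooth_on_const smF open_UNIV)
  have lap: "laplacian \<phi> z = c * lattice_density m r z" for z
    unfolding \<phi>_def[abs_def] using laplacian_cmult[OF open_UNIV smF UNIV_I] lapF by simp
  have ld_nonneg: "0 \<le> lattice_density m r z" for z
    unfolding lattice_density_def by (intro sum_nonneg blob_nonneg)
  have lap_nonneg: "0 \<le> laplacian \<phi> z" for z
    unfolding lap using c ld_nonneg by simp
  have ld_pos: "0 < \<beta> z + laplacian \<phi> z \<longleftrightarrow> 0 < \<beta> z \<or> 0 < lattice_density m r z" for z
  proof -
    have "0 < b + x \<longleftrightarrow> 0 < b \<or> 0 < x" if "0 \<le> b" "0 \<le> x" for b x :: real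
      using that by (cases "b = 0"; cases "x = 0") auto
    then have "0 < \<beta> z + laplacian \<phi> z \<longleftrightarrow> 0 < \<beta> z \<or> 0 < laplacian \<phi> z"
      using \<beta>(2) lap_nonneg by blast
    then show ?thesis unfolding lap using c by (simp add: zero_less_mult_iff)
  qed
  have thin: "tame {z. 0 < \<beta> z + laplacian \<phi> z}"
    unfolding ld_pos Collect_disj_eq by (rule tame_Un[OF \<beta>(3) tame_lattice_density[OF r(1)]])
  have part: "\<bar>partials l \<phi> z\<bar> \<le> d / 4" if l: "length l \<le> k + 2" and z: "z \<in> ball 0 4" for l z
  proof -
    have "z \<in> cball 0 4" using z by simp
    then have "c * \<bar>partials l F z\<bar> \<le> c * M" using M(2)[OF l] c by (intro mult_left_mono) auto
    moreover have "\<bar>partials l \<phi> z\<bar> = c * \<bar>partials l F z\<bar>"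
      unfolding \<phi>_def[abs_def] using partials_cmult[OF open_UNIV smF UNIV_I] c by (simp add: abs_mult)
    ultimately show ?thesis using cM by linarith
  qed
  have v'0: "\<beta> z + laplacian \<phi> z = 0" if "v' z \<noteq> 0" for z
  proof -
    have "v z \<noteq> 0" using that v'(4) by blast
    then have "\<beta> z = 0" by (rule v(2))
    moreover have "blob r (a p) z = 0" if p: "p \<in> I" for p
    proof (rule blob_eq_0[OF r(1)])
      have "z \<notin> ball (a p) r0" using v'(3)[of "a p" z] p \<open>v' z \<noteq> 0\<close> by auto
      then show "r \<le> dist (a p) z" using r(3) by simp
    qed
    then have "lattice_density m r z = 0"
      unfolding lattice_density_def a_def I_def by (intro sum.neutral) auto
    ultimately show ?thesis by (simp add: lap)
  qed
  define d' where "d' = min (d / 2) (1 / real n)"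
  have d': "0 < d'" "d' \<le> d / 2" "real n * d' \<le> 1"
  proof -
    show "0 < d'" "d' \<le> d / 2" using d n by (auto simp: d'_def)
    have "real n * d' \<le> real n * (1 / real n)" by (intro mult_left_mono) (auto simp: d'_def)
    then show "real n * d' \<le> 1" using n by simp
  qed
  have large: "ereal (real k) \<le> lambda_m (ball 0 1) (\<lambda>z. real n * \<psi> z)"
    if \<psi>: "smooth_on (ball 0 4) \<psi>"
      and B: "\<And>z. z \<in> ball 0 4 \<Longrightarrow> \<beta> z + laplacian \<phi> z \<le> laplacian \<psi> z \<and> laplacian \<psi> z \<le> \<beta> z + laplacian \<phi> z + d'" for \<psi>
  proof -
    \<comment> \<open>squares with corner in \<open>G\<close> miss \<open>P\<close>; on \<open>H\<close> the old density, multiplied by \<open>n\<close>, is large\<close>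
    define T where "T = (\<Union>w\<in>P. ball w (3 * \<epsilon>))"
    define G where "G = - T"
    define H where "H = {z. 4 * real k + 1 \<le> real n * \<beta> z}"
    define R where "R = ball 0 1 \<inter> T - H"
    have [measurable]: "\<beta> \<in> borel_measurable borel" by (rule borel_measurable_continuous_onI[OF \<beta>(1)])
    have oT: "open T" unfolding T_def by (intro open_UN ballI open_ball)
    have oP: "open P" using \<beta>(3) by (simp add: tame_def P_def)
    have meas: "G \<in> sets borel" "H \<in> sets borel" "R \<in> sets borel"
      unfolding G_def R_def H_def using oT by (auto intro!: borel_open borel_closed)
    have lap\<psi>: "laplacian (\<lambda>z. real n * \<psi> z) z = real n * laplacian \<psi> z" if "z \<in> ball 0 4" for z
      by (rule laplacian_cmult[OF open_ball \<psi> that])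
    have sub4: "z \<in> ball 0 4" if "z \<in> ball 0 1" for z :: complex using that by simp
    have sm\<psi>: "smooth_on (ball 0 4) (\<lambda>z. real n * \<psi> z)"
      by (intro smooth_on_mult smooth_on_const \<psi> open_ball)
    show ?thesis
    proof (rule lambda_m_ge[OF sm\<psi> _ _ e ek meas])
      fix z :: complex assume "z \<in> ball 0 1"
      note z4 = sub4[OF this]
      have "0 \<le> laplacian \<psi> z" using B[OF z4] \<beta>(2)[of z] lap_nonneg[of z] by linarith
      then show "0 \<le> laplacian (\<lambda>z. real n * \<psi> z) z" unfolding lap\<psi>[OF z4] by simp
    next
      show "ball 0 1 \<subseteq> G \<union> H \<union> R" by (auto simp: G_def R_def)
    next
      fix z assume z: "z \<in> H \<inter> ball 0 1"
      then have z4: "z \<in> ball 0 4" by auto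
      have "\<beta> z \<le> laplacian \<psi> z" using B[OF z4] lap_nonneg[of z] by linarith
      then have "real n * \<beta> z \<le> real n * laplacian \<psi> z" by (intro mult_left_mono) auto
      then show "4 * real k + 1 \<le> laplacian (\<lambda>z. real n * \<psi> z) z"
        using z unfolding lap\<psi>[OF z4] H_def by simp
    next
      fix z assume zG: "z \<in> G \<inter> ball 0 1"
      then have z: "cmod z < 1" by simp
      have inB: "z + Complex s t \<in> ball 0 4" if "s \<in> {0..\<epsilon>}" "t \<in> {0..\<epsilon>}" for s t
        using square_in_ball[OF z, of s t] that e by (auto simp del: mem_ball)
      have \<beta>0: "\<beta> (z + Complex s t) = 0" if st: "s \<in> {0..\<epsilon>}" "t \<in> {0..\<epsilon>}" for s t
      proof (rule ccontr)
        assume "\<beta> (z + Complex s t) \<noteq> 0"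
        then have "z + Complex s t \<in> P" using \<beta>(2)[of "z + Complex s t"] by (simp add: P_def)
        moreover have "dist (z + Complex s t) z < 3 * \<epsilon>"
          using cmod_le[of "Complex s t"] st e by (simp add: dist_norm)
        ultimately have "z \<in> T" unfolding T_def by auto
        then show False using zG by (simp add: G_def)
      qed
      have cont: "continuous_on (ball 0 4) (laplacian (\<lambda>z. real n * \<psi> z))"
        by (rule smooth_on_continuous[OF smooth_on_laplacian[OF open_ball sm\<psi>]])
      have contl: "continuous_on (ball 0 4) (\<lambda>w. real n * c * lattice_density m r w + b)" for b
      proof -
        have "continuous_on UNIV (laplacian F)"
          by (rule smooth_on_continuous[OF smooth_on_laplacian[OF open_UNIV smF]])
        then have "continuous_on (ball 0 4) (lattice_density m r)"
          unfolding lapF[abs_def] by (rule continuous_on_subset) simp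
        then show ?thesis by (intro continuous_on_add continuous_on_mult continuous_on_const)
      qed
      have ncC: "real n * c * blob_mass r = pi" using n C by (simp add: c_def C_def)
      have "square_flux (\<lambda>w. real n * c * lattice_density m r w + 0) z \<epsilon> \<le> square_flux (laplacian (\<lambda>z. real n * \<psi> z)) z \<epsilon>"
      proof (rule square_flux_mono[OF z e contl cont])
        fix s t assume st: "s \<in> {0..\<epsilon>}" "t \<in> {0..\<epsilon>}"
        have "real n * laplacian \<phi> (z + Complex s t) \<le> real n * laplacian \<psi> (z + Complex s t)"
          using B[OF inB[OF st]] \<beta>0[OF st] by (intro mult_left_mono) auto
        then show "real n * c * lattice_density m r (z + Complex s t) + 0 \<le> laplacian (\<lambda>z. real n * \<psi> z) (z + Complex s t)"
          unfolding lap\<psi>[OF inB[OF st]] lap by (simp add: mult.assoc)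
      qed
      then have lower: "pi \<le> square_flux (laplacian (\<lambda>z. real n * \<psi> z)) z \<epsilon>"
        using square_flux_affine[OF z m r(1,2), of "real n * c" 0] ncC by (simp add: \<epsilon>_def)
      have "square_flux (laplacian (\<lambda>z. real n * \<psi> z)) z \<epsilon> \<le> square_flux (\<lambda>w. real n * c * lattice_density m r w + 1) z \<epsilon>"
      proof (rule square_flux_mono[OF z e cont contl])
        fix s t assume st: "s \<in> {0..\<epsilon>}" "t \<in> {0..\<epsilon>}"
        have "real n * laplacian \<psi> (z + Complex s t) \<le> real n * (laplacian \<phi> (z + Complex s t) + d')"
          using B[OF inB[OF st]] \<beta>0[OF st] by (intro mult_left_mono) auto
        then show "laplacian (\<lambda>z. real n * \<psi> z) (z + Complex s t) \<le> real n * c * lattice_density m r (z + Complex s t) + 1"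
          unfolding lap\<psi>[OF inB[OF st]] lap using d'(3) by (simp add: algebra_simps)
      qed
      also have "\<dots> = pi + 1 / (real m)\<^sup>2"
        using square_flux_affine[OF z m r(1,2), of "real n * c" 1] ncC by (simp add: \<epsilon>_def)
      also have "\<dots> \<le> pi + 1"
      proof -
        have "1 \<le> (real m)\<^sup>2" using m by (intro one_le_power) simp
        then show ?thesis by (simp add: divide_le_eq)
      qed
      finally show "cos (square_flux (laplacian (\<lambda>z. real n * \<psi> z)) z \<epsilon>) \<le> 0"
        by (rule cos_nonpos_beyond_pi[OF lower])
    next
      let ?A = "ball 0 1 \<inter> T - P" and ?B = "{z \<in> ball 0 1. 0 < \<beta> z \<and> \<beta> z < (4 * real k + 1) / real n}"
      have "R \<subseteq> ?A \<union> ?B"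
        using n by (auto simp: R_def H_def P_def field_simps)
      moreover have sA: "?A \<in> sets borel" using oT oP by auto
      moreover have sB: "?B \<in> sets borel" by measurable
      ultimately have "emeasure lborel R \<le> emeasure lborel (?A \<union> ?B)"
        by (intro emeasure_mono) auto
      also have "\<dots> \<le> emeasure lborel ?A + emeasure lborel ?B"
        using sA sB by (intro emeasure_subadditive) auto
      also have "\<dots> \<le> ennreal (\<kappa> / 2) + ennreal (\<kappa> / 2)"
        using tube sub by (intro add_mono) (auto simp: T_def)
      also have "\<dots> = ennreal (\<kappa> / 2 + \<kappa> / 2)"
        by (rule ennreal_plus[symmetric]) (use \<kappa> in auto)
      finally show "emeasure lborel R \<le> ennreal (1 / (16 * (1 + real k)\<^sup>2))"
        by (simp add: \<kappa>_def)
    qed simp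
  qed
  show ?thesis
    by (rule that[OF sm lap_nonneg thin part v'(1) v'0 v'(5,6) d'(1,2) n(2) large])
qed

section \<open>The limit of the construction\<close>

text \<open>A stage consists of the potential that it adds, the sum of all Laplacians so far, the current trial
  function, the total size that all later Laplacians may have, and the multiple \<open>n\<close> at which the magnetic energy is
  large.\<close>

type_synonym stage = "(complex \<Rightarrow> real) \<times> (complex \<Rightarrow> real) \<times> (complex \<Rightarrow> complex) \<times> real \<times> nat"

definition stage_inv :: "real \<Rightarrow> real \<Rightarrow> nat \<Rightarrow> stage \<Rightarrow> bool" where
  "stage_inv g \<mu> k = (\<lambda>(\<phi>, \<beta>, v, d, n).
     smooth_on UNIV \<phi> \<and> (\<forall>z. 0 \<le> laplacian \<phi> z) \<and> continuous_on UNIV \<beta> \<and> (\<forall>z. 0 \<le> \<beta> z) \<and> tame {z. 0 < \<beta> z} \<and>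
     trial v \<and> (\<forall>z. v z \<noteq> 0 \<longrightarrow> \<beta> z = 0) \<and> dirichlet v < g \<and> \<mu> < mass v \<and> 0 < d \<and> d \<le> (1/2)^k \<and>
     (k = 0 \<longrightarrow> (\<forall>z. \<beta> z = 0)))"

definition stage_step :: "nat \<Rightarrow> stage \<Rightarrow> stage \<Rightarrow> bool" where
  "stage_step k = (\<lambda>(\<phi>, \<beta>, v, d, n) (\<phi>', \<beta>', v', d', n').
     (\<forall>z. \<beta>' z = \<beta> z + laplacian \<phi>' z) \<and>
     (\<forall>l z. length l \<le> k + 2 \<longrightarrow> z \<in> ball 0 4 \<longrightarrow> \<bar>partials l \<phi>' z\<bar> \<le> d / 4) \<and> d' \<le> d / 2 \<and> k \<le> n' \<and>
     (\<forall>\<psi>. smooth_on (ball 0 4) \<psi> \<longrightarrow>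
        (\<forall>z\<in>ball 0 4. \<beta>' z \<le> laplacian \<psi> z \<and> laplacian \<psi> z \<le> \<beta>' z + d') \<longrightarrow>
        ereal (real k) \<le> lambda_m (ball 0 1) (\<lambda>z. real n' * \<psi> z)))"

lemma stage_exists:
  assumes "trial v0" "dirichlet v0 < g" "\<mu> < mass v0"
  shows "\<exists>f. \<forall>k. stage_inv g \<mu> k (f k) \<and> stage_step k (f k) (f (Suc k))"
proof (rule dependent_nat_choice)
  have "smooth_on UNIV (\<lambda>_. 0 :: real)" by (rule smooth_on_const)
  moreover have "laplacian (\<lambda>_. 0) z = 0" for z
    by (simp add: laplacian_def partial_x_def[abs_def] partial_y_def[abs_def])
  ultimately have "stage_inv g \<mu> 0 (\<lambda>_. 0, \<lambda>_. 0, v0, 1, 0)"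
    using assms by (simp add: stage_inv_def tame_empty)
  then show "\<exists>x. stage_inv g \<mu> 0 x" ..
next
  fix x k assume inv: "stage_inv g \<mu> k x"
  obtain \<phi> \<beta> v d n where x: "x = (\<phi>, \<beta>, v, d, n)" by (cases x)
  have \<beta>: "continuous_on UNIV \<beta>" "\<And>z. 0 \<le> \<beta> z" "tame {z. 0 < \<beta> z}"
    and v: "trial v" "\<And>z. v z \<noteq> 0 \<Longrightarrow> \<beta> z = 0" "dirichlet v < g" "\<mu> < mass v" and d: "0 < d" "d \<le> (1/2)^k"
    using inv by (simp_all add: stage_inv_def x)
  show "\<exists>y. stage_inv g \<mu> (Suc k) y \<and> stage_step k x y"
  proof (rule next_stage[OF \<beta> v d(1), of k])
    fix \<phi>' v' d' n'
    assume \<phi>': "smooth_on UNIV \<phi>'" "\<And>z. 0 \<le> laplacian \<phi>' z" "tame {z. 0 < \<beta> z + laplacian \<phi>' z}"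
      "\<And>l z. length l \<le> k + 2 \<Longrightarrow> z \<in> ball 0 4 \<Longrightarrow> \<bar>partials l \<phi>' z\<bar> \<le> d / 4"
      and v': "trial v'" "\<And>z. v' z \<noteq> 0 \<Longrightarrow> \<beta> z + laplacian \<phi>' z = 0" "dirichlet v' < g" "\<mu> < mass v'"
      and d': "0 < d'" "d' \<le> d / 2" "k \<le> n'"
      and large: "\<And>\<psi>. smooth_on (ball 0 4) \<psi> \<Longrightarrow>
      (\<And>z. z \<in> ball 0 4 \<Longrightarrow> \<beta> z + laplacian \<phi>' z \<le> laplacian \<psi> z \<and> laplacian \<psi> z \<le> \<beta> z + laplacian \<phi>' z + d') \<Longrightarrow>
      ereal (real k) \<le> lambda_m (ball 0 1) (\<lambda>z. real n' * \<psi> z)"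
    let ?y = "(\<phi>', \<lambda>z. \<beta> z + laplacian \<phi>' z, v', d', n')"
    have "continuous_on UNIV (\<lambda>z. \<beta> z + laplacian \<phi>' z)"
      by (rule continuous_on_add[OF \<beta>(1) smooth_on_continuous[OF smooth_on_laplacian[OF open_UNIV \<phi>'(1)]]])
    moreover have "d' \<le> (1/2) ^ Suc k" using d'(2) d(2) by simp
    ultimately have "stage_inv g \<mu> (Suc k) ?y"
      unfolding stage_inv_def prod.case using \<phi>'(1-3) v' d' \<beta>(2) by (intro conjI allI impI add_nonneg_nonneg) auto
    moreover have "stage_step k x ?y"
      unfolding stage_step_def x prod.case
    proof (intro conjI allI impI)
      fix \<psi> assume "smooth_on (ball 0 4) \<psi>" and
        "\<forall>z\<in>ball 0 4. \<beta> z + laplacian \<phi>' z \<le> laplacian \<psi> z \<and> laplacian \<psi> z \<le> \<beta> z + laplacian \<phi>' z + d'"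
      then show "ereal (real k) \<le> lambda_m (ball 0 1) (\<lambda>z. real n' * \<psi> z)"
        by (intro large) (simp_all del: mem_ball)
    qed (use \<phi>'(4) d' in auto)
    ultimately show ?thesis by blast
  qed
qed

theorem proposition1p4:
  fixes \<Omega>\<^sub>0 :: "complex set"
  assumes "\<Omega>\<^sub>0 = ball 0 1"
  shows "\<exists>\<phi> :: complex \<Rightarrow> real.
           smooth_on \<Omega>\<^sub>0 \<phi> \<and> subharmonic_on \<Omega>\<^sub>0 \<phi> \<and>
           (SUP n\<in>{1::nat..}. lambda_e \<Omega>\<^sub>0 (\<lambda>z. real n * \<phi> z)) < \<infinity> \<and>
           limsup (\<lambda>n. lambda_m \<Omega>\<^sub>0 (\<lambda>z. real n * \<phi> z)) = \<infinity>"
proof -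
  let ?S = "ball (0::complex) 1" and ?T = "ball (0::complex) 4"
  obtain v0 where v0: "trial v0" "0 < mass v0" using trial_exists by blast
  define g where "g = dirichlet v0 + 1"
  define \<mu> where "\<mu> = mass v0 / 2"
  have \<mu>: "0 < \<mu>" using v0 by (simp add: \<mu>_def)
  obtain f where f: "\<And>k. stage_inv g \<mu> k (f k)" "\<And>k. stage_step k (f k) (f (Suc k))"
    using stage_exists[of v0 g \<mu>] v0 by (auto simp: g_def \<mu>_def)
  define \<phi> where "\<phi> k = fst (f k)" for k
  define \<beta> where "\<beta> k = fst (snd (f k))" for k
  define v where "v k = fst (snd (snd (f k)))" for k
  define d where "d k = fst (snd (snd (snd (f k))))" for k
  define n where "n k = snd (snd (snd (snd (f k))))" for k
  have fk: "f k = (\<phi> k, \<beta> k, v k, d k, n k)" for k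
    by (simp add: \<phi>_def \<beta>_def v_def d_def n_def)
  have inv: "smooth_on UNIV (\<phi> k)" "0 \<le> laplacian (\<phi> k) z" "trial (v k)" "v k z \<noteq> 0 \<Longrightarrow> \<beta> k z = 0"
    "dirichlet (v k) < g" "\<mu> < mass (v k)" "0 < d k" "d k \<le> (1/2)^k" for k z
    using f(1)[of k] unfolding fk stage_inv_def by auto
  have step: "\<beta> (Suc k) z = \<beta> k z + laplacian (\<phi> (Suc k)) z" "d (Suc k) \<le> d k / 2" "k \<le> n (Suc k)" for k z
    using f(2)[of k] unfolding fk stage_step_def by auto
  have small: "\<bar>partials l (\<phi> (Suc k)) z\<bar> \<le> d k / 4" if "length l \<le> k + 2" "z \<in> ?T" for l k z
    using f(2)[of k] that unfolding fk stage_step_def by auto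
  have large: "ereal (real k) \<le> lambda_m ?S (\<lambda>z. real (n (Suc k)) * \<psi> z)"
    if "smooth_on ?T \<psi>" "\<And>z. z \<in> ?T \<Longrightarrow> \<beta> (Suc k) z \<le> laplacian \<psi> z \<and> laplacian \<psi> z \<le> \<beta> (Suc k) z + d (Suc k)" for k \<psi>
  proof -
    have "\<forall>\<psi>. smooth_on ?T \<psi> \<longrightarrow>
        (\<forall>z\<in>?T. \<beta> (Suc k) z \<le> laplacian \<psi> z \<and> laplacian \<psi> z \<le> \<beta> (Suc k) z + d (Suc k)) \<longrightarrow>
        ereal (real k) \<le> lambda_m ?S (\<lambda>z. real (n (Suc k)) * \<psi> z)"
      using f(2)[of k] unfolding fk stage_step_def prod.case by (elim conjE)
    from this[rule_format, OF that] show ?thesis .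
  qed
  \<comment> \<open>The sum starts with the first stage, since the initial one contributes no potential. For a fixed multi-index
    \<open>l\<close>, the stages before \<open>length l\<close> need not be small, but there are only finitely many of them.\<close>
  define \<Phi> where "\<Phi> z = (\<Sum>j. \<phi> (Suc j) z)" for z
  have bd: "\<exists>a. summable a \<and> (\<forall>j. \<forall>z\<in>?T. \<bar>partials l (\<phi> (Suc j)) z\<bar> \<le> a j)" for l
  proof -
    have "\<exists>M>0. \<forall>l'. length l' \<le> length l \<longrightarrow> (\<forall>z\<in>cball 0 4. \<bar>partials l' (\<phi> (Suc j)) z\<bar> \<le> M)" for j
      by (rule partials_bounded[OF inv(1) compact_cball])
    then obtain M where M: "\<And>j z. z \<in> cball 0 4 \<Longrightarrow> \<bar>partials l (\<phi> (Suc j)) z\<bar> \<le> M j"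
      by (metis order_refl)
    define a where "a j = (if length l \<le> j + 2 then (1/2)^j else M j)" for j
    have "\<forall>\<^sub>F j in sequentially. a j = (1/2)^j"
      by (rule eventually_sequentiallyI[of "length l"]) (simp add: a_def)
    then have "summable a"
      by (subst summable_cong) (auto intro: summable_geometric)
    moreover have "\<bar>partials l (\<phi> (Suc j)) z\<bar> \<le> a j" if z: "z \<in> ?T" for j z
    proof (cases "length l \<le> j + 2")
      case True
      then show ?thesis using small[OF True z] inv(7)[of j] inv(8)[of j] by (simp add: a_def)
    next
      case False
      then show ?thesis using M[of z j] z by (simp add: a_def)
    qed
    ultimately show ?thesis by blast
  qed
  have smooth: "smooth_on ?T (\<phi> (Suc j))" for j
    by (rule smooth_on_subset[OF inv(1) subset_UNIV])
  note series = partials_suminf[OF open_ball convex_ball smooth bd, folded \<Phi>_def]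
  have lap_sums: "(\<lambda>j. laplacian (\<phi> (Suc j)) z) sums laplacian \<Phi> z" if "z \<in> ?T" for z
    unfolding laplacian_partials by (rule sums_add[OF series(2)[OF that] series(2)[OF that]])
  have \<beta>_sum: "\<beta> k z = \<beta> 0 z + (\<Sum>j<k. laplacian (\<phi> (Suc j)) z)" for k z
    by (induction k) (simp_all add: step)
  have \<beta>0: "\<beta> 0 z = 0" for z
    using f(1)[of 0] unfolding fk stage_inv_def by simp
  \<comment> \<open>The budget halves at each stage, and a stage uses at most half of it, so all later stages together add at
    most \<open>d k\<close> to the Laplacian.\<close>
  have d_decay: "d (i + k) \<le> d k * (1/2)^i" for i k
  proof (induction i)
    case (Suc i)
    then show ?case using step(2)[of "i + k"] by simp
  qed simp
  have sandwich: "\<beta> k z \<le> laplacian \<Phi> z \<and> laplacian \<Phi> z \<le> \<beta> k z + d k" if z: "z \<in> ?T" for k z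
  proof -
    note s = sums_split_initial_segment[OF lap_sums[OF z], of k]
    have tail: "laplacian (\<phi> (Suc (i + k))) z \<le> d k * ((1/2)^i * (1/2))" for i
    proof -
      have "laplacian (\<phi> (Suc (i + k))) z \<le> d (i + k) / 4 + d (i + k) / 4"
        unfolding laplacian_partials
        using small[of "[True, True]" "i + k" z] small[of "[False, False]" "i + k" z] z
        by (intro add_mono) (auto simp del: partials.simps mem_ball)
      also have "\<dots> \<le> d k * ((1/2)^i * (1/2))" using d_decay[of i k] by simp
      finally show ?thesis .
    qed
    have "(\<lambda>i. d k * ((1/2)^i * (1/2))) sums (d k * (1 / (1 - 1/2) * (1/2)))"
      by (intro sums_mult sums_mult2 geometric_sums) simp
    then have geo: "(\<lambda>i. d k * ((1/2)^i * (1/2))) sums d k" by simp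
    have "laplacian \<Phi> z - (\<Sum>j<k. laplacian (\<phi> (Suc j)) z) \<le> d k"
      by (rule sums_le[OF tail s geo])
    moreover have "0 \<le> laplacian \<Phi> z - (\<Sum>j<k. laplacian (\<phi> (Suc j)) z)"
      by (rule sums_le[OF inv(2) sums_zero s])
    ultimately show ?thesis using \<beta>_sum[of k z] \<beta>0[of z] by simp
  qed
  have \<beta>_nonneg: "0 \<le> \<beta> k z" for k z
  proof -
    have "0 \<le> (\<Sum>j<k. laplacian (\<phi> (Suc j)) z)" by (rule sum_nonneg[OF inv(2)])
    then show ?thesis using \<beta>_sum[of k z] \<beta>0[of z] by linarith
  qed
  have ST: "?S \<subseteq> ?T" by auto
  have sm: "smooth_on ?S \<Phi>" by (rule smooth_on_subset[OF series(1) ST])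
  have lap_nonneg: "0 \<le> laplacian \<Phi> z" if "z \<in> ?S" for z
    using sandwich[OF subsetD[OF ST that], of 0] \<beta>_nonneg[of 0 z] by linarith
  have sub: "subharmonic_on ?S \<Phi>"
    by (rule subharmonic_on_laplacian_nonneg[OF open_ball sm lap_nonneg])
  have electric: "lambda_e ?S (\<lambda>z. real N * \<Phi> z) \<le> ereal (g / \<mu> + 1)" for N
  proof -
    \<comment> \<open>On the support of the \<open>k\<close>-th trial function only the stages after \<open>k\<close> contribute, and these add at
      most \<open>1 / 2\<^sup>k\<close>.\<close>
    obtain k where k: "real N < 2 ^ k" using real_arch_pow[of 2 "real N"] by auto
    show ?thesis
    proof (rule lambda_e_le[OF inv(3,5,6) \<mu>])
      show "smooth_on ?S (\<lambda>z. real N * \<Phi> z)"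
        by (intro smooth_on_mult smooth_on_const sm open_ball)
      fix z :: complex assume z: "z \<in> ?S"
      then have zT: "z \<in> ?T" by auto
      have lap: "laplacian (\<lambda>z. real N * \<Phi> z) z = real N * laplacian \<Phi> z"
        by (rule laplacian_cmult[OF open_ball sm z])
      show "laplacian (\<lambda>z. real N * \<Phi> z) z * (cmod (v k z))\<^sup>2 \<le> (cmod (v k z))\<^sup>2"
      proof (cases "v k z = 0")
        case False
        then have "laplacian \<Phi> z \<le> (1/2)^k" using sandwich[OF zT, of k] inv(4)[of k z] inv(8)[of k] by linarith
        then have "real N * laplacian \<Phi> z \<le> 2^k * (1/2)^k"
          using k lap_nonneg[OF z] by (intro mult_mono) auto
        also have "\<dots> = 1" by (simp add: power_one_over)
        finally show ?thesis unfolding lap by (intro mult_left_le_one_le) (use lap_nonneg[OF z] in auto)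
      qed simp
    qed
  qed
  have "(SUP N\<in>{1::nat..}. lambda_e ?S (\<lambda>z. real N * \<Phi> z)) \<le> ereal (g / \<mu> + 1)"
    by (rule SUP_least) (rule electric)
  then have e: "(SUP N\<in>{1::nat..}. lambda_e ?S (\<lambda>z. real N * \<Phi> z)) < \<infinity>"
    by (rule order.strict_trans1) simp
  have magnetic: "ereal (real k) \<le> lambda_m ?S (\<lambda>z. real (n (Suc k)) * \<Phi> z)" for k
    by (rule large[OF series(1) sandwich])
  have "ereal B \<le> limsup (\<lambda>N. lambda_m ?S (\<lambda>z. real N * \<Phi> z))" for B
    unfolding limsup_INF_SUP
  proof (rule INF_greatest)
    fix N
    obtain k0 :: nat where "B < real k0" using reals_Archimedean2 by blast
    define k where "k = max N k0"
    have "ereal B \<le> ereal (real k)" using \<open>B < real k0\<close> by (simp add: k_def)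
    also have "\<dots> \<le> lambda_m ?S (\<lambda>z. real (n (Suc k)) * \<Phi> z)" by (rule magnetic)
    also have "\<dots> \<le> (SUP N\<in>{N..}. lambda_m ?S (\<lambda>z. real N * \<Phi> z))"
      by (rule SUP_upper) (use step(3)[of k] in \<open>simp add: k_def\<close>)
    finally show "ereal B \<le> (SUP N\<in>{N..}. lambda_m ?S (\<lambda>z. real N * \<Phi> z))" .
  qed
  then have m: "limsup (\<lambda>N. lambda_m ?S (\<lambda>z. real N * \<Phi> z)) = \<infinity>"
    by (rule ereal_top)
  show ?thesis
    unfolding assms using sm sub e m by blast
qed

end
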